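(* Let $u\not\equiv-\infty$ be a subharmonic function on $\mathbb C$ such that $\mathsf{ord}[\mathsf B_u^{\mathrm{rad}}]<+\infty$. Then the following two statements (A) and (B) are equivalent. (A) For every $q\in\mathbb R^+$ there is an entire function $f_q\not\equiv 0$ such that, with $Q(z):=(1+|z|)^{-q}$, $$\log|f_q(z)|\le \mathsf B_u\bigl(z,Q(z)\bigr)\le \mathsf C_u\bigl(z,Q(z)\bigr)\le \mathsf M_u\bigl(z,Q(z)\bigr)\quad\text{for each } z\in\mathbb C.$$ (B) For every $q\in\mathbb R^+$ there are an entire function $f_q\not\equiv 0$ and an at most countable set of disks $D(z_k,t_k)$, $k=1,2,\dots$, such that $$\log|f_q(z)|\le u(z)\quad\text{for each } z\in\mathbb C\setminus E_q,\qquad\text{where } E_q:=\bigcup_k D(z_k,t_k),$$ $$\sup_k t_k\le 1,\qquad \sum_{|z_k|\ge R}t_k=O\Bigl(\frac1{R^q}\Bigr)\quad\text{as } R\to+\infty.$$ If moreover $\mathsf{ord}[u]<+\infty$, then statement (A), and likewise statement (B), can be supplemented by the following restrictions, i.e. for every $q\in\mathbb R^+$ the function $f_q$ in (A) (respectively, $f_q$ and the disks in (B)) can be chosen so that in addition: (o) $\mathsf{ord}\bigl[\log|f_q|\bigr]\le\mathsf{ord}[u]$; (t) $\mathsf{type}_p\bigl[\log|f_q|\bigr]\le\mathsf{type}_p[u]$ for each $p\in\mathbb R^+$; (i) $\mathsf{ind}_p\bigl[\log|f_q|\bigr](s)\le\mathsf{ind}_p[u](s)$ for all $s\in\mathbb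 R$ and for each $p\in\mathbb R^+$ for which these indicators are defined (that is, $\mathsf{type}_p[u]<+\infty$). Besides, for the sets $E_q$ in (B): for any ray $L\subset\mathbb C$, $$\mathsf{mes}\bigl((L\cap E_q)\setminus D(R)\bigr)=O\Bigl(\frac1{R^q}\Bigr)\quad\text{as } R\to+\infty,$$ and also $$\mathsf{mes}\bigl(E_q\cap\partial\overline D(R)\bigr)=O\Bigl(\frac1{R^q}\Bigr)\quad\text{as } R\to+\infty.$$
   Context: $\mathbb R^+:=\{x\in\mathbb R: x\ge 0\}$ (zero included), $\overline{\mathbb R}:=\mathbb R\cup\{\pm\infty\}$, $\overline{\mathbb R}^+:=\mathbb R^+\cup\{+\infty\}$, $x^+:=\max\{x,0\}$, and $m^+$ is the positive part of a function $m$. For $z\in\mathbb C$, $r\in\mathbb R^+$: $D(z,r):=\{z':|z'-z|<r\}$ (so $D(z,0)=\varnothing$), $\overline D(z,r):=\{z':|z'-z|\le r\}$, $\partial\overline D(z,r):=\overline D(z,r)\setminus D(z,r)$, $D(R):=D(0,R)$, $\overline D(R):=\overline D(0,R)$. All disk radii $t_k$ are in $\mathbb R^+$. For a subharmonic function $v$ on $\mathbb C$ and $r>0$: $$\mathsf C_v(z,r):=\frac1{2\pi}\int_0^{2\pi}v(z+re^{i\theta})\,d\theta,\qquad \mathsf B_v(z,r):=\frac2{r^2}\int_0^r\mathsf C_v(z,t)\,t\,dt,\qquad \mathsf M_v(z,r):=\sup_{z'\in\overline D(z,r)}v(z'),$$ and $\mathsf B_v^{\mathrm{rad}}(r):=\mathsf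 B_v(0,r)$, $\mathsf M_v^{\mathrm{rad}}(r):=\mathsf M_v(0,r)$. For an extended real function $m$ of $r$ (defined for large $r$) and $p\in\mathbb R^+$: $$\mathsf{ord}[m]:=\limsup_{r\to+\infty}\frac{\log(1+m^+(r))}{\log r}\in\overline{\mathbb R}^+,\qquad \mathsf{type}_p[m]:=\limsup_{r\to+\infty}\frac{m^+(r)}{r^p}\in\overline{\mathbb R}^+.$$ For a subharmonic function $v$ on $\mathbb C$: $\mathsf{ord}[v]:=\mathsf{ord}[\mathsf M_v^{\mathrm{rad}}]$, $\mathsf{type}_p[v]:=\mathsf{type}_p[\mathsf M_v^{\mathrm{rad}}]$, and, when $\mathsf{type}_p[v]<+\infty$, the indicator of growth of $v$ at the order $p$ is $$\mathsf{ind}_p[v](s):=\limsup_{r\to+\infty}\frac{v(re^{is})}{r^p},\quad s\in\mathbb R.$$ $\mathsf{mes}$ denotes linear Lebesgue measure on a ray and arc-length measure on a circle. *)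

theory Defs
  imports "HOL-Complex_Analysis.Complex_Analysis"
begin

(* Integral of an extended real function over A.  On ereal the library has
   \<infinity> - \<infinity> = \<infinity>; this case does not arise for integrands bounded above on a
   bounded set A, such as a subharmonic function on a circle. *)
definition ereal_integral :: "real set \<Rightarrow> (real \<Rightarrow> ereal) \<Rightarrow> ereal" where
  "ereal_integral A g =
     enn2ereal (\<integral>\<^sup>+x\<in>A. e2ennreal (max 0 (g x)) \<partial>lborel)
     - enn2ereal (\<integral>\<^sup>+x\<in>A. e2ennreal (max 0 (- g x)) \<partial>lborel)"

definition circle_mean :: "(complex \<Rightarrow> ereal) \<Rightarrow> complex \<Rightarrow> real \<Rightarrow> ereal" where
  "circle_mean v z r =
     ereal (1 / (2 * pi)) * ereal_integral {0..2*pi} (\<lambda>\<theta>. v (z + of_real r * cis \<theta>))"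

definition disk_mean :: "(complex \<Rightarrow> ereal) \<Rightarrow> complex \<Rightarrow> real \<Rightarrow> ereal" where
  "disk_mean v z r =
     ereal (2 / r\<^sup>2) * ereal_integral {0<..<r} (\<lambda>t. circle_mean v z t * ereal t)"

definition disk_sup :: "(complex \<Rightarrow> ereal) \<Rightarrow> complex \<Rightarrow> real \<Rightarrow> ereal" where
  "disk_sup v z r = (SUP z'\<in>cball z r. v z')"

(* Subharmonic on the whole plane; the constant -\<infinity> is admitted. *)
definition subharmonic :: "(complex \<Rightarrow> ereal) \<Rightarrow> bool" where
  "subharmonic v \<longleftrightarrow>
     (\<forall>z. v z < \<infinity>) \<and>
     (\<forall>a. open {z. v z < a}) \<and>
     (\<forall>z. \<forall>r>0. v z \<le> circle_mean v z r)"

definition elog :: "ereal \<Rightarrow> ereal" where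
  "elog x = (if x \<le> 0 then -\<infinity> else if x = \<infinity> then \<infinity> else ereal (ln (real_of_ereal x)))"

definition log_abs :: "(complex \<Rightarrow> complex) \<Rightarrow> complex \<Rightarrow> ereal" where
  "log_abs f z = elog (ereal (cmod (f z)))"

definition radial_order :: "(real \<Rightarrow> ereal) \<Rightarrow> ereal" where
  "radial_order m = Limsup at_top (\<lambda>r. elog (1 + max 0 (m r)) / ereal (ln r))"

definition radial_type :: "real \<Rightarrow> (real \<Rightarrow> ereal) \<Rightarrow> ereal" where
  "radial_type p m = Limsup at_top (\<lambda>r. max 0 (m r) / ereal (r powr p))"

definition growth_order :: "(complex \<Rightarrow> ereal) \<Rightarrow> ereal" where
  "growth_order v = radial_order (disk_sup v 0)"

definition growth_type :: "real \<Rightarrow> (complex \<Rightarrow> ereal) \<Rightarrow> ereal" where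
  "growth_type p v = radial_type p (disk_sup v 0)"

definition indicator_of_growth :: "real \<Rightarrow> (complex \<Rightarrow> ereal) \<Rightarrow> real \<Rightarrow> ereal" where
  "indicator_of_growth p v s = Limsup at_top (\<lambda>r. v (of_real r * cis s) / ereal (r powr p))"

definition nonzero_entire :: "(complex \<Rightarrow> complex) \<Rightarrow> bool" where
  "nonzero_entire f \<longleftrightarrow> f holomorphic_on UNIV \<and> (\<exists>z. f z \<noteq> 0)"

(* g(R) = O(1 / R^q) as R tends to +\<infinity>, for [0,\<infinity>]-valued g *)
definition bigo_inverse_power :: "real \<Rightarrow> (real \<Rightarrow> ennreal) \<Rightarrow> bool" where
  "bigo_inverse_power q g \<longleftrightarrow>
     (\<exists>C::real. eventually (\<lambda>R. g R \<le> ennreal (C * (1 / R powr q))) at_top)"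

definition minorant_by_means ::
    "(complex \<Rightarrow> ereal) \<Rightarrow> real \<Rightarrow> (complex \<Rightarrow> complex) \<Rightarrow> bool" where
  "minorant_by_means u q f \<longleftrightarrow>
     nonzero_entire f \<and>
     (\<forall>z. let Q = (1 + cmod z) powr (- q) in
        log_abs f z \<le> disk_mean u z Q \<and>
        disk_mean u z Q \<le> circle_mean u z Q \<and>
        circle_mean u z Q \<le> disk_sup u z Q)"

(* An at most countable family of disks is indexed by an arbitrary, possibly finite or
   empty, set K of natural numbers. *)
definition disk_union :: "nat set \<Rightarrow> (nat \<Rightarrow> complex) \<Rightarrow> (nat \<Rightarrow> real) \<Rightarrow> complex set" where
  "disk_union K c t = (\<Union>k\<in>K. ball (c k) (t k))"

definition minorant_off_disks ::
    "(complex \<Rightarrow> ereal) \<Rightarrow> real \<Rightarrow> (complex \<Rightarrow> complex) \<Rightarrow>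
     nat set \<Rightarrow> (nat \<Rightarrow> complex) \<Rightarrow> (nat \<Rightarrow> real) \<Rightarrow> bool" where
  "minorant_off_disks u q f K c t \<longleftrightarrow>
     nonzero_entire f \<and>
     (\<forall>z. z \<notin> disk_union K c t \<longrightarrow> log_abs f z \<le> u z) \<and>
     (\<forall>k\<in>K. 0 \<le> t k \<and> t k \<le> 1) \<and>
     bigo_inverse_power q (\<lambda>R. \<Sum>\<^sub>\<infinity>k\<in>{k\<in>K. cmod (c k) \<ge> R}. ennreal (t k))"

definition growth_restrictions :: "(complex \<Rightarrow> ereal) \<Rightarrow> (complex \<Rightarrow> complex) \<Rightarrow> bool" where
  "growth_restrictions u f \<longleftrightarrow>
     growth_order (log_abs f) \<le> growth_order u \<and>
     (\<forall>p\<ge>0. growth_type p (log_abs f) \<le> growth_type p u) \<and>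
     (\<forall>p\<ge>0. growth_type p u < \<infinity> \<longrightarrow>
        (\<forall>s. indicator_of_growth p (log_abs f) s \<le> indicator_of_growth p u s))"

(* Linear measure of the part of S on the ray from a in the direction w, |w| = 1. *)
definition ray_measure :: "complex \<Rightarrow> complex \<Rightarrow> complex set \<Rightarrow> ennreal" where
  "ray_measure a w S = emeasure lebesgue {s::real. 0 \<le> s \<and> a + of_real s * w \<in> S}"

(* Arc-length measure of the part of S on the circle of radius R about 0. *)
definition circle_measure :: "real \<Rightarrow> complex set \<Rightarrow> ennreal" where
  "circle_measure R S =
     ennreal R * emeasure lebesgue {\<theta>::real. 0 \<le> \<theta> \<and> \<theta> < 2 * pi \<and> of_real R * cis \<theta> \<in> S}"

end

theory Submission
  imports Defs
begin

text \<open>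
  Circle means of a subharmonic function are compared by pairing it with the averaged Laplacian of a
  compactly supported nonnegative combination of potentials \<open>ln (max t \<bar>w - z\<bar>)\<close>; this
  replaces the Riesz measure. It yields that \<open>C(z, t)\<close> is convex in \<open>ln t\<close>, hence
  \<open>C(z, r/2) \<le> B(z, r) \<le> C(z, r)\<close>, and that the increments \<open>C(z, t) - C(z, t/2)\<close>
  over disjoint disks add up to at most polynomial growth.

  From (A) to (B): where \<open>C(z, Q) > u(z) + 1\<close>, some dyadic radius \<open>t \<le> Q\<close> has an
  increment larger than \<open>t / (2 Q)\<close>. A Vitali subfamily of these disks has small total radius,
  and \<open>f / e\<close> works off them.

  From (B) to (A): for large \<open>\<bar>z\<bar>\<close> some circle around \<open>z\<close> of radius less than
  \<open>Q/2\<close> misses all disks, so that \<open>ln \<bar>f(z)\<bar> \<le> C(z, Q/2) \<le> B(z, Q)\<close>;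
  bounded \<open>z\<close> are handled by a constant factor.

  The minorant so obtained satisfies both estimates. Order and type follow from the first one. For the
  indicator, most points of a unit segment of the ray lie off the disks, and a two-constants theorem on the
  segment carries the bound by \<open>u\<close> to its midpoint.
\<close>

section \<open>Circle means\<close>

text \<open>For fixed \<open>e\<close> the operator taking \<open>v\<close> to
  \<open>cmean v w e - v w\<close> is symmetric under integration against functions of bounded
  support. This gives a Green formula with no smoothness and no distributions. Its price is an
  uncertainty \<open>e\<close> in every radius: a potential of radius \<open>t\<close> only controls
  means of radii between \<open>t - e\<close> and \<open>t + e\<close>. Hence comparisons are set up
  with room to spare in the radii, and \<open>e\<close> is chosen to fit that room. Since
  \<open>u\<close> may take the value -\<infinity>, all of this is done for functions bounded below
  and carried to \<open>u\<close> along its truncations. The polynomial bound on the increments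
  comes from the finite order, and its exponent \<open>N\<close> is paid for by using (A) at
  \<open>N + q + 1\<close>. Conversely (B) is used at \<open>q + 1\<close>, so that the tail of the
  radii falls below any fixed multiple of \<open>Q\<close>. The first estimate does not yield the
  indicator directly, because \<open>B(z, Q)\<close> involves values of \<open>u\<close> off the
  ray, while the indicator sees only the ray; so the same function is also kept below
  \<open>u\<close> off the disks.\<close>

definition circ :: "real measure" where
  "circ = uniform_measure lborel {0..<2*pi}"

text \<open>Real-valued counterpart of \<open>circle_mean\<close> as a Bochner integral: without
  integrability it is 0 by default, so the calculus below is tied to \<open>locbdd\<close>.\<close>

definition cmean :: "(complex \<Rightarrow> real) \<Rightarrow> complex \<Rightarrow> real \<Rightarrow> real" where
  "cmean v z r = (\<integral>\<theta>. v (z + of_real r * cis \<theta>) \<partial>circ)"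

text \<open>The class is closed under sums, products and circle means, yet each member is integrable
  on circles, and over the plane once its support is bounded.\<close>

definition locbdd :: "(complex \<Rightarrow> real) \<Rightarrow> bool" where
  "locbdd v \<longleftrightarrow> v \<in> borel_measurable borel \<and> (\<forall>R. \<exists>B. \<forall>w. cmod w \<le> R \<longrightarrow> \<bar>v w\<bar> \<le> B)"

lemma sets_circ [measurable_cong, simp]: "sets circ = sets borel"
  and space_circ [simp]: "space circ = UNIV"
  by (simp_all add: circ_def)

lemma emeasure_circ_UNIV [simp]: "emeasure circ UNIV = 1"
  unfolding circ_def by (subst emeasure_uniform_measure) (simp_all add: ennreal_divide_self)

lemma measure_circ_UNIV [simp]: "measure circ UNIV = 1"
  by (simp add: measure_def)

interpretation circ: finite_measure circ
  by standard simp

interpretation circ_circ: pair_sigma_finite circ circ ..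

interpretation lborel_circ: pair_sigma_finite "lborel :: complex measure" circ ..

interpretation real_circ: pair_sigma_finite "lborel :: real measure" circ ..

lemma nn_integral_circ:
  assumes [measurable]: "f \<in> borel_measurable borel"
  shows "(\<integral>\<^sup>+\<theta>. f \<theta> \<partial>circ) = (\<integral>\<^sup>+\<theta>. f \<theta> * indicator {0..<2*pi} \<theta> \<partial>lborel) / ennreal (2*pi)"
  unfolding circ_def by (subst nn_integral_uniform_measure) simp_all

lemma borel_measurable_cis [measurable]: "cis \<in> borel_measurable borel"
  by (intro borel_measurable_continuous_onI continuous_intros)

text \<open>The shifted interval is cut at \<open>2*pi\<close>; by periodicity the overhang moves
  back to \<open>{0..<\<phi>}\<close>.\<close>

lemma nn_integral_circ_shift:
  assumes [measurable]: "g \<in> borel_measurable borel" and \<phi>: "0 \<le> \<phi>" "\<phi> \<le> 2*pi"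
  shows "(\<integral>\<^sup>+\<theta>. g (cis (\<phi> + \<theta>)) \<partial>circ) = (\<integral>\<^sup>+\<theta>. g (cis \<theta>) \<partial>circ)"
proof -
  define h where "h = (\<lambda>\<theta>. g (cis \<theta>) :: ennreal)"
  have [measurable]: "h \<in> borel_measurable borel" unfolding h_def by measurable
  have per: "h (2*pi + x) = h x" for x
    by (simp add: h_def cis_mult [symmetric])
  have "(\<integral>\<^sup>+\<theta>. h (\<phi> + \<theta>) * indicator {0..<2*pi} \<theta> \<partial>lborel)
      = (\<integral>\<^sup>+\<theta>. h (\<phi> + \<theta>) * indicator {\<phi>..<\<phi>+2*pi} (\<phi> + \<theta>) \<partial>lborel)"
    by (intro nn_integral_cong) (auto split: split_indicator)
  also have "\<dots> = (\<integral>\<^sup>+\<theta>. h \<theta> * indicator {\<phi>..<\<phi>+2*pi} \<theta> \<partial>lborel)"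
    using nn_integral_real_affine[of "\<lambda>x. h x * indicator {\<phi>..<\<phi>+2*pi} x" 1 \<phi>] by simp
  also have "\<dots> = (\<integral>\<^sup>+\<theta>. h \<theta> * indicator {\<phi>..<2*pi} \<theta> + h \<theta> * indicator {2*pi..<2*pi+\<phi>} \<theta> \<partial>lborel)"
    using \<phi> by (intro nn_integral_cong) (auto split: split_indicator)
  also have "\<dots> = (\<integral>\<^sup>+\<theta>. h \<theta> * indicator {\<phi>..<2*pi} \<theta> \<partial>lborel) + (\<integral>\<^sup>+\<theta>. h \<theta> * indicator {2*pi..<2*pi+\<phi>} \<theta> \<partial>lborel)"
    by (intro nn_integral_add) measurable
  also have "(\<integral>\<^sup>+\<theta>. h \<theta> * indicator {2*pi..<2*pi+\<phi>} \<theta> \<partial>lborel)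
      = (\<integral>\<^sup>+\<theta>. h (2*pi + \<theta>) * indicator {2*pi..<2*pi+\<phi>} (2*pi + \<theta>) \<partial>lborel)"
    using nn_integral_real_affine[of "\<lambda>x. h x * indicator {2*pi..<2*pi+\<phi>} x" 1 "2*pi"] by simp
  also have "\<dots> = (\<integral>\<^sup>+\<theta>. h \<theta> * indicator {0..<\<phi>} \<theta> \<partial>lborel)"
    by (intro nn_integral_cong) (auto simp: per split: split_indicator)
  also have "(\<integral>\<^sup>+\<theta>. h \<theta> * indicator {\<phi>..<2*pi} \<theta> \<partial>lborel) + \<dots>
      = (\<integral>\<^sup>+\<theta>. h \<theta> * indicator {\<phi>..<2*pi} \<theta> + h \<theta> * indicator {0..<\<phi>} \<theta> \<partial>lborel)"
    by (intro nn_integral_add [symmetric]) measurable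
  also have "\<dots> = (\<integral>\<^sup>+\<theta>. h \<theta> * indicator {0..<2*pi} \<theta> \<partial>lborel)"
    using \<phi> by (intro nn_integral_cong) (auto split: split_indicator)
  finally have eq: "(\<integral>\<^sup>+\<theta>. h (\<phi> + \<theta>) * indicator {0..<2*pi} \<theta> \<partial>lborel)
      = (\<integral>\<^sup>+\<theta>. h \<theta> * indicator {0..<2*pi} \<theta> \<partial>lborel)" .
  have "(\<integral>\<^sup>+\<theta>. h (\<phi> + \<theta>) \<partial>circ) = (\<integral>\<^sup>+\<theta>. h \<theta> \<partial>circ)"
    by (simp add: nn_integral_circ eq)
  then show ?thesis by (simp add: h_def)
qed

lemma distr_circ_rotate:
  assumes "cmod c = 1"
  shows "distr circ borel (\<lambda>\<theta>. c * cis \<theta>) = distr circ borel cis"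
proof -
  obtain \<phi> where \<phi>: "0 \<le> \<phi>" "\<phi> \<le> 2*pi" "c = cis \<phi>"
    using Arg2pi_ge_0[of c] Arg2pi_lt_2pi[of c] complex_norm_eq_1_exp[of c] assms
    by (metis cis_conv_exp less_imp_le)
  have "emeasure (distr circ borel (\<lambda>\<theta>. c * cis \<theta>)) A = emeasure (distr circ borel cis) A"
    if A: "A \<in> sets borel" for A
  proof -
    have "(\<integral>\<^sup>+x. indicator A x \<partial>distr circ borel (\<lambda>\<theta>. c * cis \<theta>)) = (\<integral>\<^sup>+x. indicator A x \<partial>distr circ borel cis)"
      using nn_integral_circ_shift[of "indicator A" \<phi>] A \<phi>
      by (subst (1 2) nn_integral_distr) (auto simp: cis_mult [symmetric])
    then show ?thesis using A by simp
  qed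
  then show ?thesis
    by (intro measure_eqI) auto
qed

lemma integral_circ_rotate:
  fixes g :: "complex \<Rightarrow> real"
  assumes [measurable]: "g \<in> borel_measurable borel" and "cmod c = 1"
  shows "(\<integral>\<theta>. g (c * cis \<theta>) \<partial>circ) = (\<integral>\<theta>. g (cis \<theta>) \<partial>circ)"
proof -
  have "(\<integral>\<theta>. g (c * cis \<theta>) \<partial>circ) = (\<integral>x. g x \<partial>distr circ borel (\<lambda>\<theta>. c * cis \<theta>))"
    by (intro integral_distr [symmetric]) measurable
  also have "\<dots> = (\<integral>\<theta>. g (cis \<theta>) \<partial>circ)"
    by (subst distr_circ_rotate[OF assms(2)], intro integral_distr) measurable
  finally show ?thesis .
qed

text \<open>Only the modulus of a complex radius matters. With \<open>a = w - z\<close> the radial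
  function \<open>cmean v z (cmod (w - z))\<close> becomes an integral of \<open>v\<close> at points
  depending continuously on \<open>w\<close>, which is how its measurability and semicontinuity are
  obtained.\<close>

lemma cmean_rotate:
  assumes [measurable]: "v \<in> borel_measurable borel"
  shows "(\<integral>\<theta>. v (z + a * cis \<theta>) \<partial>circ) = cmean v z (cmod a)"
proof -
  have a: "a = cmod a * cis (Arg a)" by (cases "a = 0") (simp_all add: Arg_eq cis_conv_exp)
  have "(\<integral>\<theta>. v (z + a * cis \<theta>) \<partial>circ) = (\<integral>\<theta>. v (z + cmod a * (cis (Arg a) * cis \<theta>)) \<partial>circ)"
    by (subst a) (simp add: mult.assoc)
  also have "\<dots> = (\<integral>\<theta>. v (z + cmod a * cis \<theta>) \<partial>circ)"
    by (rule integral_circ_rotate) simp_all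
  finally show ?thesis by (simp add: cmean_def)
qed

text \<open>Any translation invariant measure that agrees with Lebesgue measure on the unit disk
  is Lebesgue measure, by Fubini.\<close>

lemma distr_lborel_rotate:
  assumes c: "cmod c = 1"
  shows "distr lborel borel ((*) c) = (lborel :: complex measure)"
proof -
  have "emeasure (distr lborel borel ((*) c)) B = emeasure (lborel :: complex measure) B"
    if [measurable]: "B \<in> sets borel" for B :: "complex set"
  proof -
    define A where "A = ball (0::complex) 1"
    have [measurable]: "A \<in> sets borel" by (simp add: A_def)
    have shift: "(\<integral>\<^sup>+y. f (a + y) \<partial>lborel) = (\<integral>\<^sup>+y. f y \<partial>lborel)"
      if [measurable]: "f \<in> borel_measurable borel" for f :: "complex \<Rightarrow> ennreal" and a
    proof -
      have "(\<integral>\<^sup>+y. f y \<partial>lborel) = (\<integral>\<^sup>+y. f y \<partial>distr lborel borel ((+) a))"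
        by (simp add: lborel_distr_plus)
      also have "\<dots> = (\<integral>\<^sup>+y. f (a + y) \<partial>lborel)"
        by (intro nn_integral_distr) auto
      finally show ?thesis by simp
    qed
    have normc: "cmod (c * x) = cmod x" for x using c by (simp add: norm_mult)
    let ?iA = "indicator A :: complex \<Rightarrow> ennreal" and ?iB = "indicator B :: complex \<Rightarrow> ennreal"
    have "emeasure lborel A * emeasure lborel B
        = (\<integral>\<^sup>+x. ?iA (c * x) * (\<integral>\<^sup>+y. ?iB y \<partial>lborel) \<partial>lborel)"
    proof -
      have "?iA (c * x) = ?iA x" for x by (simp add: A_def normc indicator_def)
      then show ?thesis by (subst nn_integral_multc) simp_all
    qed
    also have "\<dots> = (\<integral>\<^sup>+x. \<integral>\<^sup>+y. ?iA (c * x) * ?iB y \<partial>lborel \<partial>lborel)"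
      by (subst nn_integral_cmult) auto
    also have "\<dots> = (\<integral>\<^sup>+x. \<integral>\<^sup>+y. ?iA (c * x) * ?iB (c * x + y) \<partial>lborel \<partial>lborel)"
      by (intro nn_integral_cong shift [symmetric]) auto
    also have "\<dots> = (\<integral>\<^sup>+y. \<integral>\<^sup>+x. ?iA (c * x) * ?iB (c * x + y) \<partial>lborel \<partial>lborel)"
      by (intro lborel_pair.Fubini') auto
    also have "\<dots> = (\<integral>\<^sup>+y. \<integral>\<^sup>+x. ?iA (c * (x - y / c)) * ?iB (c * (x - y / c) + y) \<partial>lborel \<partial>lborel)"
    proof (rule nn_integral_cong)
      fix y
      show "(\<integral>\<^sup>+x. ?iA (c * x) * ?iB (c * x + y) \<partial>lborel)
         = (\<integral>\<^sup>+x. ?iA (c * (x - y / c)) * ?iB (c * (x - y / c) + y) \<partial>lborel)"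
        using shift[of "\<lambda>x. ?iA (c * x) * ?iB (c * x + y)" "- (y / c)"] by simp
    qed
    also have "\<dots> = (\<integral>\<^sup>+y. \<integral>\<^sup>+x. ?iA (y + - (c * x)) * ?iB (c * x) \<partial>lborel \<partial>lborel)"
    proof (rule nn_integral_cong, rule nn_integral_cong, rule arg_cong2[where f="(*)"])
      fix y x
      have "c \<noteq> 0" using c by auto
      then have *: "c * (x - y / c) = c * x - y" by (simp add: field_simps)
      show "?iA (c * (x - y / c)) = ?iA (y + - (c * x))"
        unfolding * A_def by (simp add: indicator_def norm_minus_commute)
      show "?iB (c * (x - y / c) + y) = ?iB (c * x)"
        unfolding * by simp
    qed
    also have "\<dots> = (\<integral>\<^sup>+x. \<integral>\<^sup>+y. ?iA (y + - (c * x)) * ?iB (c * x) \<partial>lborel \<partial>lborel)"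
      by (intro lborel_pair.Fubini') auto
    also have "\<dots> = (\<integral>\<^sup>+x. \<integral>\<^sup>+y. ?iA y * ?iB (c * x) \<partial>lborel \<partial>lborel)"
    proof (rule nn_integral_cong)
      fix x
      show "(\<integral>\<^sup>+y. ?iA (y + - (c * x)) * ?iB (c * x) \<partial>lborel) = (\<integral>\<^sup>+y. ?iA y * ?iB (c * x) \<partial>lborel)"
        using shift[of "\<lambda>y. ?iA y * ?iB (c * x)" "- (c * x)"] by (simp add: add.commute)
    qed
    also have "\<dots> = emeasure lborel A * (\<integral>\<^sup>+x. ?iB (c * x) \<partial>lborel)"
      by (simp add: nn_integral_multc nn_integral_cmult)
    also have "(\<integral>\<^sup>+x. ?iB (c * x) \<partial>lborel) = emeasure (distr lborel borel ((*) c)) B"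
      by (subst nn_integral_distr[where f="?iB" and M'=borel and T="(*) c", symmetric]) auto
    finally have "emeasure lborel A * emeasure lborel B = emeasure lborel A * emeasure (distr lborel borel ((*) c)) B" .
    moreover have "emeasure lborel A \<noteq> 0" "emeasure lborel A \<noteq> \<infinity>"
      using emeasure_lborel_ball_finite[of "0::complex" 1] content_ball_pos[of 1 "0::complex"]
      by (auto simp: A_def measure_def)
    ultimately show ?thesis
      by (simp add: ennreal_mult_cancel_left)
  qed
  then show ?thesis by (intro measure_eqI) auto
qed


lemma lborel_integral_translate:
  fixes f :: "complex \<Rightarrow> real"
  assumes [measurable]: "f \<in> borel_measurable borel"
  shows "(\<integral>w. f (a + w) \<partial>lborel) = (\<integral>w. f w \<partial>lborel)"
proof -
  have "(\<integral>w. f w \<partial>lborel) = (\<integral>w. f w \<partial>distr lborel borel ((+) a))"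
    by (simp add: lborel_distr_plus)
  also have "\<dots> = (\<integral>w. f (a + w) \<partial>lborel)"
    by (intro integral_distr) auto
  finally show ?thesis by simp
qed

lemma lborel_integral_rotate:
  fixes f :: "complex \<Rightarrow> real"
  assumes [measurable]: "f \<in> borel_measurable borel" and "cmod c = 1"
  shows "(\<integral>w. f (c * w) \<partial>lborel) = (\<integral>w. f w \<partial>lborel)"
proof -
  have "(\<integral>w. f w \<partial>lborel) = (\<integral>w. f w \<partial>distr lborel borel ((*) c))"
    by (simp add: distr_lborel_rotate assms)
  also have "\<dots> = (\<integral>w. f (c * w) \<partial>lborel)"
    by (intro integral_distr) auto
  finally show ?thesis by simp
qed

section \<open>Locally bounded functions and the algebra of their circle means\<close>

lemma locbdd_measurable [measurable_dest]: "locbdd v \<Longrightarrow> v \<in> borel_measurable borel"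
  by (simp add: locbdd_def)

lemma locbdd_bound:
  assumes "locbdd v"
  obtains B where "B \<ge> 0" "\<And>w. cmod w \<le> R \<Longrightarrow> \<bar>v w\<bar> \<le> B"
proof -
  obtain B where B: "\<And>w. cmod w \<le> R \<Longrightarrow> \<bar>v w\<bar> \<le> B" using assms by (auto simp: locbdd_def)
  show ?thesis
    using B by (intro that[of "max 0 B"]) (auto simp: le_max_iff_disj)
qed

lemma locbdd_continuous:
  assumes "continuous_on UNIV v"
  shows "locbdd v"
proof -
  have "\<exists>B. \<forall>w. cmod w \<le> R \<longrightarrow> \<bar>v w\<bar> \<le> B" for R
  proof -
    have "compact (v ` cball 0 R)"
      using assms by (intro compact_continuous_image) (auto intro: continuous_on_subset)
    then have "bounded (v ` cball 0 R)" by (rule compact_imp_bounded)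
    then obtain B where "\<forall>x\<in>v ` cball 0 R. norm x \<le> B" unfolding bounded_iff ..
    then show ?thesis by (intro exI[of _ B]) auto
  qed
  then show ?thesis
    using assms by (auto simp: locbdd_def intro: borel_measurable_continuous_onI)
qed

lemma locbdd_const [simp]: "locbdd (\<lambda>_. c)"
  by (intro locbdd_continuous continuous_intros)

lemma locbdd_add: 
  assumes "locbdd u" "locbdd v"
  shows "locbdd (\<lambda>w. u w + v w)"
proof -
  have "\<exists>B. \<forall>w. cmod w \<le> R \<longrightarrow> \<bar>u w + v w\<bar> \<le> B" for R
  proof -
    obtain B1 B2 where "\<And>w. cmod w \<le> R \<Longrightarrow> \<bar>u w\<bar> \<le> B1" "\<And>w. cmod w \<le> R \<Longrightarrow> \<bar>v w\<bar> \<le> B2"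
      using assms by (metis locbdd_bound)
    then show ?thesis by (intro exI[of _ "B1 + B2"]) (smt (verit))
  qed
  then show ?thesis using assms by (auto simp: locbdd_def)
qed

lemma locbdd_cmult: 
  assumes "locbdd v"
  shows "locbdd (\<lambda>w. c * v w)"
proof -
  have "\<exists>B. \<forall>w. cmod w \<le> R \<longrightarrow> \<bar>c * v w\<bar> \<le> B" for R
  proof -
    obtain B where "\<And>w. cmod w \<le> R \<Longrightarrow> \<bar>v w\<bar> \<le> B"
      using assms by (metis locbdd_bound)
    then show ?thesis by (intro exI[of _ "\<bar>c\<bar> * B"]) (auto simp: abs_mult mult_left_mono)
  qed
  then show ?thesis using assms by (auto simp: locbdd_def)
qed

lemma locbdd_mult:
  assumes "locbdd f" "locbdd g"
  shows "locbdd (\<lambda>w. f w * g w)"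
proof -
  have [measurable]: "f \<in> borel_measurable borel" "g \<in> borel_measurable borel" using assms by (simp_all add: locbdd_def)
  have "\<exists>B. \<forall>w. cmod w \<le> R \<longrightarrow> \<bar>f w * g w\<bar> \<le> B" for R
  proof -
    obtain B B' where "B \<ge> 0" "\<And>w. cmod w \<le> R \<Longrightarrow> \<bar>f w\<bar> \<le> B" "B' \<ge> 0" "\<And>w. cmod w \<le> R \<Longrightarrow> \<bar>g w\<bar> \<le> B'"
      using assms by (metis locbdd_bound)
    then show ?thesis
      by (intro exI[of _ "B * B'"]) (auto simp: abs_mult intro!: mult_mono)
  qed
  then show ?thesis by (simp add: locbdd_def)
qed

lemma locbdd_diff: "locbdd u \<Longrightarrow> locbdd v \<Longrightarrow> locbdd (\<lambda>w. u w - v w)"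
  using locbdd_add[of u "\<lambda>w. (-1) * v w"] locbdd_cmult[of v "-1"] by simp

lemma locbdd_sum: "(\<And>i. i \<in> I \<Longrightarrow> locbdd (f i)) \<Longrightarrow> locbdd (\<lambda>w. \<Sum>i\<in>I. f i w)"
  by (induction I rule: infinite_finite_induct) (auto intro: locbdd_add)

lemma integrable_circ_bounded:
  fixes h :: "real \<Rightarrow> real"
  assumes "h \<in> borel_measurable borel" "\<And>\<theta>. \<bar>h \<theta>\<bar> \<le> B"
  shows "integrable circ h"
  using assms by (intro circ.integrable_const_bound[of _ B]) (simp_all add: measurable_cong_sets[OF sets_circ refl])

lemma norm_circle_point_le: "cmod (z + of_real r * cis \<theta>) \<le> cmod z + \<bar>r\<bar>"
  by (rule order_trans[OF norm_triangle_ineq]) (simp add: norm_mult)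

lemma integrable_circle:
  assumes "locbdd v"
  shows "integrable circ (\<lambda>\<theta>. v (z + of_real r * cis \<theta>))"
proof -
  have [measurable]: "v \<in> borel_measurable borel" using assms by measurable
  obtain B where "\<And>w. cmod w \<le> cmod z + \<bar>r\<bar> \<Longrightarrow> \<bar>v w\<bar> \<le> B" using assms by (metis locbdd_bound)
  then show ?thesis
    by (intro integrable_circ_bounded[of _ B]) (auto intro: norm_circle_point_le)
qed

lemma cmean_mono:
  assumes "locbdd u" "locbdd v" "\<And>w. cmod (w - z) = \<bar>r\<bar> \<Longrightarrow> u w \<le> v w"
  shows "cmean u z r \<le> cmean v z r"
  unfolding cmean_def
  by (intro integral_mono integrable_circle assms) (simp add: norm_mult)

lemma cmean_const [simp]: "cmean (\<lambda>_. c) z r = c"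
  by (simp add: cmean_def)

lemma cmean_le:
  assumes "locbdd v" "\<And>w. cmod (w - z) = \<bar>r\<bar> \<Longrightarrow> v w \<le> c"
  shows "cmean v z r \<le> c"
  using cmean_mono[of v "\<lambda>_. c" z r] assms by simp

lemma cmean_ge:
  assumes "locbdd v" "\<And>w. cmod (w - z) = \<bar>r\<bar> \<Longrightarrow> c \<le> v w"
  shows "c \<le> cmean v z r"
  using cmean_mono[of "\<lambda>_. c" v z r] assms by simp

lemma cmean_zero [simp]: "cmean v z 0 = v z"
  by (simp add: cmean_def)

lemma cmean_add:
  assumes "locbdd u" "locbdd v"
  shows "cmean (\<lambda>w. u w + v w) z r = cmean u z r + cmean v z r"
  unfolding cmean_def by (intro Bochner_Integration.integral_add integrable_circle assms)

lemma cmean_cmult: "cmean (\<lambda>w. c * v w) z r = c * cmean v z r"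
  unfolding cmean_def by simp

lemma cmean_diff:
  assumes "locbdd u" "locbdd v"
  shows "cmean (\<lambda>w. u w - v w) z r = cmean u z r - cmean v z r"
  unfolding cmean_def by (intro Bochner_Integration.integral_diff integrable_circle assms)

lemma cmean_sum:
  assumes "\<And>i. i \<in> I \<Longrightarrow> locbdd (f i)"
  shows "cmean (\<lambda>w. \<Sum>i\<in>I. f i w) z r = (\<Sum>i\<in>I. cmean (f i) z r)"
  unfolding cmean_def by (intro Bochner_Integration.integral_sum integrable_circle assms)

lemma cmean_cong:
  assumes "\<And>w. cmod (w - z) = \<bar>r\<bar> \<Longrightarrow> u w = v w"
  shows "cmean u z r = cmean v z r"
  unfolding cmean_def by (intro Bochner_Integration.integral_cong assms) (simp_all add: norm_mult)

lemma locbdd_cmean_rad: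
  assumes "locbdd v"
    and [measurable]: "h \<in> borel_measurable borel" "a \<in> borel_measurable borel"
    and bd: "\<And>R. \<exists>R'. \<forall>w. cmod w \<le> R \<longrightarrow> cmod (h w) + cmod (a w) \<le> R'"
  shows "locbdd (\<lambda>w. \<integral>\<theta>. v (h w + a w * cis \<theta>) \<partial>circ)"
proof -
  have [measurable]: "v \<in> borel_measurable borel" using assms by measurable
  have "(\<lambda>w. \<integral>\<theta>. v (h w + a w * cis \<theta>) \<partial>circ) \<in> borel_measurable borel"
    by (intro circ.borel_measurable_lebesgue_integral) measurable
  moreover have "\<exists>B. \<forall>w. cmod w \<le> R \<longrightarrow> \<bar>\<integral>\<theta>. v (h w + a w * cis \<theta>) \<partial>circ\<bar> \<le> B" for R
  proof -
    obtain R' where R': "\<And>w. cmod w \<le> R \<Longrightarrow> cmod (h w) + cmod (a w) \<le> R'" using bd[of R] by blast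
    obtain B where B: "\<And>w. cmod w \<le> R' \<Longrightarrow> \<bar>v w\<bar> \<le> B" using assms by (metis locbdd_bound)
    have "\<bar>\<integral>\<theta>. v (h w + a w * cis \<theta>) \<partial>circ\<bar> \<le> B" if w: "cmod w \<le> R" for w
    proof -
      have vB: "\<bar>v (h w + a w * cis \<theta>)\<bar> \<le> B" for \<theta>
        using R'[OF w] norm_triangle_ineq[of "h w" "a w * cis \<theta>"] by (intro B) (simp add: norm_mult)
      have "norm (\<integral>\<theta>. v (h w + a w * cis \<theta>) \<partial>circ) \<le> (\<integral>\<theta>. norm (v (h w + a w * cis \<theta>)) \<partial>circ)"
        by (rule integral_norm_bound)
      also have "\<dots> \<le> (\<integral>\<theta>. B \<partial>circ)"
        using vB by (intro integral_mono integrable_norm integrable_circ_bounded[of _ B]) (auto intro: order_trans[OF abs_ge_zero])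
      finally show ?thesis by simp
    qed
    then show ?thesis by blast
  qed
  ultimately show ?thesis by (auto simp: locbdd_def)
qed

lemma locbdd_cmean:
  assumes "locbdd v"
  shows "locbdd (\<lambda>w. cmean v w r)"
  unfolding cmean_def
  by (rule locbdd_cmean_rad[OF assms]) (auto intro!: exI[of _ "_ + \<bar>r\<bar>"])

lemma locbdd_cmean_radial:
  assumes "locbdd v"
  shows "locbdd (\<lambda>w. cmean v z (cmod (w - z)))"
proof -
  have "\<exists>R'. \<forall>w. cmod w \<le> R \<longrightarrow> cmod z + cmod (w - z) \<le> R'" for R
    by (intro exI[of _ "2 * cmod z + R"]) (auto intro!: order_trans[OF norm_triangle_ineq4])
  then have "locbdd (\<lambda>w. \<integral>\<theta>. v (z + (w - z) * cis \<theta>) \<partial>circ)"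
    by (intro locbdd_cmean_rad[OF assms]) auto
  then show ?thesis using assms by (subst (asm) cmean_rotate) auto
qed

section \<open>Exchanging circle means with planar integrals\<close>

lemma integrable_lborel_compact_support:
  assumes "locbdd f" "\<And>w. cmod w > R \<Longrightarrow> f w = 0"
  shows "integrable lborel f"
proof -
  have [measurable]: "f \<in> borel_measurable borel" using assms by measurable
  obtain B where "\<And>w. cmod w \<le> R \<Longrightarrow> \<bar>f w\<bar> \<le> B" using assms by (metis locbdd_bound)
  then show ?thesis
    using assms(2) by (intro integrableI_bounded_set[where A="cball 0 R" and B=B])
       (use emeasure_lborel_cball_finite[of "0::complex" R] in \<open>auto simp: not_le\<close>)
qed

lemma integrable_pair_compact_support:
  assumes [measurable]: "case_prod f \<in> borel_measurable (borel \<Otimes>\<^sub>M borel)"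
    and B: "\<And>w \<theta>. cmod w \<le> R \<Longrightarrow> \<bar>f w \<theta>\<bar> \<le> B" and z: "\<And>w \<theta>. cmod w > R \<Longrightarrow> f w \<theta> = 0"
  shows "integrable (lborel \<Otimes>\<^sub>M circ) (case_prod f :: complex \<times> real \<Rightarrow> real)"
proof (intro integrableI_bounded_set[where A="cball 0 R \<times> UNIV" and B=B])
  have z': "cmod w \<le> R" if "f w \<theta> \<noteq> 0" for w \<theta>
    using z[of w \<theta>] that by (meson not_le)
  show "AE x in lborel \<Otimes>\<^sub>M circ. x \<notin> cball 0 R \<times> UNIV \<longrightarrow> case_prod f x = 0"
    using z' by (auto intro!: AE_I2)
  show "cball 0 R \<times> UNIV \<in> sets (lborel \<Otimes>\<^sub>M circ)" by (auto intro!: pair_measureI)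
  show "case_prod f \<in> borel_measurable (lborel \<Otimes>\<^sub>M circ)" by measurable
  have "emeasure (lborel \<Otimes>\<^sub>M circ) (cball (0::complex) R \<times> UNIV) = emeasure lborel (cball (0::complex) R) * emeasure circ UNIV"
    by (rule circ.emeasure_pair_measure_Times) auto
  then show "emeasure (lborel \<Otimes>\<^sub>M circ) (cball (0::complex) R \<times> UNIV) < \<infinity>"
    using emeasure_lborel_cball_finite[of "0::complex" R] by simp
qed (use B in \<open>auto intro!: AE_I2\<close>)

text \<open>For each angle a translation by \<open>e * cis \<theta>\<close> moves the average from
  \<open>v\<close> to \<open>W\<close> with the sign of \<open>e\<close> reversed, and a circle is
  symmetric about its centre. Fubini applies since \<open>W\<close> has bounded support.\<close>

lemma integral_cmean_symmetric:
  assumes v: "locbdd v" and W: "locbdd W" and supp: "\<And>w. cmod w > R \<Longrightarrow> W w = 0" and e: "e \<ge> 0"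
  shows "(\<integral>w. W w * cmean v w e \<partial>lborel) = (\<integral>w. v w * cmean W w e \<partial>lborel)"
proof -
  have [measurable]: "v \<in> borel_measurable borel" "W \<in> borel_measurable borel" using v W by measurable
  obtain Bv where Bv: "\<And>w. cmod w \<le> R + e \<Longrightarrow> \<bar>v w\<bar> \<le> Bv" "Bv \<ge> 0" using v by (metis locbdd_bound)
  obtain BW where BW: "\<And>w. cmod w \<le> R \<Longrightarrow> \<bar>W w\<bar> \<le> BW" "BW \<ge> 0" using W by (metis locbdd_bound)
  have BW': "\<bar>W w\<bar> \<le> BW" for w using BW supp[of w] by (cases "cmod w \<le> R") auto
  have "(\<integral>w. W w * cmean v w e \<partial>lborel) = (\<integral>w. \<integral>\<theta>. W w * v (w + e * cis \<theta>) \<partial>circ \<partial>lborel)"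
    by (simp add: cmean_def)
  also have "\<dots> = (\<integral>\<theta>. \<integral>w. W w * v (w + e * cis \<theta>) \<partial>lborel \<partial>circ)"
  proof (intro lborel_circ.Fubini_integral [symmetric] integrable_pair_compact_support[of _ R "BW * Bv"])
    fix w \<theta> assume w: "cmod w \<le> R"
    have "cmod (w + e * cis \<theta>) \<le> R + e"
      using norm_circle_point_le[of w e \<theta>] w e by simp
    then show "\<bar>W w * v (w + e * cis \<theta>)\<bar> \<le> BW * Bv"
      using BW Bv w by (auto simp: abs_mult intro!: mult_mono)
  qed (auto simp: supp)
  also have "\<dots> = (\<integral>\<theta>. \<integral>w. v w * W (w + (- e) * cis \<theta>) \<partial>lborel \<partial>circ)"
  proof (rule Bochner_Integration.integral_cong[OF refl])
    fix \<theta>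
    show "(\<integral>w. W w * v (w + e * cis \<theta>) \<partial>lborel) = (\<integral>w. v w * W (w + (- e) * cis \<theta>) \<partial>lborel)"
      using lborel_integral_translate[of "\<lambda>w. v w * W (w + (- e) * cis \<theta>)" "e * cis \<theta>"]
      by (simp add: mult.commute add.commute)
  qed
  also have "\<dots> = (\<integral>w. \<integral>\<theta>. v w * W (w + (- e) * cis \<theta>) \<partial>circ \<partial>lborel)"
  proof (intro lborel_circ.Fubini_integral integrable_pair_compact_support[of _ "R + e" "Bv * BW"])
    fix w \<theta> assume "cmod w \<le> R + e"
    then show "\<bar>v w * W (w + (- e) * cis \<theta>)\<bar> \<le> Bv * BW"
      using BW' Bv by (auto simp: abs_mult intro!: mult_mono)
  next
    fix w \<theta> assume "cmod w > R + e"
    then have "cmod (w + (- e) * cis \<theta>) > R"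
      using norm_triangle_ineq2[of w "e * cis \<theta>"] e by (simp add: norm_mult)
    then show "v w * W (w + (- e) * cis \<theta>) = 0" by (simp add: supp)
  qed auto
  also have "\<dots> = (\<integral>w. v w * cmean W w e \<partial>lborel)"
  proof (rule Bochner_Integration.integral_cong[OF refl])
    fix w
    show "(\<integral>\<theta>. v w * W (w + (- e) * cis \<theta>) \<partial>circ) = v w * cmean W w e"
      using cmean_rotate[of W w "- complex_of_real e"] e by simp
  qed
  finally show ?thesis .
qed

text \<open>Averaging the integral over all rotations about \<open>z\<close> changes nothing, since
  Lebesgue measure and \<open>k\<close> are rotation invariant; Fubini then replaces
  \<open>v\<close> by its mean over each circle.\<close>

lemma integral_radial:
  assumes v: "locbdd v" and k: "locbdd k" and supp: "\<And>w. cmod (w - z) > R \<Longrightarrow> k w = 0"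
    and rad: "\<And>w w'. cmod (w - z) = cmod (w' - z) \<Longrightarrow> k w = k w'"
  shows "(\<integral>w. v w * k w \<partial>lborel) = (\<integral>w. cmean v z (cmod (w - z)) * k w \<partial>lborel)"
proof -
  have [measurable]: "v \<in> borel_measurable borel" "k \<in> borel_measurable borel" using v k by measurable
  have [measurable]: "(\<lambda>w. cmean v z (cmod (w - z))) \<in> borel_measurable borel"
    using locbdd_cmean_radial[OF v] by (simp add: locbdd_def)
  obtain Bv where Bv: "\<And>w. cmod w \<le> cmod z + R \<Longrightarrow> \<bar>v w\<bar> \<le> Bv" "Bv \<ge> 0" using v by (metis locbdd_bound)
  obtain Bk where Bk: "\<And>w. cmod w \<le> cmod z + R \<Longrightarrow> \<bar>k w\<bar> \<le> Bk" "Bk \<ge> 0" using k by (metis locbdd_bound)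
  have rot: "(\<integral>w. v w * k w \<partial>lborel) = (\<integral>w. v (z + w * cis \<theta>) * k (z + w) \<partial>lborel)" for \<theta>
  proof -
    have "(\<integral>w. v w * k w \<partial>lborel) = (\<integral>w. v (z + w) * k (z + w) \<partial>lborel)"
      by (rule lborel_integral_translate [symmetric]) measurable
    also have "\<dots> = (\<integral>w. v (z + cis \<theta> * w) * k (z + cis \<theta> * w) \<partial>lborel)"
      by (rule lborel_integral_rotate [symmetric]) auto
    also have "\<dots> = (\<integral>w. v (z + w * cis \<theta>) * k (z + w) \<partial>lborel)"
    proof (rule Bochner_Integration.integral_cong[OF refl])
      fix w
      have "k (z + cis \<theta> * w) = k (z + w)" by (intro rad) (simp add: norm_mult)
      then show "v (z + cis \<theta> * w) * k (z + cis \<theta> * w) = v (z + w * cis \<theta>) * k (z + w)"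
        by (simp add: mult.commute)
    qed
    finally show ?thesis .
  qed
  have "(\<integral>w. v w * k w \<partial>lborel) = (\<integral>\<theta>. (\<integral>w. v w * k w \<partial>lborel) \<partial>circ)"
    by simp
  also have "\<dots> = (\<integral>\<theta>. \<integral>w. v (z + w * cis \<theta>) * k (z + w) \<partial>lborel \<partial>circ)"
    by (rule Bochner_Integration.integral_cong[OF refl rot])
  also have "\<dots> = (\<integral>w. \<integral>\<theta>. v (z + w * cis \<theta>) * k (z + w) \<partial>circ \<partial>lborel)"
  proof (intro lborel_circ.Fubini_integral integrable_pair_compact_support[of _ R "Bv * Bk"])
    fix w \<theta> assume w: "cmod w \<le> R"
    have "cmod (z + w * cis \<theta>) \<le> cmod z + R" "cmod (z + w) \<le> cmod z + R"
      using norm_triangle_ineq[of z "w * cis \<theta>"] norm_triangle_ineq[of z w] w by (simp_all add: norm_mult)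
    then show "\<bar>v (z + w * cis \<theta>) * k (z + w)\<bar> \<le> Bv * Bk"
      using Bv Bk by (auto simp: abs_mult intro!: mult_mono)
  qed (auto simp: supp)
  also have "\<dots> = (\<integral>w. cmean v z (cmod ((z + w) - z)) * k (z + w) \<partial>lborel)"
    by (simp add: cmean_rotate)
  also have "\<dots> = (\<integral>w. cmean v z (cmod (w - z)) * k w \<partial>lborel)"
    by (rule lborel_integral_translate) measurable
  finally show ?thesis .
qed

section \<open>The maximum principle\<close>

definition usc :: "(complex \<Rightarrow> real) \<Rightarrow> bool" where
  "usc v \<longleftrightarrow> (\<forall>a. open {z. v z < a})"

lemma usc_measurable: "usc v \<Longrightarrow> v \<in> borel_measurable borel"
  by (auto simp: usc_def intro!: borel_measurableI_less)

lemma usc_continuous: "continuous_on UNIV v \<Longrightarrow> usc v"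
  unfolding usc_def by (auto intro!: open_Collect_less continuous_on_const)

text \<open>Without a maximum the open sets \<open>{x. v x < v w}\<close> with \<open>w\<close> in
  \<open>K\<close> would cover \<open>K\<close>; a point with the largest of the finitely many
  values in a subcover is itself uncovered.\<close>

lemma usc_attains_max:
  assumes K: "compact K" "K \<noteq> {}" and v: "usc v"
  shows "\<exists>w\<in>K. \<forall>x\<in>K. v x \<le> v w"
proof (rule ccontr)
  assume "\<not> ?thesis"
  then have "K \<subseteq> (\<Union>w\<in>K. {x. v x < v w})" by (force simp: not_le)
  moreover have "open {x. v x < v w}" for w using v by (simp add: usc_def)
  ultimately obtain D where D: "D \<subseteq> K" "finite D" "K \<subseteq> (\<Union>w\<in>D. {x. v x < v w})"
    using compactE_image[OF K(1), of K "\<lambda>w. {x. v x < v w}"] by metis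
  then have "D \<noteq> {}" using K(2) by auto
  then have "Max (v ` D) \<in> v ` D" using D(2) by (intro Max_in) auto
  then obtain w where w: "w \<in> D" "v w = Max (v ` D)" by auto
  with D obtain w' where "w' \<in> D" "v w < v w'" by blast
  then show False using w D(2) by (simp add: leD)
qed

lemma usc_locbdd:
  assumes "usc v" "\<And>w. b \<le> v w"
  shows "locbdd v"
proof -
  have "\<exists>B. \<forall>w. cmod w \<le> R \<longrightarrow> \<bar>v w\<bar> \<le> B" for R
  proof (cases "R < 0")
    case True
    then have "\<not> cmod w \<le> R" for w by (simp add: not_le less_le_trans[OF _ norm_ge_zero])
    then show ?thesis by blast
  next
    case False
    then have "cball (0::complex) R \<noteq> {}" by simp
    then obtain w where "\<forall>x\<in>cball 0 R. v x \<le> v w"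
      using usc_attains_max[OF compact_cball _ assms(1), of 0 R] by blast
    then have "\<And>x. cmod x \<le> R \<Longrightarrow> v x \<le> v w" by simp
    then show ?thesis using assms(2) by (intro exI[of _ "\<bar>v w\<bar> + \<bar>b\<bar>"]) (smt (verit))
  qed
  then show ?thesis by (simp add: locbdd_def usc_measurable assms)
qed

lemma not_AE_circ: "\<not> (AE \<theta> in circ. \<theta> \<notin> {0<..<1})"
proof
  assume "AE \<theta> in circ. \<theta> \<notin> {0<..<1}"
  then have "AE \<theta> in lborel. \<theta> \<in> {0..<2*pi} \<longrightarrow> \<theta> \<notin> {0<..<1}"
    unfolding circ_def by (subst (asm) AE_uniform_measure) (simp_all add: ennreal_less_top)
  moreover have "{0<..<1} \<subseteq> {0..<2*pi}" using pi_gt3 by auto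
  ultimately have "AE \<theta> in lborel. \<theta> \<notin> {0<..<1::real}" by (auto elim!: eventually_mono)
  then have "emeasure lborel {0<..<1::real} = 0" by (subst (asm) AE_iff_measurable[where N="{0<..<1}"]) auto
  then show False by simp
qed

text \<open>A maximiser of maximal modulus must lie in \<open>\<Gamma>\<close>: on any circle around
  another maximiser \<open>w\<close> an arc of positive length has larger modulus than \<open>w\<close>.\<close>

lemma max_principle:
  assumes K: "compact K" and F: "usc F" "locbdd F"
    and sub: "\<And>w. w \<in> K \<Longrightarrow> w \<notin> \<Gamma> \<Longrightarrow> \<exists>r>0. cball w r \<subseteq> K \<and> F w \<le> cmean F w r"
    and bd: "\<And>w. w \<in> K \<Longrightarrow> w \<in> \<Gamma> \<Longrightarrow> F w \<le> M"
    and x: "x \<in> K"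
  shows "F x \<le> M"
proof -
  have [measurable]: "F \<in> borel_measurable borel" using F by (simp add: locbdd_def)
  obtain w1 where w1: "w1 \<in> K" "\<And>y. y \<in> K \<Longrightarrow> F y \<le> F w1"
    using usc_attains_max[OF K _ F(1)] x by blast
  define X where "X = K \<inter> - {w. F w < F w1}"
  have "compact X" using K F(1) unfolding X_def usc_def by (intro compact_Int_closed) auto
  moreover have "w1 \<in> X" using w1 by (simp add: X_def)
  ultimately obtain w0 where w0: "w0 \<in> X" "\<And>y. y \<in> X \<Longrightarrow> cmod y \<le> cmod w0"
    using continuous_attains_sup[of X cmod] by (auto intro: continuous_intros)
  have w0K: "w0 \<in> K" "F w0 = F w1" using w0 w1 by (auto simp: X_def not_less intro: antisym)
  show ?thesis
  proof (cases "w0 \<in> \<Gamma>")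
    case True
    then show ?thesis using bd[OF w0K(1)] w1(2)[OF x] w0K(2) by simp
  next
    case False
    then obtain r where r: "r > 0" "cball w0 r \<subseteq> K" "F w0 \<le> cmean F w0 r" using sub w0K by blast
    \<comment> \<open>Angles are measured from the outward radial direction at \<open>w0\<close>, so
      that every angle with positive cosine leads to a point of larger modulus. At the origin any
      direction serves.\<close>
    define u where "u = (if w0 = 0 then 1 else sgn w0)"
    have u: "cmod u = 1" by (simp add: u_def norm_sgn)
    have u2: "w0 = cmod w0 * u" by (simp add: u_def sgn_div_norm scaleR_conv_of_real)
    define g where "g = (\<lambda>\<theta>. F w0 - F (w0 + (r * u) * cis \<theta>))"
    have on_K: "w0 + (r * u) * cis \<theta> \<in> K" for \<theta>
      using r u by (intro subsetD[OF r(2)]) (simp add: dist_norm norm_mult)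
    have int: "integrable circ (\<lambda>\<theta>. F (w0 + (r * u) * cis \<theta>))"
    proof -
      obtain B where "\<And>w. cmod w \<le> cmod w0 + r \<Longrightarrow> \<bar>F w\<bar> \<le> B" using F(2) by (metis locbdd_bound)
      moreover have "cmod (w0 + (r * u) * cis \<theta>) \<le> cmod w0 + r" for \<theta>
        using norm_triangle_ineq[of w0 "(r * u) * cis \<theta>"] u r by (simp add: norm_mult)
      ultimately show ?thesis by (intro integrable_circ_bounded[of _ B]) auto
    qed
    \<comment> \<open>The deficit \<open>g\<close> is nonnegative because \<open>w0\<close> is a
      maximiser and the circle lies in \<open>K\<close>; the sub-mean value inequality makes its
      mean zero, so almost every point of the circle is a maximiser too.\<close>
    have g0: "g \<theta> \<ge> 0" for \<theta> using w1(2)[OF on_K] w0K(2) by (simp add: g_def)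
    have "(\<integral>\<theta>. g \<theta> \<partial>circ) = F w0 - cmean F w0 r"
      using int u r cmean_rotate[of F w0 "r * u"] by (simp add: g_def norm_mult)
    with r(3) have "(\<integral>\<theta>. g \<theta> \<partial>circ) = 0"
      using Bochner_Integration.integral_nonneg[of circ g] g0 by simp
    then have "AE \<theta> in circ. g \<theta> = 0"
      using int g0 by (subst (asm) integral_nonneg_eq_0_iff_AE) (auto simp: g_def)
    moreover have "g \<theta> \<noteq> 0" if \<theta>: "\<theta> \<in> {0<..<1}" for \<theta>
    proof
      assume "g \<theta> = 0"
      then have "w0 + (r * u) * cis \<theta> \<in> X" using on_K[of \<theta>] w0K by (simp add: g_def X_def)
      then have "cmod (w0 + (r * u) * cis \<theta>) \<le> cmod w0" by (rule w0(2))
      moreover have "w0 + (r * u) * cis \<theta> = u * (cmod w0 + r * cis \<theta>)"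
        by (subst u2) (simp add: algebra_simps)
      ultimately have "cmod (cmod w0 + r * cis \<theta>) \<le> cmod w0" using u by (simp add: norm_mult)
      moreover have "cmod w0 + r * cos \<theta> \<le> cmod (cmod w0 + r * cis \<theta>)"
        using complex_Re_le_cmod[of "cmod w0 + r * cis \<theta>"] by simp
      moreover have "cos \<theta> > 0" using \<theta> pi_gt3 by (intro cos_gt_zero) auto
      ultimately show False using r(1) by (smt (verit) mult_pos_pos)
    qed
    ultimately have "AE \<theta> in circ. \<theta> \<notin> {0<..<1}" by (auto elim!: eventually_mono)
    then show ?thesis using not_AE_circ by blast
  qed
qed

text \<open>Real subharmonic functions, bounded below. The sub-mean value inequality is required only for radii
  below a locally uniform bound; this is what can be checked directly for \<open>ln (max (exp (-n)) \<bar>f\<bar>)\<close>.\<close>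

definition rsh :: "(complex \<Rightarrow> real) \<Rightarrow> bool" where
  "rsh v \<longleftrightarrow> usc v \<and> (\<exists>b. \<forall>w. b \<le> v w) \<and>
     (\<forall>R. \<exists>e>0. \<forall>w r. cmod w \<le> R \<longrightarrow> 0 < r \<longrightarrow> r \<le> e \<longrightarrow> v w \<le> cmean v w r)"

lemma rsh_usc: "rsh v \<Longrightarrow> usc v"
  and rsh_locbdd: "rsh v \<Longrightarrow> locbdd v"
  by (auto simp: rsh_def intro: usc_locbdd)

text \<open>Fatou's lemma for the nonnegative functions \<open>B - v\<close>: upper semicontinuity
  of \<open>v\<close> is lower semicontinuity of the integrand at each angle. Openness is shown as
  sequential closedness of the complement.\<close>

lemma usc_radialise:
  assumes v: "usc v" and b: "\<And>w. b \<le> v w"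
  shows "usc (\<lambda>w. cmean v z (cmod (w - z)))"
  unfolding usc_def
proof
  fix a
  let ?U = "\<lambda>w. cmean v z (cmod (w - z))"
  have lv: "locbdd v" using v b by (rule usc_locbdd)
  have [measurable]: "v \<in> borel_measurable borel" using v by (rule usc_measurable)
  have "closed {w. a \<le> ?U w}"
    unfolding closed_sequential_limits
  proof (intro allI impI, elim conjE)
    fix x l assume x: "\<forall>n. x n \<in> {w. a \<le> ?U w}" and lim: "x \<longlonglongrightarrow> l"
    have "Bseq x" using lim by (intro convergent_imp_Bseq) (auto simp: convergent_def)
    then obtain R where R: "\<And>n. cmod (x n) \<le> R" by (auto simp: Bseq_def)
    then have Rl: "cmod l \<le> R" using lim by (intro Lim_bounded[OF tendsto_norm[OF lim], of 0]) auto
    obtain B where B: "\<And>w. cmod w \<le> 2 * cmod z + R \<Longrightarrow> \<bar>v w\<bar> \<le> B" using lv by (metis locbdd_bound)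
    have pt: "cmod (z + (y - z) * cis \<theta>) \<le> 2 * cmod z + R" if "cmod y \<le> R" for y \<theta>
      using norm_triangle_ineq[of z "(y - z) * cis \<theta>"] norm_triangle_ineq4[of y z] that by (simp add: norm_mult)
    have int: "integrable circ (\<lambda>\<theta>. v (z + (y - z) * cis \<theta>))" if "cmod y \<le> R" for y
      using B pt[OF that] by (intro integrable_circ_bounded[of _ B]) auto
    have val: "(\<integral>\<^sup>+\<theta>. ennreal (B - v (z + (y - z) * cis \<theta>)) \<partial>circ) = ennreal (B - ?U y)" if y: "cmod y \<le> R" for y
    proof -
      have "B - v (z + (y - z) * cis \<theta>) \<ge> 0" for \<theta> using B[OF pt[OF y]] by (smt (verit))
      then have "(\<integral>\<^sup>+\<theta>. ennreal (B - v (z + (y - z) * cis \<theta>)) \<partial>circ) = ennreal (\<integral>\<theta>. B - v (z + (y - z) * cis \<theta>) \<partial>circ)"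
        using int[OF y] by (intro nn_integral_eq_integral) auto
      also have "(\<integral>\<theta>. B - v (z + (y - z) * cis \<theta>) \<partial>circ) = B - ?U y"
        using int[OF y] by (simp add: cmean_rotate)
      finally show ?thesis .
    qed
    have "ennreal (B - ?U l) = (\<integral>\<^sup>+\<theta>. ennreal (B - v (z + (l - z) * cis \<theta>)) \<partial>circ)"
      using val[OF Rl] by simp
    also have "\<dots> \<le> (\<integral>\<^sup>+\<theta>. liminf (\<lambda>n. ennreal (B - v (z + (x n - z) * cis \<theta>))) \<partial>circ)"
    proof (rule nn_integral_mono)
      fix \<theta>
      show "ennreal (B - v (z + (l - z) * cis \<theta>)) \<le> liminf (\<lambda>n. ennreal (B - v (z + (x n - z) * cis \<theta>)))"
        unfolding le_Liminf_iff
      proof (intro allI impI)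
        fix y assume y: "y < ennreal (B - v (z + (l - z) * cis \<theta>))"
        then obtain c where c: "y = ennreal c" "c \<ge> 0"
          by (cases y) auto
        with y have "c < B - v (z + (l - z) * cis \<theta>)" by (simp add: ennreal_less_iff)
        then have "z + (l - z) * cis \<theta> \<in> {w. v w < B - c}" by simp
        moreover have "open {w. v w < B - c}" using v by (simp add: usc_def)
        moreover have "(\<lambda>n. z + (x n - z) * cis \<theta>) \<longlonglongrightarrow> z + (l - z) * cis \<theta>"
          by (intro tendsto_intros lim)
        ultimately have "eventually (\<lambda>n. z + (x n - z) * cis \<theta> \<in> {w. v w < B - c}) sequentially"
          by (auto dest: topological_tendstoD)
        then show "eventually (\<lambda>n. y < ennreal (B - v (z + (x n - z) * cis \<theta>))) sequentially"
          by eventually_elim (use c in \<open>auto simp: ennreal_less_iff\<close>)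
      qed
    qed
    also have "\<dots> \<le> liminf (\<lambda>n. \<integral>\<^sup>+\<theta>. ennreal (B - v (z + (x n - z) * cis \<theta>)) \<partial>circ)"
      by (rule nn_integral_liminf) measurable
    also have "\<dots> = liminf (\<lambda>n. ennreal (B - ?U (x n)))"
      using val R by simp
    also have "\<dots> \<le> liminf (\<lambda>n. ennreal (B - a))"
      using x by (intro Liminf_mono always_eventually) (auto intro!: ennreal_leI)
    also have "\<dots> = ennreal (B - a)" by (simp add: Liminf_const)
    finally have "ennreal (B - ?U l) \<le> ennreal (B - a)" .
    moreover have "?U l \<le> B" and "?U (x 0) \<le> B"
    proof -
      have "?U y \<le> B" if y: "cmod y \<le> R" for y
      proof (rule cmean_le[OF lv])
        fix w assume "cmod (w - z) = \<bar>cmod (y - z)\<bar>"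
        then have "cmod w \<le> 2 * cmod z + R"
          using norm_triangle_ineq4[of y z] norm_triangle_ineq[of "w - z" z] y by simp
        then show "v w \<le> B" using B[of w] by simp
      qed
      then show "?U l \<le> B" and "?U (x 0) \<le> B" using R Rl by auto
    qed
    moreover have "a \<le> ?U (x 0)" using x by auto
    ultimately show "l \<in> {w. a \<le> ?U w}" by (simp add: ennreal_le_iff)
  qed
  moreover have "- {w. a \<le> ?U w} = {w. ?U w < a}" by auto
  ultimately show "open {w. ?U w < a}" by (metis open_Compl)
qed

lemma rsh_radialise:
  assumes v: "rsh v"
  shows "rsh (\<lambda>w. cmean v z (cmod (w - z)))"
proof -
  obtain b where b: "\<And>w. b \<le> v w" using v by (auto simp: rsh_def)
  have lv: "locbdd v" using v by (rule rsh_locbdd)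
  have [measurable]: "v \<in> borel_measurable borel" using lv by (simp add: locbdd_def)
  let ?U = "\<lambda>w. cmean v z (cmod (w - z))"
  have U: "?U w = (\<integral>\<phi>. v (z + (w - z) * cis \<phi>) \<partial>circ)" for w by (simp add: cmean_rotate)
  have "\<exists>e>0. \<forall>w r. cmod w \<le> R \<longrightarrow> 0 < r \<longrightarrow> r \<le> e \<longrightarrow> ?U w \<le> cmean ?U w r" for R
  proof -
    obtain e where e: "e > 0" "\<And>w r. cmod w \<le> 2 * cmod z + R \<Longrightarrow> 0 < r \<Longrightarrow> r \<le> e \<Longrightarrow> v w \<le> cmean v w r"
      using v unfolding rsh_def by metis
    have "?U w \<le> cmean ?U w r" if w: "cmod w \<le> R" and r: "0 < r" "r \<le> e" for w r
    proof -
      have pt: "cmod (z + (y - z) * cis \<theta>) \<le> 2 * cmod z + cmod y" for y \<theta>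
        using norm_triangle_ineq[of z "(y - z) * cis \<theta>"] norm_triangle_ineq4[of y z] by (simp add: norm_mult)
      obtain B where B: "\<And>w. cmod w \<le> 2 * cmod z + (R + r) \<Longrightarrow> \<bar>v w\<bar> \<le> B" using lv by (metis locbdd_bound)
      have B': "\<bar>v (z + (w + r * cis \<theta> - z) * cis \<phi>)\<bar> \<le> B" for \<theta> \<phi>
        using pt[of "w + r * cis \<theta>" \<phi>] norm_circle_point_le[of w r \<theta>] w r by (intro B) auto
      have ptR: "cmod (z + (w - z) * cis \<phi>) \<le> 2 * cmod z + R" for \<phi>
        using pt[of w \<phi>] w by simp
      have ptRr: "cmod (z + (w - z) * cis \<phi>) \<le> 2 * cmod z + (R + r)" for \<phi>
        using ptR[of \<phi>] r by simp
      have "?U w \<le> (\<integral>\<phi>. cmean v (z + (w - z) * cis \<phi>) r \<partial>circ)"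
        unfolding U
      proof (rule integral_mono)
        show "integrable circ (\<lambda>\<phi>. v (z + (w - z) * cis \<phi>))"
          using ptRr by (intro integrable_circ_bounded[of _ B] B) auto
        have [measurable]: "(\<lambda>w. cmean v w r) \<in> borel_measurable borel"
          using locbdd_cmean[OF lv] by (simp add: locbdd_def)
        obtain B1 where "\<And>w. cmod w \<le> 2 * cmod z + R \<Longrightarrow> \<bar>cmean v w r\<bar> \<le> B1"
          using locbdd_cmean[OF lv, of r] by (metis locbdd_bound)
        then show "integrable circ (\<lambda>\<phi>. cmean v (z + (w - z) * cis \<phi>) r)"
          using ptR by (intro integrable_circ_bounded[of _ B1]) auto
        show "v (z + (w - z) * cis \<phi>) \<le> cmean v (z + (w - z) * cis \<phi>) r" for \<phi>
          using ptR r by (intro e) auto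
      qed
      \<comment> \<open>The circle about the rotated centre is the rotated image of the circle about
        \<open>w\<close>; the complex radius \<open>r * cis \<phi>\<close> matches the two
        parametrisations. Fubini then turns a mean of circle means of \<open>v\<close> into a circle
        mean of the radialised function.\<close>
      also have "\<dots> = (\<integral>\<phi>. \<integral>\<theta>. v (z + (w + r * cis \<theta> - z) * cis \<phi>) \<partial>circ \<partial>circ)"
      proof (rule Bochner_Integration.integral_cong[OF refl])
        fix \<phi>
        show "cmean v (z + (w - z) * cis \<phi>) r = (\<integral>\<theta>. v (z + (w + r * cis \<theta> - z) * cis \<phi>) \<partial>circ)"
          using cmean_rotate[of v "z + (w - z) * cis \<phi>" "r * cis \<phi>"] r
          by (simp add: norm_mult algebra_simps)
      qed
      also have "\<dots> = (\<integral>\<theta>. \<integral>\<phi>. v (z + (w + r * cis \<theta> - z) * cis \<phi>) \<partial>circ \<partial>circ)"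
      proof (rule circ_circ.Fubini_integral)
        have "finite_measure (circ \<Otimes>\<^sub>M circ)"
          by (rule finite_measureI) (simp add: circ.emeasure_pair_measure_Times space_pair_measure flip: UNIV_Times_UNIV)
        then show "integrable (circ \<Otimes>\<^sub>M circ) (\<lambda>(\<theta>, \<phi>). v (z + (w + r * cis \<theta> - z) * cis \<phi>))"
          using B' by (intro finite_measure.integrable_const_bound[where B=B]) auto
      qed
      also have "\<dots> = cmean ?U w r"
        by (subst cmean_def) (simp only: U)
      finally show ?thesis .
    qed
    then show ?thesis using e(1) by blast
  qed
  moreover have "usc ?U" using v b by (intro usc_radialise) (auto simp: rsh_def)
  moreover have "b \<le> ?U w" for w using b by (intro cmean_ge[OF lv])
  ultimately show ?thesis unfolding rsh_def by blast
qed

text \<open>The radialised function is constant on the sphere of radius \<open>t\<close>, with value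
  \<open>cmean v z t\<close>, and the maximum principle bounds it by that constant inside.\<close>

lemma rsh_cmean_mono:
  assumes v: "rsh v" and st: "0 \<le> s" "s \<le> t"
  shows "cmean v z s \<le> cmean v z t"
proof -
  let ?U = "\<lambda>w. cmean v z (cmod (w - z))"
  have U: "rsh ?U" by (rule rsh_radialise[OF v])
  obtain e where e: "e > 0" "\<And>w r. cmod w \<le> cmod z + t \<Longrightarrow> 0 < r \<Longrightarrow> r \<le> e \<Longrightarrow> ?U w \<le> cmean ?U w r"
    using U unfolding rsh_def by meson
  have "?U (z + s) \<le> cmean v z t"
  proof (rule max_principle[where F="?U" and x="z + s" and K="cball z t" and \<Gamma>="sphere z t"])
    show "usc ?U" using U by (rule rsh_usc)
    show "locbdd ?U" using U by (rule rsh_locbdd)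
    fix w assume w: "w \<in> cball z t" "w \<notin> sphere z t"
    define r where "r = min e (t - dist z w)"
    have "r > 0" using w e by (auto simp: r_def)
    moreover have "cball w r \<subseteq> cball z t"
    proof
      fix y assume "y \<in> cball w r"
      then show "y \<in> cball z t" using dist_triangle[of z y w] by (auto simp: r_def)
    qed
    moreover have "?U w \<le> cmean ?U w r"
      using w \<open>r > 0\<close> norm_triangle_ineq[of "w - z" z] by (intro e) (auto simp: r_def dist_norm norm_minus_commute)
    ultimately show "\<exists>r>0. cball w r \<subseteq> cball z t \<and> ?U w \<le> cmean ?U w r" by blast
  qed (use st in \<open>auto simp: dist_norm norm_minus_commute\<close>)
  then show ?thesis using st by simp
qed

text \<open>Radius zero in the monotonicity; this lifts the bound on the admissible radii in
  \<open>rsh\<close>.\<close>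

lemma rsh_submean: "rsh v \<Longrightarrow> 0 \<le> r \<Longrightarrow> v z \<le> cmean v z r"
  using rsh_cmean_mono[of v 0 r z] by simp

section \<open>Logarithmic potentials\<close>

lemma integral_circ:
  fixes f :: "real \<Rightarrow> real"
  assumes [measurable]: "f \<in> borel_measurable borel"
  shows "(\<integral>\<theta>. f \<theta> \<partial>circ) = (LINT \<theta>:{0..2*pi}|lborel. f \<theta>) / (2*pi)"
proof -
  have "circ = density lborel (\<lambda>x. ennreal (indicator {0..<2*pi} x / (2*pi)))"
    unfolding circ_def uniform_measure_def
    by (intro density_cong AE_I2) (auto simp: indicator_def divide_ennreal[symmetric] simp del: divide_ennreal)
  then have "(\<integral>\<theta>. f \<theta> \<partial>circ) = (\<integral>x. f x \<partial>density lborel (\<lambda>x. ennreal (indicator {0..<2*pi} x / (2*pi))))"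
    by (rule arg_cong[where f="\<lambda>M. integral\<^sup>L M f"])
  also have "\<dots> = (\<integral>x. (indicator {0..<2*pi} x / (2*pi)) *\<^sub>R f x \<partial>lborel)"
    by (intro integral_density) auto
  also have "\<dots> = (\<integral>x. (indicator {0..2*pi} x *\<^sub>R f x) / (2*pi) \<partial>lborel)"
    using AE_lborel_singleton[of "2*pi"]
    by (intro integral_cong_AE) (auto elim!: eventually_mono simp: indicator_def)
  finally show ?thesis by (simp add: set_lebesgue_integral_def)
qed

lemma integral_circ_continuous:
  fixes f :: "real \<Rightarrow> real"
  assumes "f \<in> borel_measurable borel" "continuous_on {0..2*pi} f" "(f has_integral I) {0..2*pi}"
  shows "(\<integral>\<theta>. f \<theta> \<partial>circ) = I / (2*pi)"
proof -
  have "set_integrable lborel {0..2*pi} f"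
    using assms(2) by (intro borel_integrable_atLeastAtMost')
  then have "(LINT \<theta>:{0..2*pi}|lborel. f \<theta>) = I"
    using set_borel_integral_eq_integral(2) integral_unique[OF assms(3)] by metis
  then show ?thesis by (simp add: integral_circ assms(1))
qed

text \<open>A zero-free \<open>g\<close> on the disk is \<open>exp h\<close>, so
  \<open>ln (cmod g)\<close> is the real part of \<open>h\<close>, and Cauchy's formula on the
  circle is the mean value property of \<open>h\<close>.\<close>

lemma cmean_ln_holomorphic:
  assumes g: "g holomorphic_on ball z R" and nz: "\<And>w. w \<in> ball z R \<Longrightarrow> g w \<noteq> 0" and r: "0 \<le> r" "r < R"
  shows "cmean (\<lambda>w. ln (cmod (g w))) z r = ln (cmod (g z))"
proof (cases "r = 0")
  case True
  then show ?thesis by simp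
next
  case False
  then have r0: "r > 0" using r by simp
  obtain h where h: "h holomorphic_on ball z R" "\<And>w. w \<in> ball z R \<Longrightarrow> exp (h w) = g w"
    using holomorphic_logarithm_exists[of "ball z R" g z] g nz r r0 by auto
  have on: "z + r * cis t \<in> ball z R" for t using r r0 by (simp add: dist_norm norm_mult)
  have ln: "ln (cmod (g w)) = Re (h w)" if "w \<in> ball z R" for w
    using h(2)[OF that] by (metis ln_exp norm_exp_eq_Re)
  have "((\<lambda>u. h u / (u - z)) has_contour_integral (2 * of_real pi * \<i> * h z)) (circlepath z r)"
    using r r0 h(1) by (intro Cauchy_integral_circlepath_simple) (auto intro: holomorphic_on_subset)
  then have "((\<lambda>t. h (z + r * cis t) / (z + r * cis t - z) * r * \<i> * cis t) has_integral (2 * of_real pi * \<i> * h z)) {0..2*pi}"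
    unfolding circlepath_def by (subst (asm) has_contour_integral_part_circlepath_iff) (auto simp: mult.assoc)
  then have "((\<lambda>t. \<i> * h (z + r * cis t)) has_integral (\<i> * (2 * of_real pi * h z))) {0..2*pi}"
    using r0 by (simp add: field_simps)
  from has_integral_mult_right[OF this, of "-\<i>"]
  have "((\<lambda>t. h (z + r * cis t)) has_integral (2 * of_real pi * h z)) {0..2*pi}"
    by (simp add: mult.assoc[symmetric])
  from has_integral_linear[OF this bounded_linear_Re]
  have I: "((\<lambda>t. Re (h (z + r * cis t))) has_integral (2 * pi * Re (h z))) {0..2*pi}"
    by (simp add: o_def)
  have "continuous_on (ball z R) h" using h(1) by (rule holomorphic_on_imp_continuous_on)
  then have c: "continuous_on UNIV (\<lambda>t. Re (h (z + r * cis t)))"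
    using on by (intro continuous_intros continuous_on_compose2[where f="\<lambda>t. z + r * cis t" and g=h and t="ball z R"]) auto
  have "(\<integral>\<theta>. Re (h (z + r * cis \<theta>)) \<partial>circ) = Re (h z)"
    using integral_circ_continuous[OF _ _ I] c
    by (auto intro: borel_measurable_continuous_onI continuous_on_subset)
  moreover have "cmean (\<lambda>w. ln (cmod (g w))) z r = (\<integral>\<theta>. Re (h (z + r * cis \<theta>)) \<partial>circ)"
    unfolding cmean_def using ln[OF on] by simp
  ultimately show ?thesis using ln[of z] r r0 by simp
qed

text \<open>Up to normalisation the logarithmic potential of the uniform distribution on the circle
  of radius \<open>t\<close> about \<open>z\<close>: its Laplacian lives on that circle, so pairing
  with it yields circle means.\<close>

definition lpot :: "real \<Rightarrow> complex \<Rightarrow> complex \<Rightarrow> real" where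
  "lpot t z w = ln (max t (cmod (w - z)))"

lemma continuous_lpot: "t > 0 \<Longrightarrow> continuous_on UNIV (lpot t z)"
  unfolding lpot_def by (intro continuous_intros) (auto simp: max_def)

lemma locbdd_lpot: "t > 0 \<Longrightarrow> locbdd (lpot t z)"
  by (intro locbdd_continuous continuous_lpot)

lemma lpot_mono: "0 < s \<Longrightarrow> s \<le> t \<Longrightarrow> lpot s z w \<le> lpot t z w"
  unfolding lpot_def by (subst ln_le_cancel_iff) auto

lemma lpot_outside: "cmod (w - z) \<ge> t \<Longrightarrow> lpot t z w = ln (cmod (w - z))"
  and lpot_inside: "cmod (w - z) \<le> t \<Longrightarrow> lpot t z w = ln t"
  by (simp_all add: lpot_def max_def)

lemma lpot_ge: "0 < t \<Longrightarrow> ln t \<le> lpot t z w"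
  unfolding lpot_def by (subst ln_le_cancel_iff) auto

lemma norm_circle_ge: "cmod (w' - w) = \<bar>e\<bar> \<Longrightarrow> 0 \<le> e \<Longrightarrow> cmod (w' - z) \<ge> cmod (w - z) - e"
  using norm_triangle_ineq[of "w' - z" "w - w'"] by (simp add: norm_minus_commute)

lemma norm_circle_le: "cmod (w' - w) = \<bar>e\<bar> \<Longrightarrow> 0 \<le> e \<Longrightarrow> cmod (w' - z) \<le> cmod (w - z) + e"
  using norm_triangle_ineq[of "w' - w" "w - z"] by simp

lemma cmean_lpot_far:
  assumes "0 \<le> e" "0 < t" "t + e \<le> cmod (w - z)"
  shows "cmean (lpot t z) w e = lpot t z w"
proof -
  have "cmean (lpot t z) w e = cmean (\<lambda>w. ln (cmod (w - z))) w e"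
  proof (rule cmean_cong)
    fix w' assume "cmod (w' - w) = \<bar>e\<bar>"
    from norm_circle_ge[OF this, of z] show "lpot t z w' = ln (cmod (w' - z))"
      using assms by (intro lpot_outside) auto
  qed
  also have "\<dots> = ln (cmod (w - z))"
    using assms by (intro cmean_ln_holomorphic[of _ _ "cmod (w - z)"] holomorphic_intros) (auto simp: dist_norm)
  also have "\<dots> = lpot t z w" using assms by (simp add: lpot_outside)
  finally show ?thesis .
qed

lemma cmean_lpot_near:
  assumes "0 \<le> e" "cmod (w - z) + e \<le> t"
  shows "cmean (lpot t z) w e = lpot t z w"
proof -
  have "cmean (lpot t z) w e = cmean (\<lambda>w. ln t) w e"
  proof (rule cmean_cong)
    fix w' assume "cmod (w' - w) = \<bar>e\<bar>"
    from norm_circle_le[OF this, of z] show "lpot t z w' = ln t"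
      using assms by (intro lpot_inside) auto
  qed
  then show ?thesis using assms by (simp add: lpot_inside)
qed

text \<open>Inside the disk \<open>ln t\<close> is the least value of the potential. Outside, the
  truncation is lowered to a radius \<open>s\<close> whose disk the circle about \<open>w\<close>
  does not enter: \<open>lpot s z\<close> agrees with \<open>lpot t z\<close> at \<open>w\<close>,
  has its own value there as mean, and lies below \<open>lpot t z\<close>.\<close>

lemma cmean_lpot_ge:
  assumes "0 \<le> e" "e < t"
  shows "lpot t z w \<le> cmean (lpot t z) w e"
proof (cases "cmod (w - z) \<le> t")
  case True
  then show ?thesis using assms by (auto simp: lpot_inside lpot_ge intro!: cmean_ge locbdd_lpot)
next
  case False
  define s where "s = min t (cmod (w - z) - e)"
  have s: "0 < s" "s \<le> t" "s + e \<le> cmod (w - z)" using assms False by (auto simp: s_def)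
  have "lpot t z w = lpot s z w" using False s by (simp add: lpot_outside)
  also have "\<dots> = cmean (lpot s z) w e" using s assms by (simp add: cmean_lpot_far)
  also have "\<dots> \<le> cmean (lpot t z) w e"
    using s by (intro cmean_mono locbdd_lpot lpot_mono) auto
  finally show ?thesis .
qed

lemma cmean_lpot_shift: "cmean (lpot t z) (z + w) e = cmean (lpot t 0) w e"
  unfolding cmean_def lpot_def by (simp add: algebra_simps)

text \<open>A finite-scale Laplacian of the potential: for \<open>e < t\<close> it is nonnegative,
  radial about \<open>z\<close>, and zero outside the annulus of half-width \<open>e\<close> about
  the circle of radius \<open>t\<close>.\<close>

definition lker :: "real \<Rightarrow> real \<Rightarrow> complex \<Rightarrow> complex \<Rightarrow> real" where
  "lker e t z w = cmean (lpot t z) w e - lpot t z w"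

lemma lker_nonneg: "0 \<le> e \<Longrightarrow> e < t \<Longrightarrow> 0 \<le> lker e t z w"
  by (simp add: lker_def cmean_lpot_ge)

lemma lker_eq_0: "0 \<le> e \<Longrightarrow> 0 < t \<Longrightarrow> e \<le> \<bar>cmod (w - z) - t\<bar> \<Longrightarrow> lker e t z w = 0"
  using cmean_lpot_far[of e t w z] cmean_lpot_near[of e w z t] by (auto simp: lker_def abs_if split: if_splits)

lemma locbdd_lker: "0 < t \<Longrightarrow> locbdd (lker e t z)"
  unfolding lker_def by (intro locbdd_diff locbdd_cmean locbdd_lpot)

lemma lpot_radial: "cmod (w - z) = cmod (w' - z) \<Longrightarrow> lpot t z w = lpot t z w'"
  by (simp add: lpot_def)

lemma lker_radial:
  assumes "0 < t" "cmod (w - z) = cmod (w' - z)"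
  shows "lker e t z w = lker e t z w'"
proof -
  define c where "c = (if w' = z then 1 else (w - z) / (w' - z))"
  have c: "cmod c = 1" "w - z = c * (w' - z)" using assms(2) by (auto simp: c_def norm_divide)
  have [measurable]: "lpot t z \<in> borel_measurable borel" using locbdd_lpot[OF assms(1), of z] by (simp add: locbdd_def)
  have "cmean (lpot t z) w e = (\<integral>\<theta>. lpot t z (w + c * e * cis \<theta>) \<partial>circ)"
  proof -
    have "(\<integral>\<theta>. lpot t z (w + (c * e) * cis \<theta>) \<partial>circ) = cmean (lpot t z) w \<bar>e\<bar>"
      by (subst cmean_rotate) (simp_all add: norm_mult c)
    moreover have "(\<integral>\<theta>. lpot t z (w + e * cis \<theta>) \<partial>circ) = cmean (lpot t z) w \<bar>e\<bar>"
      by (subst cmean_rotate) simp_all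
    ultimately show ?thesis by (simp add: cmean_def)
  qed
  also have "\<dots> = (\<integral>\<theta>. lpot t z (w' + e * cis \<theta>) \<partial>circ)"
  proof (rule Bochner_Integration.integral_cong[OF refl], rule lpot_radial)
    fix \<theta>
    have "w + c * e * cis \<theta> - z = c * (w' + e * cis \<theta> - z)" using c(2) by (simp add: algebra_simps)
    then show "cmod (w + c * e * cis \<theta> - z) = cmod (w' + e * cis \<theta> - z)" by (simp add: norm_mult c)
  qed
  finally show ?thesis using lpot_radial[OF assms(2)] by (simp add: lker_def cmean_def)
qed

lemma integrable_lker:
  assumes "0 \<le> e" "0 < t"
  shows "integrable lborel (lker e t z)"
proof (rule integrable_lborel_compact_support[OF locbdd_lker[OF assms(2)]])
  fix w assume "cmod w > cmod z + t + e"
  then show "lker e t z w = 0"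
    using norm_triangle_ineq2[of w z] assms by (intro lker_eq_0) auto
qed

lemma lpot_diff_outside:
  assumes "cmod w > cmod z + max s t"
  shows "lpot t z w - lpot s z w = 0"
  using norm_triangle_ineq2[of w z] assms by (simp add: lpot_outside)

text \<open>The difference of the two potentials has bounded support, and averaging over circles
  preserves the integral of such a function. The mass of the kernel therefore does not see the
  radius.\<close>

lemma integral_lker_eq:
  assumes "0 \<le> e" "e < s" "e < t"
  shows "(\<integral>w. lker e t z w \<partial>lborel) = (\<integral>w. lker e s z w \<partial>lborel)"
proof -
  define W where "W = (\<lambda>w. lpot t z w - lpot s z w)"
  have W: "locbdd W" unfolding W_def using assms by (intro locbdd_diff locbdd_lpot) auto
  have supp: "W w = 0" if "cmod w > cmod z + max s t" for w
    using lpot_diff_outside[OF that] by (simp add: W_def)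
  have supp': "cmean W w e = 0" if w: "cmod w > cmod z + max s t + e" for w
  proof -
    have "cmean W w e = cmean (\<lambda>_. 0) w e"
    proof (rule cmean_cong)
      fix w' assume "cmod (w' - w) = \<bar>e\<bar>"
      from norm_circle_ge[OF this assms(1), of 0] show "W w' = 0" using w by (intro supp) auto
    qed
    then show ?thesis by simp
  qed
  have "(\<integral>w. W w \<partial>lborel) = (\<integral>w. cmean W w e \<partial>lborel)"
    using integral_cmean_symmetric[of "\<lambda>_. 1" W "cmod z + max s t" e] W supp assms by simp
  moreover have "integrable lborel W"
    using W supp by (rule integrable_lborel_compact_support)
  moreover have "integrable lborel (\<lambda>w. cmean W w e)"
    using locbdd_cmean[OF W] supp' by (rule integrable_lborel_compact_support)
  ultimately have "(\<integral>w. cmean W w e - W w \<partial>lborel) = 0" by simp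
  moreover have "cmean W w e - W w = lker e t z w - lker e s z w" for w
    using assms by (simp add: W_def cmean_diff locbdd_lpot lker_def)
  ultimately show ?thesis
    using assms by (simp add: integrable_lker)
qed

lemma integral_lker_translate:
  assumes "0 < t"
  shows "(\<integral>w. lker e t z w \<partial>lborel) = (\<integral>w. lker e t 0 w \<partial>lborel)"
proof -
  have "(\<integral>w. lker e t z w \<partial>lborel) = (\<integral>w. lker e t z (z + w) \<partial>lborel)"
    using locbdd_lker[OF assms] by (intro lborel_integral_translate[symmetric]) (simp add: locbdd_def)
  then show ?thesis by (simp add: lker_def cmean_lpot_shift) (simp add: lpot_def)
qed

lemma cmean_norm_squared: "cmean (\<lambda>w. (cmod w)\<^sup>2) w r = (cmod w)\<^sup>2 + r\<^sup>2"
proof -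
  have int: "integrable circ (\<lambda>\<theta>. Re (c * cis \<theta>))" for c
  proof (rule integrable_circ_bounded)
    show "\<bar>Re (c * cis \<theta>)\<bar> \<le> cmod c" for \<theta>
      using abs_Re_le_cmod[of "c * cis \<theta>"] by (simp add: norm_mult)
  qed measurable
  \<comment> \<open>Half a turn changes the sign of the integrand.\<close>
  have 0: "(\<integral>\<theta>. Re (c * cis \<theta>) \<partial>circ) = 0" for c
  proof -
    have "(\<integral>\<theta>. Re (c * cis \<theta>) \<partial>circ) = (\<integral>\<theta>. Re (c * (-1 * cis \<theta>)) \<partial>circ)"
      by (rule integral_circ_rotate[symmetric]) auto
    also have "\<dots> = (\<integral>\<theta>. - Re (c * cis \<theta>) \<partial>circ)"
      by (rule Bochner_Integration.integral_cong) auto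
    also have "\<dots> = - (\<integral>\<theta>. Re (c * cis \<theta>) \<partial>circ)" by (rule Bochner_Integration.integral_minus)
    finally show ?thesis by linarith
  qed
  have pt: "(cmod (w + r * cis \<theta>))\<^sup>2 = (cmod w)\<^sup>2 + r\<^sup>2 + Re (2 * r * cnj w * cis \<theta>)" for \<theta>
  proof -
    have "r\<^sup>2 * ((sin \<theta>)\<^sup>2 + (cos \<theta>)\<^sup>2) = r\<^sup>2" by simp
    then have "r * (r * (cos \<theta> * cos \<theta>)) + r * (r * (sin \<theta> * sin \<theta>)) = r * r"
      by (simp only: power2_eq_square distrib_left mult.assoc add.commute)
    then show ?thesis unfolding cmod_power2 by (simp add: power2_eq_square algebra_simps)
  qed
  show ?thesis
    unfolding cmean_def pt by (subst Bochner_Integration.integral_add[OF circ.integrable_const int]) (simp only: 0, simp)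
qed

text \<open>The radius \<open>2 * e\<close> is one admissible choice; every radius above
  \<open>e\<close> gives the same number. Its sign is what matters, since it is cancelled from the
  final inequality.\<close>

definition lmass :: "real \<Rightarrow> real" where
  "lmass e = (\<integral>w. lker e (2 * e) 0 w \<partial>lborel)"

lemma integral_lker: "0 < e \<Longrightarrow> e < t \<Longrightarrow> (\<integral>w. lker e t z w \<partial>lborel) = lmass e"
  unfolding lmass_def by (subst integral_lker_translate) (auto intro: integral_lker_eq)

text \<open>Testing against \<open>\<bar>w\<bar>\<^sup>2\<close>, whose circle means exceed its values by exactly \<open>e\<^sup>2\<close>.\<close>

lemma lmass_pos:
  assumes e: "0 < e"
  shows "0 < lmass e"
proof -
  define W where "W = (\<lambda>w. lpot (3 * e) 0 w - lpot (2 * e) 0 w)"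
  let ?v = "\<lambda>w::complex. (cmod w)\<^sup>2"
  have W: "locbdd W" unfolding W_def using e by (intro locbdd_diff locbdd_lpot) auto
  have v: "locbdd ?v" by (intro locbdd_continuous continuous_intros)
  have supp: "W w = 0" if "cmod w > 3 * e" for w
    using lpot_diff_outside[of 0 "2 * e" "3 * e" w] that e by (simp add: W_def)
  have lv: "locbdd (\<lambda>w. ?v w * f w)" if "locbdd f" for f
    by (intro locbdd_mult[OF v that])
  have iW: "integrable lborel W" using W supp by (rule integrable_lborel_compact_support)
  have ivW: "integrable lborel (\<lambda>w. ?v w * W w)"
    using lv[OF W] by (rule integrable_lborel_compact_support[of _ "3 * e"]) (simp add: supp)
  have ivk: "integrable lborel (\<lambda>w. ?v w * lker e t 0 w)" if "e < t" for t
    using that e by (intro integrable_lborel_compact_support[of _ "t + e"] lv locbdd_lker) (auto simp: lker_eq_0)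
  have W0: "W w \<ge> 0" for w unfolding W_def using lpot_mono[of "2 * e" "3 * e" 0 w] e by simp
  have "0 < ln (3/2) * measure lborel (ball (0::complex) e)"
    using e by (intro mult_pos_pos content_ball_pos) auto
  also have "\<dots> = (\<integral>w. ln (3/2) * indicator (ball 0 e) w \<partial>(lborel :: complex measure))"
    by simp
  also have "\<dots> \<le> (\<integral>w. W w \<partial>lborel)"
  proof (rule integral_mono[OF _ iW])
    show "integrable lborel (\<lambda>w::complex. ln (3/2) * indicator (ball 0 e) w :: real)"
      using emeasure_lborel_ball_finite[of "0::complex" e] by simp
    fix w :: complex
    show "ln (3/2) * indicator (ball 0 e) w \<le> W w"
      using W0[of w] e by (auto simp: indicator_def W_def lpot_inside ln_div ln_mult)
  qed
  finally have pos: "0 < e\<^sup>2 * (\<integral>w. W w \<partial>lborel)" using e by simp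
  have "(\<integral>w. W w * cmean ?v w e \<partial>lborel) = (\<integral>w. ?v w * W w \<partial>lborel) + e\<^sup>2 * (\<integral>w. W w \<partial>lborel)"
    using ivW iW by (simp add: cmean_norm_squared algebra_simps)
  moreover have "(\<integral>w. W w * cmean ?v w e \<partial>lborel) = (\<integral>w. ?v w * cmean W w e \<partial>lborel)"
    using integral_cmean_symmetric[OF v W, of "3 * e" e] supp e by simp
  moreover have "(\<integral>w. ?v w * cmean W w e \<partial>lborel)
      = (\<integral>w. ?v w * W w + (?v w * lker e (3 * e) 0 w - ?v w * lker e (2 * e) 0 w) \<partial>lborel)"
  proof (rule Bochner_Integration.integral_cong[OF refl])
    fix w
    have "cmean W w e = W w + (lker e (3 * e) 0 w - lker e (2 * e) 0 w)"
      unfolding W_def lker_def using e by (simp add: cmean_diff locbdd_lpot)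
    then show "?v w * cmean W w e = ?v w * W w + (?v w * lker e (3 * e) 0 w - ?v w * lker e (2 * e) 0 w)"
      by (simp only: distrib_left right_diff_distrib)
  qed
  ultimately have "e\<^sup>2 * (\<integral>w. W w \<partial>lborel)
      = (\<integral>w. ?v w * lker e (3 * e) 0 w \<partial>lborel) - (\<integral>w. ?v w * lker e (2 * e) 0 w \<partial>lborel)"
    using ivW ivk[of "3 * e"] ivk[of "2 * e"] e by simp
  moreover have "(\<integral>w. ?v w * lker e (2 * e) 0 w \<partial>lborel) \<ge> 0"
    using e by (intro Bochner_Integration.integral_nonneg mult_nonneg_nonneg lker_nonneg) auto
  \<comment> \<open>The kernel of radius \<open>3 * e\<close> vanishes beyond modulus
    \<open>4 * e\<close>, so testing it against the squared modulus gives at most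
    \<open>(4 * e)\<^sup>2\<close> times its mass.\<close>
  moreover have "(\<integral>w. ?v w * lker e (3 * e) 0 w \<partial>lborel) \<le> (\<integral>w. (4 * e)\<^sup>2 * lker e (3 * e) 0 w \<partial>lborel)"
  proof (rule integral_mono)
    fix w
    show "?v w * lker e (3 * e) 0 w \<le> (4 * e)\<^sup>2 * lker e (3 * e) 0 w"
    proof (cases "cmod w \<le> 4 * e")
      case True
      then show ?thesis using e by (intro mult_right_mono power_mono lker_nonneg) auto
    next
      case False
      then show ?thesis using e by (simp add: lker_eq_0)
    qed
  qed (use e ivk integrable_lker in auto)
  moreover have "(\<integral>w. (4 * e)\<^sup>2 * lker e (3 * e) 0 w \<partial>lborel) = (4 * e)\<^sup>2 * lmass e"
    using e integral_lker[of e "3 * e" 0] by simp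
  ultimately have "0 < (4 * e)\<^sup>2 * lmass e" using pos by linarith
  then show ?thesis using e by (simp add: zero_less_mult_iff)
qed

text \<open>The kernel is radial, so \<open>v\<close> may be replaced by its circle means about
  \<open>z\<close>; on the annulus carrying the kernel these lie between the means of radii
  \<open>t - e\<close> and \<open>t + e\<close> by monotonicity.\<close>

lemma
  assumes v: "rsh v" and e: "0 < e" "e < t"
  shows integral_lker_upper: "(\<integral>w. v w * lker e t z w \<partial>lborel) \<le> lmass e * cmean v z (t + e)"
    and integral_lker_lower: "lmass e * cmean v z (t - e) \<le> (\<integral>w. v w * lker e t z w \<partial>lborel)"
    and integrable_lker_mult: "integrable lborel (\<lambda>w. v w * lker e t z w)"
proof -
  have lv: "locbdd v" using v by (rule rsh_locbdd)
  have far: "lker e t z w = 0" if "cmod (w - z) > t + e" for w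
    using that e by (intro lker_eq_0) auto
  have far': "lker e t z w = 0" if "cmod w > cmod z + t + e" for w
    using that norm_triangle_ineq2[of w z] by (intro far) auto
  have near: "lker e t z w = 0" if "cmod (w - z) < t - e" for w
    using that e by (intro lker_eq_0) auto
  have lk: "locbdd (lker e t z)" using e by (intro locbdd_lker) auto
  show "integrable lborel (\<lambda>w. v w * lker e t z w)"
    using locbdd_mult[OF lv lk] by (rule integrable_lborel_compact_support[of _ "cmod z + t + e"]) (simp add: far')
  let ?U = "\<lambda>w. cmean v z (cmod (w - z))"
  have iU: "integrable lborel (\<lambda>w. ?U w * lker e t z w)"
    using locbdd_mult[OF locbdd_cmean_radial[OF lv] lk] by (rule integrable_lborel_compact_support[of _ "cmod z + t + e"]) (simp add: far')
  have ik: "integrable lborel (lker e t z)" using e by (intro integrable_lker) auto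
  have eq: "(\<integral>w. v w * lker e t z w \<partial>lborel) = (\<integral>w. ?U w * lker e t z w \<partial>lborel)"
    using e by (intro integral_radial[OF lv lk far]) (auto intro!: lker_radial)
  have k0: "lker e t z w \<ge> 0" for w using e by (intro lker_nonneg) auto
  have m: "(\<integral>w. c * lker e t z w \<partial>lborel) = lmass e * c" for c
    by (simp add: integral_lker[OF e, of z])
  have "(\<integral>w. ?U w * lker e t z w \<partial>lborel) \<le> (\<integral>w. cmean v z (t + e) * lker e t z w \<partial>lborel)"
  proof (rule integral_mono[OF iU])
    fix w
    show "?U w * lker e t z w \<le> cmean v z (t + e) * lker e t z w"
    proof (cases "cmod (w - z) \<le> t + e")
      case True
      then show ?thesis by (intro mult_right_mono k0 rsh_cmean_mono[OF v]) auto
    qed (simp add: far)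
  qed (use ik in auto)
  then show "(\<integral>w. v w * lker e t z w \<partial>lborel) \<le> lmass e * cmean v z (t + e)" by (simp only: eq m)
  have "(\<integral>w. cmean v z (t - e) * lker e t z w \<partial>lborel) \<le> (\<integral>w. ?U w * lker e t z w \<partial>lborel)"
  proof (rule integral_mono[OF _ iU])
    fix w
    show "cmean v z (t - e) * lker e t z w \<le> ?U w * lker e t z w"
    proof (cases "cmod (w - z) \<ge> t - e")
      case True
      then show ?thesis using e by (intro mult_right_mono k0 rsh_cmean_mono[OF v]) auto
    qed (simp add: near)
  qed (use ik in auto)
  then show "lmass e * cmean v z (t - e) \<le> (\<integral>w. v w * lker e t z w \<partial>lborel)" by (simp only: eq m)
qed

text \<open>Pairing the nonnegative test function \<open>W\<close> with \<open>cmean v \<cdot> e - v \<ge> 0\<close> and moving the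
  averaging operator onto \<open>W\<close>, each logarithmic potential becomes a kernel concentrated near its circle,
  of the common mass \<open>lmass e\<close>.\<close>

lemma lpot_comparison:
  fixes I :: "'i set" and J :: "'j set"
  assumes v: "rsh v" and e: "0 < e"
    and fin: "finite I" "finite J"
    and t: "\<And>i. i \<in> I \<Longrightarrow> e < t i \<and> 0 \<le> c i" "\<And>j. j \<in> J \<Longrightarrow> e < t' j \<and> 0 \<le> c' j"
    and W0: "\<And>w. (\<Sum>j\<in>J. c' j * lpot (t' j) (z' j) w) \<le> (\<Sum>i\<in>I. c i * lpot (t i) (z i) w)"
    and supp: "\<And>w. cmod w > R \<Longrightarrow> (\<Sum>j\<in>J. c' j * lpot (t' j) (z' j) w) = (\<Sum>i\<in>I. c i * lpot (t i) (z i) w)"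
  shows "(\<Sum>j\<in>J. c' j * cmean v (z' j) (t' j - e)) \<le> (\<Sum>i\<in>I. c i * cmean v (z i) (t i + e))"
proof -
  have lv: "locbdd v" using v by (rule rsh_locbdd)
  define W where "W = (\<lambda>w. (\<Sum>i\<in>I. c i * lpot (t i) (z i) w) - (\<Sum>j\<in>J. c' j * lpot (t' j) (z' j) w))"
  have tpos: "0 < t i" if "i \<in> I" for i using t(1)[OF that] e by auto
  have tpos': "0 < t' i" if "i \<in> J" for i using t(2)[OF that] e by auto
  have lI: "locbdd (\<lambda>w. \<Sum>i\<in>I. c i * lpot (t i) (z i) w)" 
    by (intro locbdd_sum locbdd_cmult locbdd_lpot tpos)
  have lJ: "locbdd (\<lambda>w. \<Sum>i\<in>J. c' i * lpot (t' i) (z' i) w)" 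
    by (intro locbdd_sum locbdd_cmult locbdd_lpot tpos')
  have W: "locbdd W" unfolding W_def by (intro locbdd_diff lI lJ)
  have Wsupp: "W w = 0" if "cmod w > R" for w using supp[OF that] by (simp add: W_def)
  have W0': "W w \<ge> 0" for w using W0[of w] by (simp add: W_def)
  have iWm: "integrable lborel (\<lambda>w. W w * cmean v w e)"
    using locbdd_mult[OF W locbdd_cmean[OF lv]] by (rule integrable_lborel_compact_support[of _ R]) (simp add: Wsupp)
  have iWv: "integrable lborel (\<lambda>w. W w * v w)"
    using locbdd_mult[OF W lv] by (rule integrable_lborel_compact_support[of _ R]) (simp add: Wsupp)
  have "(\<integral>w. W w * v w \<partial>lborel) \<le> (\<integral>w. W w * cmean v w e \<partial>lborel)"
    using e by (intro integral_mono iWv iWm mult_left_mono W0' rsh_submean[OF v]) auto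
  also have "\<dots> = (\<integral>w. v w * cmean W w e \<partial>lborel)"
    using e by (intro integral_cmean_symmetric[OF lv W Wsupp]) auto
  also have "\<dots> = (\<integral>w. W w * v w + ((\<Sum>i\<in>I. c i * (v w * lker e (t i) (z i) w)) - (\<Sum>j\<in>J. c' j * (v w * lker e (t' j) (z' j) w))) \<partial>lborel)"
  proof (rule Bochner_Integration.integral_cong[OF refl])
    fix w
    have "cmean W w e = (\<Sum>i\<in>I. c i * cmean (lpot (t i) (z i)) w e) - (\<Sum>j\<in>J. c' j * cmean (lpot (t' j) (z' j)) w e)"
      unfolding W_def
      by (simp add: cmean_diff lI lJ cmean_sum cmean_cmult locbdd_cmult locbdd_lpot tpos tpos')
    also have "\<dots> = W w + ((\<Sum>i\<in>I. c i * lker e (t i) (z i) w) - (\<Sum>j\<in>J. c' j * lker e (t' j) (z' j) w))"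
      by (simp add: W_def lker_def algebra_simps sum_subtractf)
    finally show "v w * cmean W w e = W w * v w + ((\<Sum>i\<in>I. c i * (v w * lker e (t i) (z i) w)) - (\<Sum>j\<in>J. c' j * (v w * lker e (t' j) (z' j) w)))"
      by (simp only: distrib_left right_diff_distrib sum_distrib_left mult.left_commute[of "v w"] mult.commute[of "v w" "W w"])
  qed
  also have "\<dots> = (\<integral>w. W w * v w \<partial>lborel) + ((\<Sum>i\<in>I. c i * (\<integral>w. v w * lker e (t i) (z i) w \<partial>lborel)) - (\<Sum>j\<in>J. c' j * (\<integral>w. v w * lker e (t' j) (z' j) w \<partial>lborel)))"
  proof -
    have "integrable lborel (\<lambda>w. c i * (v w * lker e (t i) (z i) w))" if "i \<in> I" for i
      using t(1)[OF that] e by (intro integrable_mult_right integrable_lker_mult[OF v]) auto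
    moreover have "integrable lborel (\<lambda>w. c' i * (v w * lker e (t' i) (z' i) w))" if "i \<in> J" for i
      using t(2)[OF that] e by (intro integrable_mult_right integrable_lker_mult[OF v]) auto
    ultimately show ?thesis
      using iWv by (simp add: Bochner_Integration.integral_sum)
  qed
  finally have "(\<Sum>j\<in>J. c' j * (\<integral>w. v w * lker e (t' j) (z' j) w \<partial>lborel)) \<le> (\<Sum>i\<in>I. c i * (\<integral>w. v w * lker e (t i) (z i) w \<partial>lborel))"
    by simp
  moreover have "(\<Sum>i\<in>I. c i * (\<integral>w. v w * lker e (t i) (z i) w \<partial>lborel)) \<le> (\<Sum>i\<in>I. c i * (lmass e * cmean v (z i) (t i + e)))"
    using t e by (intro sum_mono mult_left_mono integral_lker_upper[OF v]) auto
  moreover have "(\<Sum>i\<in>J. c' i * (lmass e * cmean v (z' i) (t' i - e))) \<le> (\<Sum>i\<in>J. c' i * (\<integral>w. v w * lker e (t' i) (z' i) w \<partial>lborel))"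
    using t e by (intro sum_mono mult_left_mono integral_lker_lower[OF v]) auto
  ultimately have "lmass e * (\<Sum>j\<in>J. c' j * cmean v (z' j) (t' j - e)) \<le> lmass e * (\<Sum>i\<in>I. c i * cmean v (z i) (t i + e))"
    by (simp add: sum_distrib_left mult_ac)
  then show ?thesis using lmass_pos[OF e] by simp
qed


text \<open>Since \<open>ln (max (exp x) n)\<close> is convex in \<open>x\<close>, the potential at
  an intermediate logarithmic radius lies below the combination of the potentials at the end radii,
  with equality beyond the larger disk. Comparison transfers this to the means.\<close>

lemma cmean_convex:
  assumes v: "rsh v"
  shows "convex_on UNIV (\<lambda>x. cmean v z (exp x))"
proof (rule convex_on_linorderI)
  fix m x y :: real
  assume m: "0 < m" "m < 1" and xy: "x < y"
  define a where "a = (1 - m) * x + m * y"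
  let ?C = "\<lambda>x. cmean v z (exp x)"
  \<comment> \<open>The comparison shifts every radius by \<open>e\<close> in the unfavourable
    direction. To absorb this, the end points are lowered by \<open>d\<close> and the intermediate
    point is raised by \<open>d\<close>; this takes the weight \<open>m + D\<close> at the upper
    end, and \<open>D * (y - x) = 2 * d\<close> makes \<open>a'\<close> the exact
    combination.\<close>
  have *: "?C a \<le> (m + D) * ?C y + (1 - m - D) * ?C x" if D: "0 < D" "D \<le> 1 - m" for D
  proof -
    define d where "d = D * (y - x) / 2"
    have d: "0 < d" using D xy by (simp add: d_def)
    define b where "b = y - d"
    define s where "s = x - d"
    define a' where "a' = a + d"
    have a': "a' = (m + D) * b + (1 - m - D) * s"
      using xy by (simp add: a'_def b_def s_def a_def d_def field_simps)
    have sb: "s < b" using xy by (simp add: s_def b_def)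
    have "s \<le> a'" "a' \<le> b"
    proof -
      have "a' - s = (m + D) * (b - s)" "b - a' = (1 - m - D) * (b - s)" by (simp_all add: a' algebra_simps)
      moreover have "(m + D) * (b - s) \<ge> 0" "(1 - m - D) * (b - s) \<ge> 0" using sb D m by auto
      ultimately have "0 \<le> a' - s" "0 \<le> b - a'" by simp_all
      then show "s \<le> a'" "a' \<le> b" by simp_all
    qed
    \<comment> \<open>The first three entries keep the shifted radii on the favourable side of
      \<open>exp x\<close>, \<open>exp a\<close> and \<open>exp y\<close>; the last keeps
      \<open>e\<close> below all radii involved.\<close>
    define e where "e = Min {exp x - exp s, exp a' - exp a, exp y - exp b, exp s / 2}"
    have e0: "0 < e" using d by (simp add: e_def a'_def b_def s_def)
    have e1: "exp s + e \<le> exp x" "exp a \<le> exp a' - e" "exp b + e \<le> exp y" "e < exp s"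
    proof -
      have "e \<le> exp x - exp s" "e \<le> exp a' - exp a" "e \<le> exp y - exp b" "e \<le> exp s / 2"
        unfolding e_def by (rule Min_le; simp)+
      then show "exp s + e \<le> exp x" "exp a \<le> exp a' - e" "exp b + e \<le> exp y" "e < exp s"
        using exp_gt_zero[of s] by linarith+
    qed
    have e2: "e < exp b" "e < exp a'" using e1(4) sb \<open>s \<le> a'\<close> by (meson exp_le_cancel_iff exp_less_mono less_le_trans less_trans)+
    define I :: "bool set" where "I = UNIV"
    define c where "c i = (if i then m + D else 1 - m - D)" for i
    define t where "t i = (if i then exp b else exp s)" for i
    have UB: "(\<Sum>i\<in>UNIV. f i) = f True + f False" for f :: "bool \<Rightarrow> real" by (simp add: UNIV_bool)
    have cvx: "lpot (exp a') z w \<le> (\<Sum>i\<in>UNIV. c i * lpot (t i) z w)" for w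
    proof -
      let ?n = "cmod (w - z)"
      have 1: "(m + D) * p + (1 - m - D) * p = p" for p :: real by (simp add: algebra_simps)
      have mono: "(m + D) * p + (1 - m - D) * q \<le> (m + D) * p' + (1 - m - D) * q'" if "p \<le> p'" "q \<le> q'" for p q p' q' :: real
        using that D m by (intro add_mono mult_left_mono) auto
      consider "?n \<le> exp a'" | "exp a' \<le> ?n" by linarith
      then show ?thesis
      proof cases
        case 1
        then show ?thesis
          using mono[of b "lpot (exp b) z w" s "lpot (exp s) z w"] lpot_ge[of "exp b" z w] lpot_ge[of "exp s" z w]
          by (simp add: UB c_def t_def lpot_inside a')
      next
        case 2
        have "?n > 0" using 2 exp_gt_zero[of a'] by linarith
        then have "ln ?n \<le> lpot r z w" if "r > 0" for r
          unfolding lpot_def using that by (subst ln_le_cancel_iff) auto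
        then show ?thesis
          using mono[of "ln ?n" "lpot (exp b) z w" "ln ?n" "lpot (exp s) z w"] 2
          by (simp add: UB c_def t_def lpot_outside 1)
      qed
    qed
    have "(\<Sum>j\<in>{()}. 1 * cmean v z (exp a' - e)) \<le> (\<Sum>i\<in>UNIV. c i * cmean v z (t i + e))"
    proof (rule lpot_comparison[OF v e0, where R = "cmod z + exp b"])
      fix w assume "cmod w > cmod z + exp b"
      then have n: "cmod (w - z) \<ge> exp b" using norm_triangle_ineq2[of w z] by simp
      moreover have "exp s \<le> cmod (w - z)" "exp a' \<le> cmod (w - z)"
        using sb \<open>a' \<le> b\<close> by (auto intro: order_trans[OF _ n])
      ultimately show "(\<Sum>j\<in>{()}. 1 * lpot (exp a') z w) = (\<Sum>i\<in>UNIV. c i * lpot (t i) z w)"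
        by (simp add: UB c_def t_def lpot_outside algebra_simps)
    qed (use e1 e2 D m cvx in \<open>auto simp: c_def t_def\<close>)
    then have "cmean v z (exp a' - e) \<le> (m + D) * cmean v z (exp b + e) + (1 - m - D) * cmean v z (exp s + e)"
      by (simp add: UB c_def t_def)
    also have "\<dots> \<le> (m + D) * ?C y + (1 - m - D) * ?C x"
      using D m e0 e1 by (intro add_mono mult_left_mono rsh_cmean_mono[OF v]) (auto intro: less_imp_le add_pos_pos)
    finally show ?thesis using rsh_cmean_mono[OF v _ e1(2), of z] by simp
  qed
  have "?C a \<le> (1 - m) * ?C x + m * ?C y"
  proof (rule ccontr)
    assume neg: "\<not> ?thesis"
    define g where "g = ?C a - ((1 - m) * ?C x + m * ?C y)"
    define K where "K = ?C y - ?C x"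
    have g: "g > 0" using neg by (simp add: g_def)
    have K: "K \<ge> 0" using xy rsh_cmean_mono[OF v, of "exp x" "exp y" z] by (simp add: K_def)
    \<comment> \<open>Moving the weight by \<open>D\<close> changes the right side by
      \<open>D * K\<close>, which this choice keeps below the supposed gap \<open>g\<close>.\<close>
    define D where "D = min (1 - m) (g / (2 * (K + 1)))"
    have D: "0 < D" "D \<le> 1 - m" using m g K by (auto simp: D_def)
    have "g \<le> D * K" using *[OF D] by (simp add: g_def K_def algebra_simps)
    also have "\<dots> \<le> g / (2 * (K + 1)) * K" using K by (intro mult_right_mono) (auto simp: D_def)
    also have "\<dots> < g" using g K by (simp add: field_simps add_nonneg_pos)
    finally show False by simp
  qed
  then show "?C ((1 - m) *\<^sub>R x + m *\<^sub>R y) \<le> (1 - m) * ?C x + m * ?C y"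
    by (simp add: a_def)
qed simp

text \<open>Each \<open>lpot (2 * r k) - lpot (r k / 4)\<close> lives on its own disk and is at most
  \<open>ln 8\<close> there; by disjointness so is the sum, and \<open>lpot (8 * R) - lpot R\<close>
  equals \<open>ln 8\<close> on the disk containing them all. The gaps from \<open>2 * r\<close> to
  \<open>r\<close>, \<open>r / 4\<close> to \<open>r / 2\<close>, \<open>8 * R\<close> to
  \<open>9 * R\<close> and \<open>R\<close> to \<open>R / 2\<close> leave room for the shift
  \<open>e\<close>.\<close>

lemma cmean_disjoint_disks:
  assumes v: "rsh v" and F: "finite F" and r: "\<And>k. k \<in> F \<Longrightarrow> 0 < r k"
    and disj: "pairwise (\<lambda>k l. disjnt (ball (z k) (2 * r k)) (ball (z l) (2 * r l))) F"
    and sub: "\<And>k. k \<in> F \<Longrightarrow> ball (z k) (2 * r k) \<subseteq> ball 0 R" and R: "R > 0"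
  shows "(\<Sum>k\<in>F. cmean v (z k) (r k) - cmean v (z k) (r k / 2)) \<le> cmean v 0 (9 * R) - cmean v 0 (R / 2)"
proof -
  define e where "e = Min (insert (R / 2) ((\<lambda>k. r k / 8) ` F))"
  have e0: "0 < e" using F r R by (simp add: e_def)
  have eR: "e \<le> R / 2" unfolding e_def using F by (intro Min_le) auto
  have er: "e \<le> r k / 8" if "k \<in> F" for k unfolding e_def using F that by (intro Min_le) auto
  \<comment> \<open>\<open>None\<close> carries the large pair of radii and \<open>Some k\<close>
    the small ones. Negative potentials are moved across, so that both sides have nonnegative
    coefficients.\<close>
  define I where "I = insert None (Some ` F)"
  define t where "t = case_option (8 * R) (\<lambda>k. r k / 4)"
  define t' where "t' = case_option R (\<lambda>k. 2 * r k)"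
  define y where "y = case_option 0 z"
  have Isum: "(\<Sum>i\<in>I. f i) = f None + (\<Sum>k\<in>F. f (Some k))" for f :: "'a option \<Rightarrow> real"
    unfolding I_def using F by (subst sum.insert) (auto simp: sum.reindex)
  have ln8: "ln (2 * x) - ln (x / 4) = ln 8" if "x > 0" for x :: real
    using that ln_mult[of 8 "x / 4"] by simp
  have diff: "lpot (2 * r k) (z k) w - lpot (r k / 4) (z k) w \<le> (if w \<in> ball (z k) (2 * r k) then ln 8 else 0)"
    if k: "k \<in> F" for k w
  proof (cases "w \<in> ball (z k) (2 * r k)")
    case True
    then have "lpot (2 * r k) (z k) w = ln (2 * r k)" by (intro lpot_inside) (simp add: dist_norm norm_minus_commute)
    moreover have "lpot (r k / 4) (z k) w \<ge> ln (r k / 4)" using r[OF k] by (intro lpot_ge) simp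
    ultimately show ?thesis using ln8[OF r[OF k]] True by simp
  next
    case False
    then have "cmod (w - z k) \<ge> 2 * r k" by (simp add: dist_norm norm_minus_commute)
    then show ?thesis using False r[OF k] by (simp add: lpot_outside)
  qed
  have key: "(\<Sum>k\<in>F. lpot (2 * r k) (z k) w - lpot (r k / 4) (z k) w) \<le> lpot (8 * R) 0 w - lpot R 0 w" for w
  proof (cases "\<exists>k\<in>F. w \<in> ball (z k) (2 * r k)")
    case True
    then obtain k where k: "k \<in> F" "w \<in> ball (z k) (2 * r k)" by blast
    have "(\<Sum>k\<in>F. lpot (2 * r k) (z k) w - lpot (r k / 4) (z k) w) \<le> (\<Sum>l\<in>F. if l = k then ln 8 else 0)"
    proof (rule sum_mono)
      fix l assume l: "l \<in> F"
      have "w \<notin> ball (z l) (2 * r l)" if "l \<noteq> k"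
        using pairwiseD[OF disj l k(1) that] k(2) by (auto simp: disjnt_def)
      then show "lpot (2 * r l) (z l) w - lpot (r l / 4) (z l) w \<le> (if l = k then ln 8 else 0)"
        using diff[OF l, of w] k(2) by (cases "l = k") auto
    qed
    also have "\<dots> = ln 8" using F k by simp
    also have "\<dots> = lpot (8 * R) 0 w - lpot R 0 w"
    proof -
      have "cmod w \<le> R" using sub[OF k(1)] k(2) by auto
      then show ?thesis using R by (simp add: lpot_inside ln_mult)
    qed
    finally show ?thesis .
  next
    case False
    then have "(\<Sum>k\<in>F. lpot (2 * r k) (z k) w - lpot (r k / 4) (z k) w) \<le> (\<Sum>k\<in>F. 0)"
      using diff[of _ w] by (intro sum_mono) (auto split: if_splits)
    then show ?thesis using lpot_mono[of R "8 * R" 0 w] R by simp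
  qed
  have "(\<Sum>j\<in>I. 1 * cmean v (y j) (t' j - e)) \<le> (\<Sum>i\<in>I. 1 * cmean v (y i) (t i + e))"
  proof (rule lpot_comparison[OF v e0, where R = "8 * R"])
    show "finite I" "finite I" using F by (auto simp: I_def)
    show "e < t i \<and> 0 \<le> (1::real)" "e < t' i \<and> 0 \<le> (1::real)" if "i \<in> I" for i
      using that eR R r er e0 by (auto simp: I_def t_def t'_def intro: le_less_trans[OF er])
    show "(\<Sum>j\<in>I. 1 * lpot (t' j) (y j) w) \<le> (\<Sum>i\<in>I. 1 * lpot (t i) (y i) w)" for w
      using key[of w] by (simp add: Isum t_def t'_def y_def sum_subtractf)
    fix w assume w: "cmod w > 8 * R"
    have "lpot (2 * r k) (z k) w = lpot (r k / 4) (z k) w" if k: "k \<in> F" for k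
    proof -
      have "w \<notin> ball (z k) (2 * r k)" using sub[OF k] w R by auto
      then have "cmod (w - z k) \<ge> 2 * r k" by (simp add: dist_norm norm_minus_commute)
      then show ?thesis using r[OF k] by (simp add: lpot_outside)
    qed
    moreover have "lpot R 0 w = lpot (8 * R) 0 w" using w R by (simp add: lpot_outside)
    ultimately show "(\<Sum>j\<in>I. 1 * lpot (t' j) (y j) w) = (\<Sum>i\<in>I. 1 * lpot (t i) (y i) w)"
      by (simp add: Isum t_def t'_def y_def)
  qed
  then have "cmean v 0 (R - e) + (\<Sum>k\<in>F. cmean v (z k) (2 * r k - e)) \<le> cmean v 0 (8 * R + e) + (\<Sum>k\<in>F. cmean v (z k) (r k / 4 + e))"
    by (simp add: Isum t_def t'_def y_def)
  moreover have er': "0 \<le> r k" "r k \<le> 2 * r k - e" "0 \<le> r k / 4 + e" "r k / 4 + e \<le> r k / 2" if "k \<in> F" for k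
    using er[OF that] r[OF that] e0 by linarith+
  moreover have "cmean v 0 (R / 2) \<le> cmean v 0 (R - e)" "cmean v 0 (8 * R + e) \<le> cmean v 0 (9 * R)"
    using R eR e0 by (auto intro!: rsh_cmean_mono[OF v])
  moreover have "(\<Sum>k\<in>F. cmean v (z k) (r k)) \<le> (\<Sum>k\<in>F. cmean v (z k) (2 * r k - e))"
    using er' by (intro sum_mono rsh_cmean_mono[OF v]) auto
  moreover have "(\<Sum>k\<in>F. cmean v (z k) (r k / 4 + e)) \<le> (\<Sum>k\<in>F. cmean v (z k) (r k / 2))"
    using er' by (intro sum_mono rsh_cmean_mono[OF v]) auto
  ultimately show ?thesis by (simp add: sum_subtractf)
qed

section \<open>Extended real subharmonic functions\<close>

text \<open>Valid for arbitrary integrands, since \<open>nn_integral\<close> is a supremum over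
  simple functions and hence monotone. The two parts of the difference move in opposite
  directions.\<close>

lemma ereal_integral_mono:
  assumes "\<And>x. x \<in> A \<Longrightarrow> g x \<le> h x"
  shows "ereal_integral A g \<le> ereal_integral A h"
  unfolding ereal_integral_def
proof (rule ereal_minus_mono)
  show "enn2ereal (\<integral>\<^sup>+x\<in>A. e2ennreal (max 0 (g x)) \<partial>lborel) \<le> enn2ereal (\<integral>\<^sup>+x\<in>A. e2ennreal (max 0 (h x)) \<partial>lborel)"
    unfolding less_eq_ennreal.rep_eq[symmetric]
    using assms by (intro nn_integral_mono) (auto simp: indicator_def intro!: e2ennreal_mono max.mono)
  show "enn2ereal (\<integral>\<^sup>+x\<in>A. e2ennreal (max 0 (- h x)) \<partial>lborel) \<le> enn2ereal (\<integral>\<^sup>+x\<in>A. e2ennreal (max 0 (- g x)) \<partial>lborel)"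
    unfolding less_eq_ennreal.rep_eq[symmetric]
    using assms by (intro nn_integral_mono) (auto simp: indicator_def intro!: e2ennreal_mono max.mono)
qed

lemma e2ennreal_max_ereal: "e2ennreal (max 0 (ereal x)) = ennreal x"
  by (simp add: ennreal_def sup_max)

lemma ereal_integral_real:
  assumes f: "set_integrable lborel A f"
  shows "ereal_integral A (\<lambda>x. ereal (f x)) = ereal (LINT x:A|lborel. f x)"
proof -
  let ?f = "\<lambda>x. indicator A x *\<^sub>R f x"
  have int: "integrable lborel ?f" using f by (simp add: set_integrable_def)
  have P: "(\<integral>\<^sup>+x\<in>A. e2ennreal (max 0 (ereal (f x))) \<partial>lborel) = (\<integral>\<^sup>+x. ennreal (?f x) \<partial>lborel)"
    unfolding e2ennreal_max_ereal by (intro nn_integral_cong) (simp add: indicator_def)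
  have N: "(\<integral>\<^sup>+x\<in>A. e2ennreal (max 0 (- ereal (f x))) \<partial>lborel) = (\<integral>\<^sup>+x. ennreal (- ?f x) \<partial>lborel)"
    unfolding uminus_ereal.simps e2ennreal_max_ereal by (intro nn_integral_cong) (simp add: indicator_def)
  obtain p q where pq: "p \<ge> 0" "(\<integral>\<^sup>+x. ennreal (?f x) \<partial>lborel) = ennreal p"
      "q \<ge> 0" "(\<integral>\<^sup>+x. ennreal (- ?f x) \<partial>lborel) = ennreal q" and I: "integral\<^sup>L lborel ?f = p - q"
    by (rule integrableE[OF int])
  have "(LINT x:A|lborel. f x) = p - q"
    using I by (simp add: set_lebesgue_integral_def)
  then show ?thesis
    unfolding ereal_integral_def P N pq(2,4) using pq by (simp add: enn2ereal_ennreal)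
qed

text \<open>Truncation from below leaves the positive part alone and lets the negative part increase
  to its limit. The upper bound on a set of finite measure keeps the positive part finite, so the
  difference converges even when the limit is -\<infinity>.\<close>

lemma ereal_integral_truncate_tendsto:
  assumes g [measurable]: "g \<in> borel_measurable borel" and A: "A \<in> sets borel" "emeasure lborel A < \<infinity>"
    and B: "\<And>x. x \<in> A \<Longrightarrow> g x \<le> ereal B"
  shows "(\<lambda>n. ereal_integral A (\<lambda>x. max (g x) (- ereal (real n)))) \<longlonglongrightarrow> ereal_integral A g"
proof -
  have [measurable]: "A \<in> sets borel" by (rule A)
  define P where "P = (\<integral>\<^sup>+x\<in>A. e2ennreal (max 0 (g x)) \<partial>lborel)"
  define N where "N = (\<integral>\<^sup>+x\<in>A. e2ennreal (max 0 (- g x)) \<partial>lborel)"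
  define Nn where "Nn n = (\<integral>\<^sup>+x\<in>A. e2ennreal (max 0 (- max (g x) (- ereal (real n)))) \<partial>lborel)" for n
  have "P \<le> (\<integral>\<^sup>+x\<in>A. ennreal B \<partial>lborel)"
    unfolding P_def
  proof (intro nn_integral_mono)
    fix x
    show "e2ennreal (max 0 (g x)) * indicator A x \<le> ennreal B * indicator A x"
    proof (cases "x \<in> A")
      case True
      have "e2ennreal (max 0 (g x)) \<le> e2ennreal (max 0 (ereal B))"
        using B[OF True] by (intro e2ennreal_mono max.mono) auto
      then show ?thesis by (simp add: True e2ennreal_max_ereal)
    qed simp
  qed
  also have "\<dots> = ennreal B * emeasure lborel A" by (simp add: nn_integral_cmult_indicator)
  also have "\<dots> < \<infinity>" using A by (simp add: ennreal_mult_less_top)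
  finally have "P < \<infinity>" .
  then have P: "\<bar>enn2ereal P\<bar> \<noteq> \<infinity>" by (cases P) (auto simp: enn2ereal_ennreal)
  have Pn: "(\<integral>\<^sup>+x\<in>A. e2ennreal (max 0 (max (g x) (- ereal (real n)))) \<partial>lborel) = P" for n
  proof -
    have "max 0 (max (g x) (- ereal (real n))) = max 0 (g x)" for x
      by (cases "g x") (auto simp: max_def)
    then show ?thesis by (simp add: P_def)
  qed
  have negm: "- max (g x) (- ereal (real n)) \<le> - max (g x) (- ereal (real (Suc n)))" for n x
    unfolding ereal_minus_le_minus by (intro max.mono order_refl) simp
  have "(\<integral>\<^sup>+x. (SUP n. e2ennreal (max 0 (- max (g x) (- ereal (real n)))) * indicator A x) \<partial>lborel) = (SUP n. Nn n)"
    unfolding Nn_def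
  proof (rule nn_integral_monotone_convergence_SUP)
    show "incseq (\<lambda>n x. e2ennreal (max 0 (- max (g x) (- ereal (real n)))) * indicator A x)"
      by (intro incseq_SucI le_funI mult_right_mono e2ennreal_mono max.mono order_refl negm) simp
  qed measurable
  also have "(\<lambda>x. (SUP n. e2ennreal (max 0 (- max (g x) (- ereal (real n)))) * indicator A x))
      = (\<lambda>x. e2ennreal (max 0 (- g x)) * indicator A x)"
  proof
    fix x
    show "(SUP n. e2ennreal (max 0 (- max (g x) (- ereal (real n)))) * indicator A x) = e2ennreal (max 0 (- g x)) * indicator A x"
    proof (cases "x \<in> A")
      case True
      have "(SUP n. e2ennreal (max 0 (- max (g x) (- ereal (real n))))) = e2ennreal (max 0 (- g x))"
      proof (cases "g x")
        case (real r)
        show ?thesis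
        proof (rule antisym)
          show "(SUP n. e2ennreal (max 0 (- max (g x) (- ereal (real n))))) \<le> e2ennreal (max 0 (- g x))"
            by (intro SUP_least e2ennreal_mono max.mono order_refl) (simp add: ereal_minus_le_minus)
          obtain n :: nat where "- r \<le> real n" using real_arch_simple by blast
          then have "e2ennreal (max 0 (- g x)) = e2ennreal (max 0 (- max (g x) (- ereal (real n))))"
            using real by (simp add: max_def)
          then show "e2ennreal (max 0 (- g x)) \<le> (SUP n. e2ennreal (max 0 (- max (g x) (- ereal (real n)))))"
            by (metis SUP_upper UNIV_I)
        qed
      next
        case PInf
        then show ?thesis using B[OF True] by simp
      next
        case MInf
        have "e2ennreal (max 0 (- max (g x) (- ereal (real n)))) = of_nat n" for n
          using MInf e2ennreal_max_ereal[of "real n"] by (simp add: ennreal_of_nat_eq_real_of_nat)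
        then show ?thesis using MInf by (simp add: ennreal_SUP_of_nat_eq_top)
      qed
      then show ?thesis using True by simp
    qed simp
  qed
  finally have N: "N = (SUP n. Nn n)" by (simp add: N_def)
  have "incseq Nn" unfolding Nn_def
    by (intro incseq_SucI nn_integral_mono mult_right_mono e2ennreal_mono max.mono order_refl negm) simp
  then have "Nn \<longlonglongrightarrow> N" unfolding N by (rule LIMSEQ_SUP)
  then have "(\<lambda>n. enn2ereal (Nn n)) \<longlonglongrightarrow> enn2ereal N" by (rule tendsto_enn2erealI)
  then have "(\<lambda>n. enn2ereal P + - enn2ereal (Nn n)) \<longlonglongrightarrow> enn2ereal P + - enn2ereal N"
    using P by (intro tendsto_add_ereal_general tendsto_const tendsto_uminus_ereal) auto
  then show ?thesis
    unfolding ereal_integral_def Pn by (simp add: minus_ereal_def P_def N_def Nn_def)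
qed

text \<open>\<open>real_of_ereal\<close> loses nothing here as long as \<open>u\<close> is nowhere
  \<infinity>. As the level \<open>-n\<close> sinks, the truncations decrease to
  \<open>u\<close>.\<close>

definition trunc :: "(complex \<Rightarrow> ereal) \<Rightarrow> nat \<Rightarrow> complex \<Rightarrow> real" where
  "trunc u n z = real_of_ereal (max (u z) (- ereal (real n)))"

locale subharm =
  fixes u :: "complex \<Rightarrow> ereal" and z0 :: complex
  assumes sh: "subharmonic u" and z0: "u z0 \<noteq> -\<infinity>"
begin

lemma u_less_PInf: "u z < \<infinity>" using sh by (simp add: subharmonic_def)

lemma u_measurable [measurable]: "u \<in> borel_measurable borel"
  using sh by (auto simp: subharmonic_def intro!: borel_measurableI_less)

lemma trunc_ereal: "ereal (trunc u n z) = max (u z) (- ereal (real n))"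
  unfolding trunc_def using u_less_PInf[of z]
  by (intro ereal_real') (cases "u z", auto simp: max_def)

lemma u_le_trunc: "u z \<le> ereal (trunc u n z)"
  by (simp add: trunc_ereal)

lemma trunc_ge: "- real n \<le> trunc u n z"
  using trunc_ereal[of n z] by (metis ereal_less_eq(3) max.cobounded2 uminus_ereal.simps(1))

lemma usc_trunc: "usc (trunc u n)"
  unfolding usc_def
proof
  fix a
  have "{z. trunc u n z < a} = (if - real n < a then {z. u z < ereal a} else {})"
  proof -
    have "trunc u n z < a \<longleftrightarrow> u z < ereal a \<and> - real n < a" for z
      unfolding less_ereal.simps(1)[symmetric] trunc_ereal by (simp add: max_less_iff_conj)
    then show ?thesis by auto
  qed
  moreover have "open {z. u z < ereal a}" using sh by (simp add: subharmonic_def)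
  ultimately show "open {z. trunc u n z < a}" by simp
qed

lemma locbdd_trunc: "locbdd (trunc u n)"
  using usc_trunc trunc_ge by (rule usc_locbdd)

lemma circle_mean_real:
  assumes "locbdd v"
  shows "circle_mean (\<lambda>w. ereal (v w)) z r = ereal (cmean v z r)"
proof -
  have [measurable]: "v \<in> borel_measurable borel" using assms by (simp add: locbdd_def)
  obtain B where B: "B \<ge> 0" "\<And>w. cmod w \<le> cmod z + \<bar>r\<bar> \<Longrightarrow> \<bar>v w\<bar> \<le> B" using assms by (metis locbdd_bound)
  have "set_integrable lborel {0..2*pi} (\<lambda>\<theta>. v (z + of_real r * cis \<theta>))"
    unfolding set_integrable_def using norm_circle_point_le[of z r] B
    by (intro integrableI_bounded_set_indicator[where B=B]) (auto simp: emeasure_lborel_Icc_eq)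
  from ereal_integral_real[OF this] show ?thesis
    unfolding circle_mean_def cmean_def by (subst integral_circ) auto
qed

lemma circle_mean_mono:
  assumes "\<And>w. cmod (w - z) = \<bar>r\<bar> \<Longrightarrow> g w \<le> h w"
  shows "circle_mean g z r \<le> circle_mean h z r"
  unfolding circle_mean_def
  by (intro ereal_mult_left_mono ereal_integral_mono assms) (auto simp: norm_mult)

lemma circle_mean_le_cmean: "circle_mean u z r \<le> ereal (cmean (trunc u n) z r)"
  unfolding circle_mean_real[OF locbdd_trunc, symmetric] by (intro circle_mean_mono u_le_trunc)

lemma rsh_trunc: "rsh (trunc u n)"
proof -
  have "trunc u n z \<le> cmean (trunc u n) z r" if "r > 0" for z r
  proof -
    have "u z \<le> circle_mean u z r" using sh that by (simp add: subharmonic_def)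
    also have "\<dots> \<le> ereal (cmean (trunc u n) z r)" by (rule circle_mean_le_cmean)
    finally have "u z \<le> ereal (cmean (trunc u n) z r)" .
    moreover have "- real n \<le> cmean (trunc u n) z r"
      by (intro cmean_ge locbdd_trunc trunc_ge)
    ultimately have "ereal (trunc u n z) \<le> ereal (cmean (trunc u n) z r)"
      by (simp add: trunc_ereal)
    then show ?thesis by simp
  qed
  then show ?thesis
    unfolding rsh_def
    by (intro conjI usc_trunc exI[of _ "- real n"] allI trunc_ge exI[of _ "1::real"]) auto
qed

lemma cmean_trunc_tendsto_ereal: "(\<lambda>n. ereal (cmean (trunc u n) z r)) \<longlonglongrightarrow> circle_mean u z r"
proof -
  obtain B where B: "\<And>w. cmod w \<le> cmod z + \<bar>r\<bar> \<Longrightarrow> \<bar>trunc u 0 w\<bar> \<le> B"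
    using locbdd_trunc by (metis locbdd_bound)
  have "(\<lambda>n. ereal_integral {0..2*pi} (\<lambda>\<theta>. max (u (z + of_real r * cis \<theta>)) (- ereal (real n))))
      \<longlonglongrightarrow> ereal_integral {0..2*pi} (\<lambda>\<theta>. u (z + of_real r * cis \<theta>))"
  proof (rule ereal_integral_truncate_tendsto)
    fix \<theta>
    have "u (z + of_real r * cis \<theta>) \<le> ereal (trunc u 0 (z + of_real r * cis \<theta>))" by (rule u_le_trunc)
    also have "\<dots> \<le> ereal B" using B[OF norm_circle_point_le[of z r \<theta>]] by simp
    finally show "u (z + of_real r * cis \<theta>) \<le> ereal B" .
  qed (auto simp: emeasure_lborel_Icc_eq)
  then have "(\<lambda>n. ereal (1 / (2*pi)) * ereal_integral {0..2*pi} (\<lambda>\<theta>. ereal (trunc u n (z + of_real r * cis \<theta>))))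
      \<longlonglongrightarrow> ereal (1 / (2*pi)) * ereal_integral {0..2*pi} (\<lambda>\<theta>. u (z + of_real r * cis \<theta>))"
    unfolding trunc_ereal by (intro tendsto_cmult_ereal) auto
  then show ?thesis
    unfolding circle_mean_real[OF locbdd_trunc, symmetric] circle_mean_def .
qed

lemma u_z0: "u z0 = ereal (real_of_ereal (u z0))"
  using z0 u_less_PInf[of z0] by (cases "u z0") auto

lemma trunc_mono_0: "trunc u n z \<le> trunc u 0 z"
  unfolding ereal_less_eq(3)[symmetric] trunc_ereal by (intro max.mono) auto

text \<open>The estimate is anchored at \<open>z0\<close>: the area mean over a large disk about
  \<open>z0\<close> is at least \<open>u z0\<close>. Since \<open>u\<close> is bounded above there,
  the part outside the small disk about \<open>z\<close> contributes at most a constant, and the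
  area mean over the small disk is at most the circle mean at radius \<open>r\<close>. All constants
  are free of \<open>n\<close> and \<open>z\<close>.\<close>

lemma cmean_trunc_lower:
  assumes r: "r > 0"
  shows "\<exists>m. \<forall>n z. cmod z \<le> R \<longrightarrow> m \<le> cmean (trunc u n) z r"
proof (cases "R \<ge> 0")
  case False
  then have "\<not> cmod z \<le> R" for z using norm_ge_zero[of z] by linarith
  then show ?thesis by blast
next
  case R: True
  \<comment> \<open>Large enough for the disk about \<open>z0\<close> to contain every
    \<open>cball z r\<close> with \<open>cmod z \<le> R\<close>.\<close>
  define S where "S = cmod z0 + R + r"
  have S: "S > 0" using R r by (simp add: S_def add_nonneg_pos)
  obtain B where B: "B \<ge> 0" "\<And>w. cmod w \<le> cmod z0 + S \<Longrightarrow> \<bar>trunc u 0 w\<bar> \<le> B"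
    using locbdd_trunc by (metis locbdd_bound)
  define a where "a r = measure lborel (cball (0::complex) r)" for r
  have a: "measure lborel (cball z t) = a t" if "t > 0" for z :: complex and t
    using that by (simp add: a_def content_cball)
  have apos: "a t > 0" if "t > 0" for t unfolding a_def using that by (rule content_cball_pos)
  have "(a S * (real_of_ereal (u z0) - B)) / a r \<le> cmean (trunc u n) z r" if z: "cmod z \<le> R" for z n
  proof -
    let ?v = "trunc u n"
    have lv: "locbdd ?v" by (rule locbdd_trunc)
    have li: "locbdd (indicator (cball y t) :: complex \<Rightarrow> real)" for y t
    proof -
      have "\<bar>indicator (cball y t) w\<bar> \<le> (1::real)" for w by (simp add: indicator_def)
      moreover have "indicator (cball y t) \<in> (borel_measurable borel :: (complex \<Rightarrow> real) set)"
        by (intro borel_measurable_indicator borel_closed closed_cball)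
      ultimately show ?thesis unfolding locbdd_def by auto
    qed
    have rad: "(\<integral>w. ?v w * indicator (cball y t) w \<partial>lborel) = (\<integral>w. cmean ?v y (cmod (w - y)) * indicator (cball y t) w \<partial>lborel)" for y t
      by (rule integral_radial[where k="indicator (cball y t)" and z=y and R=t, OF lv li])
         (auto simp: indicator_def dist_norm norm_minus_commute)
    have outs: "indicator (cball y t) w = (0::real)" if "cmod w > cmod y + t" for y w t
      using norm_triangle_ineq2[of w y] that by (simp add: indicator_def dist_norm norm_minus_commute)
    have ii: "integrable lborel (\<lambda>w. f w * indicator (cball y t) w)" if "locbdd f" for f y t
      using locbdd_mult[OF that li] by (rule integrable_lborel_compact_support[of _ "cmod y + t"]) (simp add: outs)
    have ci: "(\<integral>w. c * indicator (cball y t) w \<partial>lborel) = c * a t" if "t > 0" for c and y :: complex and t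
      using a[OF that, of y] by simp
    have sub: "cball z r \<subseteq> cball z0 S"
    proof
      fix w assume "w \<in> cball z r"
      then have "cmod (w - z) \<le> r" by (simp add: dist_norm norm_minus_commute)
      moreover have "cmod (w - z0) \<le> cmod (w - z) + cmod z + cmod z0"
        using norm_triangle_ineq4[of z z0] norm_triangle_ineq[of "w - z" "z - z0"] by simp
      ultimately show "w \<in> cball z0 S" using z by (simp add: S_def dist_norm norm_minus_commute)
    qed
    have "a S * real_of_ereal (u z0) = (\<integral>w. real_of_ereal (u z0) * indicator (cball z0 S) w \<partial>lborel)"
      by (simp only: ci[OF S] mult.commute)
    also have "\<dots> \<le> (\<integral>w. cmean ?v z0 (cmod (w - z0)) * indicator (cball z0 S) w \<partial>lborel)"
    proof (intro integral_mono ii locbdd_cmean_radial lv locbdd_const mult_right_mono)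
      fix w
      have "real_of_ereal (u z0) \<le> ?v z0" using u_le_trunc[of z0 n] u_z0 by (metis ereal_less_eq(3))
      also have "\<dots> \<le> cmean ?v z0 (cmod (w - z0))" by (rule rsh_submean[OF rsh_trunc]) simp
      finally show "real_of_ereal (u z0) \<le> cmean ?v z0 (cmod (w - z0))" .
    qed simp
    also have "\<dots> = (\<integral>w. ?v w * indicator (cball z0 S) w \<partial>lborel)" by (simp only: rad)
    also have "\<dots> \<le> (\<integral>w. ?v w * indicator (cball z r) w + B * indicator (cball z0 S) w \<partial>lborel)"
    proof (intro integral_mono Bochner_Integration.integrable_add ii lv locbdd_const)
      fix w
      show "?v w * indicator (cball z0 S) w \<le> ?v w * indicator (cball z r) w + B * indicator (cball z0 S) w"
      proof (cases "w \<in> cball z0 S")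
        case True
        then have "cmod (w - z0) \<le> S" by (simp add: dist_norm norm_minus_commute)
        then have "cmod w \<le> cmod z0 + S" using norm_triangle_ineq2[of w z0] by simp
        then have "?v w \<le> B" using B(2)[of w] trunc_mono_0[of n w] by simp
        then show ?thesis using True B(1) by (simp add: indicator_def)
      next
        case False
        then show ?thesis using sub by (auto simp: indicator_def)
      qed
    qed
    also have "\<dots> = (\<integral>w. ?v w * indicator (cball z r) w \<partial>lborel) + B * a S"
      using ii[OF lv, of z r] ii[OF locbdd_const[of B], of z0 S] ci[OF S, of B z0]
      by (subst Bochner_Integration.integral_add) auto
    also have "(\<integral>w. ?v w * indicator (cball z r) w \<partial>lborel) \<le> (\<integral>w. cmean ?v z r * indicator (cball z r) w \<partial>lborel)"
      unfolding rad
    proof (intro integral_mono ii locbdd_cmean_radial lv locbdd_const)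
      fix w
      show "cmean ?v z (cmod (w - z)) * indicator (cball z r) w \<le> cmean ?v z r * indicator (cball z r) w"
        by (auto simp: indicator_def dist_norm norm_minus_commute intro!: rsh_cmean_mono[OF rsh_trunc])
    qed
    also have "\<dots> = cmean ?v z r * a r" by (rule ci[OF r])
    finally show ?thesis using apos[OF r] by (simp add: field_simps)
  qed
  then show ?thesis by blast
qed

text \<open>A default value may appear at \<open>r = 0\<close>, where the mean is \<open>u z\<close>
  and possibly -\<infinity>; the facts below concern positive radii.\<close>

definition C :: "complex \<Rightarrow> real \<Rightarrow> real" where
  "C z r = real_of_ereal (circle_mean u z r)"

lemma C_ereal:
  assumes "r > 0"
  shows "circle_mean u z r = ereal (C z r)"
proof -
  obtain m where "\<And>n. m \<le> cmean (trunc u n) z r" using cmean_trunc_lower[OF assms, of "cmod z"] by auto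
  then have "ereal m \<le> circle_mean u z r"
    by (intro LIMSEQ_le_const[OF cmean_trunc_tendsto_ereal]) auto
  moreover have "circle_mean u z r \<le> ereal (cmean (trunc u 0) z r)" by (rule circle_mean_le_cmean)
  ultimately have "\<bar>circle_mean u z r\<bar> \<noteq> \<infinity>" by (cases "circle_mean u z r") auto
  then show ?thesis by (simp add: C_def ereal_real')
qed

lemma cmean_trunc_tendsto: "r > 0 \<Longrightarrow> (\<lambda>n. cmean (trunc u n) z r) \<longlonglongrightarrow> C z r"
  using cmean_trunc_tendsto_ereal[of z r] by (simp add: C_ereal)

lemma C_lower:
  assumes "r > 0"
  shows "\<exists>m. \<forall>z. cmod z \<le> R \<longrightarrow> m \<le> C z r"
proof -
  obtain m where "\<And>n z. cmod z \<le> R \<Longrightarrow> m \<le> cmean (trunc u n) z r" using cmean_trunc_lower[OF assms, of R] by auto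
  then show ?thesis
    by (intro exI[of _ m] allI impI LIMSEQ_le_const[OF cmean_trunc_tendsto[OF assms]]) auto
qed

lemma C_mono: "0 < s \<Longrightarrow> s \<le> t \<Longrightarrow> C z s \<le> C z t"
  by (rule LIMSEQ_le[OF cmean_trunc_tendsto cmean_trunc_tendsto])
     (auto intro!: rsh_cmean_mono[OF rsh_trunc])

lemma C_convex: "convex_on UNIV (\<lambda>x. C z (exp x))"
proof (rule convex_onI)
  fix t x y :: real
  assume t: "0 < t" "t < 1"
  show "C z (exp ((1 - t) *\<^sub>R x + t *\<^sub>R y)) \<le> (1 - t) * C z (exp x) + t * C z (exp y)"
  proof (rule LIMSEQ_le)
    show "(\<lambda>n. cmean (trunc u n) z (exp ((1 - t) *\<^sub>R x + t *\<^sub>R y))) \<longlonglongrightarrow> C z (exp ((1 - t) *\<^sub>R x + t *\<^sub>R y))"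
      by (rule cmean_trunc_tendsto) simp
    show "(\<lambda>n. (1 - t) * cmean (trunc u n) z (exp x) + t * cmean (trunc u n) z (exp y)) \<longlonglongrightarrow> (1 - t) * C z (exp x) + t * C z (exp y)"
      by (intro tendsto_intros cmean_trunc_tendsto) auto
    show "\<exists>N. \<forall>n\<ge>N. cmean (trunc u n) z (exp ((1 - t) *\<^sub>R x + t *\<^sub>R y)) \<le> (1 - t) * cmean (trunc u n) z (exp x) + t * cmean (trunc u n) z (exp y)"
      using t convex_onD[OF cmean_convex[OF rsh_trunc], of t x y] by auto
  qed
qed simp

text \<open>A supporting line of the convex function \<open>C z (exp x)\<close> at
  \<open>ln a\<close>; comparing with the point one unit to the left shows that its slope is not
  negative.\<close>

lemma C_log_subgradient:
  assumes a: "a > 0"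
  shows "\<exists>L\<ge>0. \<forall>t>0. C z a + L * (ln t - ln a) \<le> C z t"
proof -
  obtain L where L: "\<And>y. C z (exp (ln a)) + L * (y - ln a) \<le> C z (exp y)"
    using convex_le_Inf_differential[OF C_convex, of "ln a"] by auto
  have "L * (- 1) \<le> 0"
    using L[of "ln a - 1"] C_mono[of "exp (ln a - 1)" "exp (ln a)" z] by simp
  moreover have "C z a + L * (ln t - ln a) \<le> C z t" if "t > 0" for t
    using L[of "ln t"] that a by simp
  ultimately show ?thesis by (intro exI[of _ L]) auto
qed

lemma C_disjoint_disks:
  assumes F: "finite F" and r: "\<And>k. k \<in> F \<Longrightarrow> 0 < r k"
    and disj: "pairwise (\<lambda>k l. disjnt (ball (z k) (2 * r k)) (ball (z l) (2 * r l))) F"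
    and sub: "\<And>k. k \<in> F \<Longrightarrow> ball (z k) (2 * r k) \<subseteq> ball 0 R" and R: "R > 0"
  shows "(\<Sum>k\<in>F. C (z k) (r k) - C (z k) (r k / 2)) \<le> C 0 (9 * R) - C 0 (R / 2)"
proof (rule LIMSEQ_le)
  show "(\<lambda>n. (\<Sum>k\<in>F. cmean (trunc u n) (z k) (r k) - cmean (trunc u n) (z k) (r k / 2))) \<longlonglongrightarrow> (\<Sum>k\<in>F. C (z k) (r k) - C (z k) (r k / 2))"
    using r by (intro tendsto_intros cmean_trunc_tendsto) auto
  show "(\<lambda>n. cmean (trunc u n) 0 (9 * R) - cmean (trunc u n) 0 (R / 2)) \<longlonglongrightarrow> C 0 (9 * R) - C 0 (R / 2)"
    using R by (intro tendsto_intros cmean_trunc_tendsto) auto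
qed (use cmean_disjoint_disks[OF rsh_trunc F r disj sub R] in auto)

lemma C_le:
  assumes "r > 0" "\<And>w. cmod (w - z) = r \<Longrightarrow> u w \<le> ereal a"
  shows "C z r \<le> a"
proof -
  have "circle_mean u z r \<le> circle_mean (\<lambda>w. ereal a) z r"
    using assms by (intro circle_mean_mono) auto
  also have "\<dots> = ereal a" using circle_mean_real[OF locbdd_const[of a]] by simp
  finally show ?thesis using C_ereal[OF assms(1)] by simp
qed

text \<open>By upper semicontinuity small circles see only values below \<open>a\<close>. This is
  the half of the convergence of \<open>C z t\<close> to \<open>u z\<close> that the descent over
  dyadic radii uses.\<close>

lemma C_small:
  assumes "u z < ereal a"
  obtains d where "d > 0" "\<And>t. 0 < t \<Longrightarrow> t < d \<Longrightarrow> C z t \<le> a"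
proof -
  have "open {w. u w < ereal a}" using sh by (simp add: subharmonic_def)
  then obtain d where "d > 0" "ball z d \<subseteq> {w. u w < ereal a}"
    using assms by (metis mem_Collect_eq open_contains_ball)
  then have "u w \<le> ereal a" if "cmod (w - z) < d" for w
  proof -
    have "w \<in> ball z d" using that by (simp add: dist_norm norm_minus_commute)
    then show ?thesis using \<open>ball z d \<subseteq> _\<close> by (auto intro: less_imp_le)
  qed
  with \<open>d > 0\<close> show ?thesis by (intro that[of d] C_le) auto
qed

text \<open>The lower bound for \<open>B\<close> uses the supporting line of \<open>C z (exp x)\<close> at
  \<open>ln (r / 2)\<close> and \<open>ln (t / a) \<ge> 1 - a / t\<close>.\<close>

definition B :: "complex \<Rightarrow> real \<Rightarrow> real" where
  "B z r = 2 / r\<^sup>2 * (LINT t:{0<..<r}|lborel. C z t * t)"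

lemma
  assumes r: "r > 0"
  shows disk_mean_real: "disk_mean u z r = ereal (B z r)"
    and B_le_C: "B z r \<le> C z r"
    and C_half_le_B: "C z (r / 2) \<le> B z r"
proof -
  define a where "a = r / 2"
  obtain L where L: "L \<ge> 0" "\<And>t. t > 0 \<Longrightarrow> C z a + L * (ln t - ln a) \<le> C z t"
    using C_log_subgradient[of a z] r by (auto simp: a_def)
  have low: "C z a * t + L * (t - a) \<le> C z t * t" if t: "0 < t" for t
  proof -
    have "a > 0" using r by (simp add: a_def)
    then have "ln (a / t) \<le> a / t - 1" using t by (intro ln_le_minus_one) simp
    then have "1 - a / t \<le> ln t - ln a" using t \<open>a > 0\<close> by (simp add: ln_div)
    then have "C z a + L * (1 - a / t) \<le> C z t" using L(2)[OF t] mult_left_mono[OF _ L(1)] by (smt (verit))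
    then have "(C z a + L * (1 - a / t)) * t \<le> C z t * t" using t by (intro mult_right_mono) auto
    moreover have "(C z a + L * (1 - a / t)) * t = C z a * t + L * (t - a)"
      using t by (simp add: distrib_right mult.assoc left_diff_distrib)
    ultimately show ?thesis by simp
  qed
  have up: "C z t * t \<le> C z r * t" if "0 < t" "t < r" for t
    using that by (intro mult_right_mono C_mono) auto
  let ?A = "{0<..<r}"
  have lin: "set_integrable lborel ?A (\<lambda>t. c * t + d)" for c d
  proof -
    have "set_integrable lborel {0..r} (\<lambda>t. c * t + d)"
      by (intro borel_integrable_atLeastAtMost' continuous_intros)
    then show ?thesis by (rule set_integrable_subset) auto
  qed
  have linI: "(LINT t:?A|lborel. c * t + d) = c * r\<^sup>2 / 2 + d * r" for c d
  proof -
    have "((\<lambda>t. c * t + d) has_integral ((c * r\<^sup>2 / 2 + d * r) - (c * 0\<^sup>2 / 2 + d * 0))) {0..r}"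
      using r by (intro fundamental_theorem_of_calculus) (auto intro!: derivative_eq_intros simp: has_real_derivative_iff_has_vector_derivative[symmetric])
    then have "((\<lambda>t. c * t + d) has_integral (c * r\<^sup>2 / 2 + d * r)) {0<..<r}"
      by (simp add: has_integral_Icc_iff_Ioo)
    then show ?thesis using set_borel_integral_eq_integral(2)[OF lin] by (metis integral_unique)
  qed
  \<comment> \<open>Monotonicity of \<open>C z\<close> on positive radii supplies the
    measurability.\<close>
  have meas: "(\<lambda>t. indicator ?A t *\<^sub>R (C z t * t)) \<in> borel_measurable lborel"
  proof -
    have "mono_on ?A (C z)" by (intro mono_onI C_mono) auto
    then have "C z \<in> borel_measurable (restrict_space borel ?A)" by (rule borel_measurable_mono_on_fnc)
    then have "(\<lambda>t. indicator ?A t *\<^sub>R C z t) \<in> borel_measurable borel"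
      by (simp add: borel_measurable_restrict_space_iff)
    then have "(\<lambda>t. (indicator ?A t *\<^sub>R C z t) * t) \<in> borel_measurable borel" by measurable
    then show ?thesis by (simp add: mult.assoc)
  qed
  have int: "set_integrable lborel ?A (\<lambda>t. C z t * t)"
    unfolding set_integrable_def
  proof (rule Bochner_Integration.integrable_bound[OF _ meas])
    let ?g = "\<lambda>t. indicator ?A t *\<^sub>R ((\<bar>C z r\<bar> + \<bar>C z a\<bar> + L) * t + L * a)"
    show "integrable lborel ?g" using lin by (simp add: set_integrable_def)
    have "\<bar>C z t * t\<bar> \<le> (\<bar>C z r\<bar> + \<bar>C z a\<bar> + L) * t + L * a" if t: "0 < t" "t < r" for t
    proof -
      have "C z r * t \<le> \<bar>C z r\<bar> * t" "- \<bar>C z a\<bar> * t \<le> C z a * t" "0 \<le> \<bar>C z r\<bar> * t" "0 \<le> \<bar>C z a\<bar> * t"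
        using t mult_right_mono[of "- \<bar>C z a\<bar>" "C z a" t] mult_right_mono[of "C z r" "\<bar>C z r\<bar>" t] by simp_all
      moreover have "0 \<le> L * t" "0 \<le> L * a" using L t r by (simp_all add: a_def)
      moreover have "L * (t - a) = L * t - L * a" by (rule right_diff_distrib)
      ultimately have "C z t * t \<le> \<bar>C z r\<bar> * t + \<bar>C z a\<bar> * t + L * t + L * a"
          "- (C z t * t) \<le> \<bar>C z r\<bar> * t + \<bar>C z a\<bar> * t + L * t + L * a"
        using low[OF t(1)] up[OF t] by linarith+
      then show ?thesis by (simp only: abs_le_iff distrib_right)
    qed
    then show "AE t in lborel. norm (indicator ?A t *\<^sub>R (C z t * t)) \<le> norm (?g t)"
      by (intro AE_I2) (auto simp: indicator_def intro: order_trans[OF _ abs_ge_self])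
  qed
  have "ereal_integral ?A (\<lambda>t. circle_mean u z t * ereal t) = ereal_integral ?A (\<lambda>t. ereal (C z t * t))"
    by (intro antisym ereal_integral_mono) (auto simp: C_ereal)
  also have "\<dots> = ereal (LINT t:?A|lborel. C z t * t)" by (rule ereal_integral_real[OF int])
  finally show "disk_mean u z r = ereal (B z r)" by (simp add: disk_mean_def B_def)
  have "(LINT t:?A|lborel. C z t * t) \<le> (LINT t:?A|lborel. C z r * t + 0)"
    by (intro set_integral_mono int lin) (use up in auto)
  then have "(LINT t:?A|lborel. C z t * t) \<le> C z r * r\<^sup>2 / 2" by (subst (asm) linI) simp
  then show "B z r \<le> C z r" using r by (simp add: B_def field_simps)
  have "(LINT t:?A|lborel. (C z a + L) * t + (- L * a)) \<le> (LINT t:?A|lborel. C z t * t)"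
    by (intro set_integral_mono int lin) (use low in \<open>auto simp: algebra_simps\<close>)
  then have "(C z a + L) * r\<^sup>2 / 2 + (- L * a) * r \<le> (LINT t:?A|lborel. C z t * t)" by (simp only: linI)
  \<comment> \<open>The unknown slope drops out because \<open>a\<close> is the midpoint of the
    interval: the term \<open>L * (t - a)\<close> integrates to zero. This is what fixes the ratio
    1/2 between the two radii.\<close>
  moreover have "(C z a + L) * r\<^sup>2 / 2 + (- L * a) * r = C z a * r\<^sup>2 / 2"
    by (simp add: a_def power2_eq_square algebra_simps)
  ultimately have "C z a * r\<^sup>2 / 2 \<le> (LINT t:?A|lborel. C z t * t)" by linarith
  then show "C z (r / 2) \<le> B z r" using r by (simp add: B_def a_def field_simps)
qed

lemma circle_mean_le_disk_sup:
  assumes "r > 0"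
  shows "circle_mean u z r \<le> disk_sup u z r"
proof (rule ccontr)
  assume "\<not> ?thesis"
  then obtain a where a: "disk_sup u z r \<le> ereal a" "ereal a < circle_mean u z r"
    using ereal_dense2[of "disk_sup u z r" "circle_mean u z r"] by (meson not_le less_imp_le)
  have "C z r \<le> a"
  proof (rule C_le[OF assms])
    fix w assume "cmod (w - z) = r"
    then have "w \<in> cball z r" by (simp add: dist_norm norm_minus_commute)
    then have "u w \<le> disk_sup u z r" unfolding disk_sup_def by (rule SUP_upper)
    then show "u w \<le> ereal a" using a(1) by (rule order_trans)
  qed
  then show False using C_ereal[OF assms] a(2) by simp
qed

text \<open>The inequalities between the means always hold at a positive radius, so the content is
  the bound by \<open>B\<close>.\<close>

lemma minorant_by_means_iff:
  "minorant_by_means u q f \<longleftrightarrow> nonzero_entire f \<and> (\<forall>z. log_abs f z \<le> ereal (B z ((1 + cmod z) powr (- q))))"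
proof -
  have Q: "(1 + cmod z) powr (- q) > 0" for z
  proof -
    have "1 + cmod z > 0" using norm_ge_zero[of z] by linarith
    then show ?thesis by simp
  qed
  show ?thesis
    unfolding minorant_by_means_def Let_def
    using disk_mean_real[OF Q] C_ereal[OF Q] B_le_C[OF Q] circle_mean_le_disk_sup[OF Q] by auto
qed

end

section \<open>Exceptional disks\<close>

lemma ennreal_infsum_le:
  fixes f :: "'i \<Rightarrow> ennreal"
  assumes "\<And>F. finite F \<Longrightarrow> F \<subseteq> A \<Longrightarrow> sum f F \<le> c"
  shows "infsum f A \<le> c"
  using assms by (subst nonneg_infsum_complete) (auto intro!: SUP_least)

lemma ennreal_sum_le_infsum:
  fixes f :: "'i \<Rightarrow> ennreal"
  assumes "finite F" "F \<subseteq> A"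
  shows "sum f F \<le> infsum f A"
  using assms by (subst nonneg_infsum_complete) (auto intro!: SUP_upper)

text \<open>For centres of modulus at least \<open>R\<close> the weight is at least
  \<open>R powr q\<close>, so a bounded weighted sum controls the tail, as in Chebyshev's
  inequality. Disks are collected as a set of pairs and are numbered by naturals only here.\<close>

lemma disks_of_weighted_sum:
  fixes P :: "(complex \<times> real) set"
  assumes P: "countable P" and t: "\<And>p. p \<in> P \<Longrightarrow> 0 \<le> snd p \<and> snd p \<le> 1" and q: "q \<ge> 0"
    and M: "\<And>F. finite F \<Longrightarrow> F \<subseteq> P \<Longrightarrow> (\<Sum>p\<in>F. snd p * (1 + cmod (fst p)) powr q) \<le> M"
  obtains K c t where "disk_union K c t = (\<Union>p\<in>P. ball (fst p) (snd p))"
    "\<And>k. k \<in> K \<Longrightarrow> 0 \<le> t k \<and> t k \<le> 1"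
    "bigo_inverse_power q (\<lambda>R. \<Sum>\<^sub>\<infinity>k\<in>{k\<in>K. cmod (c k) \<ge> R}. ennreal (t k))"
proof -
  define K where "K = to_nat_on P ` P"
  define c where "c k = fst (from_nat_into P k)" for k
  define t where "t k = snd (from_nat_into P k)" for k
  have [simp]: "from_nat_into P (to_nat_on P p) = p" if "p \<in> P" for p using P that by simp
  have KP: "from_nat_into P k \<in> P" if "k \<in> K" for k using that by (auto simp: K_def)
  have inj: "inj_on (from_nat_into P) K" by (auto simp: K_def inj_on_def)
  have "disk_union K c t = (\<Union>p\<in>P. ball (fst p) (snd p))"
    by (auto simp: disk_union_def K_def c_def t_def)
  moreover have tk: "0 \<le> t k \<and> t k \<le> 1" if "k \<in> K" for k
    using assms(2)[OF KP[OF that]] by (simp add: t_def)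
  moreover have "bigo_inverse_power q (\<lambda>R. \<Sum>\<^sub>\<infinity>k\<in>{k\<in>K. cmod (c k) \<ge> R}. ennreal (t k))"
    unfolding bigo_inverse_power_def
  proof (intro exI[of _ M] eventually_at_top_linorderI[of 1] ennreal_infsum_le)
    fix R :: real and F assume R: "1 \<le> R" and F: "finite F" "F \<subseteq> {k \<in> K. R \<le> cmod (c k)}"
    have "(\<Sum>k\<in>F. t k) * R powr q \<le> (\<Sum>k\<in>F. t k * (1 + cmod (c k)) powr q)"
      unfolding sum_distrib_right
      using F R q tk by (intro sum_mono mult_left_mono powr_mono2) auto
    also have "\<dots> = (\<Sum>p\<in>from_nat_into P ` F. snd p * (1 + cmod (fst p)) powr q)"
      using inj_on_subset[OF inj] F by (subst sum.reindex) (auto simp: c_def t_def)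
    also have "\<dots> \<le> M" using F KP by (intro M) auto
    finally have "(\<Sum>k\<in>F. t k) \<le> M * (1 / R powr q)" using R by (simp add: field_simps)
    then show "(\<Sum>k\<in>F. ennreal (t k)) \<le> ennreal (M * (1 / R powr q))"
      using F tk by (subst sum_ennreal) (auto intro!: ennreal_leI)
  qed
  ultimately show ?thesis using that by blast
qed

lemma log_abs_cmult:
  assumes "c \<noteq> 0"
  shows "log_abs (\<lambda>z. c * f z) z = log_abs f z + ereal (ln (cmod c))"
proof (cases "f z = 0")
  case False
  then have "\<not> cmod c * cmod (f z) \<le> 0" using assms by (simp add: not_le)
  then show ?thesis using assms False by (simp add: log_abs_def elog_def norm_mult ln_mult)
qed (simp add: log_abs_def elog_def)

lemma nonzero_entire_cmult:
  assumes "nonzero_entire f" "c \<noteq> 0"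
  shows "nonzero_entire (\<lambda>z. c * f z)"
  using assms by (auto simp: nonzero_entire_def intro!: holomorphic_intros)

context subharm
begin

text \<open>The hypothesis speaks of disk means; \<open>C_half_le_B\<close> passes to circle means
  at half the radius, whence \<open>18 * R\<close> for \<open>9 * R\<close>. The factor
  \<open>R1\<close> pushes the radius into the range of the order estimate, and the subtracted mean
  is bounded below by its value at radius 1/2.\<close>

lemma C_growth_bound:
  assumes "radial_order (disk_mean u 0) < \<infinity>"
  obtains A N where "A \<ge> 0" "N \<ge> 0" "\<And>R. R \<ge> 1 \<Longrightarrow> C 0 (9 * R) - C 0 (R / 2) \<le> A * R powr N"
proof -
  obtain N0 where N0: "radial_order (disk_mean u 0) < ereal N0"
    using assms less_PInf_Ex_of_nat by (metis less_ereal.simps(1) ereal_dense2)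
  then have "eventually (\<lambda>r. elog (1 + max 0 (disk_mean u 0 r)) / ereal (ln r) < ereal N0) at_top"
    unfolding radial_order_def by (rule Limsup_lessD)
  then obtain R0 where R0: "\<And>r. r \<ge> R0 \<Longrightarrow> elog (1 + max 0 (disk_mean u 0 r)) / ereal (ln r) < ereal N0"
    by (auto simp: eventually_at_top_linorder)
  define N where "N = max N0 0"
  define R1 where "R1 = max R0 2"
  have B: "B 0 r \<le> r powr N" if r: "r \<ge> R1" for r
  proof -
    have r2: "r \<ge> 2" "r \<ge> R0" "r > 0" using r by (auto simp: R1_def)
    have pos: "1 + max 0 (B 0 r) > 0" by (simp add: add_pos_nonneg)
    have lnr: "ln r > 0" using r2 by simp
    have "1 + max 0 (disk_mean u 0 r) = ereal (1 + max 0 (B 0 r))"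
      using r2 by (simp add: disk_mean_real max_def one_ereal_def)
    then have "elog (1 + max 0 (disk_mean u 0 r)) = ereal (ln (1 + max 0 (B 0 r)))"
      using pos by (simp add: elog_def)
    then have "ln (1 + max 0 (B 0 r)) / ln r < N0" using R0[OF r2(2)] lnr by simp
    then have "ln (1 + max 0 (B 0 r)) < N0 * ln r" using lnr by (simp add: field_simps)
    also have "\<dots> \<le> N * ln r" using lnr by (intro mult_right_mono) (auto simp: N_def)
    also have "\<dots> = ln (r powr N)" using r2 by (simp add: ln_powr)
    finally have "1 + max 0 (B 0 r) < r powr N" using pos r2 by (subst (asm) ln_less_cancel_iff) auto
    then show ?thesis by simp
  qed
  define A where "A = (18 * R1) powr N + \<bar>C 0 (1/2)\<bar>"
  have N: "N \<ge> 0" by (simp add: N_def)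
  have "C 0 (9 * R) - C 0 (R / 2) \<le> A * R powr N" if R: "R \<ge> 1" for R
  proof -
    have R1: "R1 \<ge> 2" by (simp add: R1_def)
    have RR1: "R1 * R \<ge> R" "R1 * R \<ge> R1" using R R1 mult_right_mono[of 1 R1 R] mult_left_mono[of 1 R R1] by auto
    have RN: "R powr N \<ge> 1" using R N by (intro ge_one_powr_ge_zero) auto
    have "C 0 (9 * R) \<le> C 0 (18 * (R1 * R) / 2)" using R R1 RR1 by (intro C_mono) auto
    also have "\<dots> \<le> B 0 (18 * (R1 * R))" using R R1 by (intro C_half_le_B) auto
    also have "\<dots> \<le> (18 * (R1 * R)) powr N" using R1 RR1 by (intro B) auto
    also have "\<dots> = (18 * R1) powr N * R powr N" using R R1 by (simp add: powr_mult mult.assoc[symmetric])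
    finally have 1: "C 0 (9 * R) \<le> (18 * R1) powr N * R powr N" .
    have "- C 0 (R / 2) \<le> - C 0 (1/2)" using R by (simp add: C_mono)
    also have "\<dots> \<le> \<bar>C 0 (1/2)\<bar> * 1" by simp
    also have "\<dots> \<le> \<bar>C 0 (1/2)\<bar> * R powr N" using RN by (intro mult_left_mono) auto
    finally show ?thesis using 1 by (simp add: A_def distrib_right)
  qed
  then show ?thesis using that[of A N] N by (simp add: A_def)
qed

text \<open>If no dyadic circle around \<open>z\<close> carries a large increment of the circle means, summing the increments
  down to radius \<open>0\<close>, where the means tend to \<open>u z\<close>, shows that \<open>C z Q\<close> exceeds \<open>u z\<close> by at most \<open>1\<close>.\<close>

lemma exists_large_increment:
  assumes Q: "Q > 0" and bad: "u z + 1 < ereal (C z Q)"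
  shows "\<exists>r. 0 < r \<and> r \<le> Q \<and> r < 2 * Q * (C z r - C z (r / 2))"
proof (rule ccontr)
  assume no: "\<not> ?thesis"
  \<comment> \<open>Failure of the threshold at radius \<open>Q / 2 ^ n\<close> bounds that
    increment by \<open>1 / 2 ^ (n + 1)\<close>: the factor \<open>Q\<close> cancels, and the
    increments sum to less than 1.\<close>
  have "C z Q - C z (Q / 2 ^ n) \<le> 1 - 1 / 2 ^ n" for n
  proof (induction n)
    case (Suc n)
    let ?r = "Q / 2 ^ n"
    have "?r > 0" using Q by simp
    moreover have "?r \<le> Q" using Q by (simp add: divide_le_eq mult_le_cancel_left1)
    ultimately have "2 * Q * (C z ?r - C z (?r / 2)) \<le> ?r" using no by (meson not_le)
    then have "Q * (2 * (C z ?r - C z (?r / 2))) \<le> Q * (1 / 2 ^ n)" by (simp only: mult.assoc mult.left_commute[of Q 2]) simp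
    then have "C z ?r - C z (?r / 2) \<le> 1 / 2 ^ n / 2"
      using Q by (subst (asm) mult_le_cancel_left_pos) auto
    moreover have "?r / 2 = Q / 2 ^ Suc n" by simp
    ultimately have step: "C z ?r - C z (Q / 2 ^ Suc n) \<le> 1 / 2 ^ n / 2" by (simp only:)
    have "c - b \<le> 1 - p / 2" if "a - b \<le> p / 2" "c - a \<le> 1 - p" for a b c p :: real
      using that by linarith
    moreover have "1 / 2 ^ Suc n = 1 / 2 ^ n / (2::real)" by simp
    ultimately show ?case using step Suc by (simp only:)
  qed simp
  then have low: "C z Q - 1 \<le> C z (Q / 2 ^ n)" for n
    by (smt (verit) divide_nonneg_nonneg zero_le_power)
  have "u z < ereal (C z Q - 1)" using bad by (cases "u z") (auto simp: one_ereal_def)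
  then obtain a where a: "u z < ereal a" "a < C z Q - 1"
    using ereal_dense2 by (metis less_ereal.simps(1))
  obtain d where d: "d > 0" "\<And>t. 0 < t \<Longrightarrow> t < d \<Longrightarrow> C z t \<le> a" using C_small[OF a(1)] by blast
  obtain n where "Q / d < 2 ^ n" using real_arch_pow[of 2 "Q / d"] by auto
  then have "Q / 2 ^ n < d" using d by (simp add: field_simps)
  then have "C z (Q / 2 ^ n) \<le> a" using Q by (intro d) auto
  then show False using low[of n] a(2) by simp
qed

text \<open>In the exponent of \<open>Q\<close> the summand \<open>N\<close> pays for the growth of
  the increments, \<open>q\<close> for the weight, and 1 makes the dyadic layers sum geometrically.
  The doubled disks are chosen disjoint, as \<open>C_disjoint_disks\<close> demands, and the Vitali
  factor 5 then gives radii \<open>10 * \<rho>\<close>.\<close>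

lemma exceptional_disks:
  assumes q: "q \<ge> 0" and N: "N \<ge> 0" and A: "A \<ge> 0"
    and gr: "\<And>R. R \<ge> 1 \<Longrightarrow> C 0 (9 * R) - C 0 (R / 2) \<le> A * R powr N"
  defines "Q \<equiv> \<lambda>z. (1 + cmod z) powr (- (N + q + 1))"
  obtains D \<rho> M where "countable D" "\<And>d. d \<in> D \<Longrightarrow> 0 < \<rho> d \<and> 10 * \<rho> d \<le> 1"
    "\<And>z. 10 * Q z \<le> 1 \<Longrightarrow> u z + 1 < ereal (C z (Q z)) \<Longrightarrow> \<exists>d\<in>D. z \<in> ball d (10 * \<rho> d)"
    "\<And>F. finite F \<Longrightarrow> F \<subseteq> D \<Longrightarrow> (\<Sum>d\<in>F. 10 * \<rho> d * (1 + cmod d) powr q) \<le> M"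
proof -
  define Z where "Z = {z. 10 * Q z \<le> 1 \<and> u z + 1 < ereal (C z (Q z))}"
  have c1: "1 + cmod z > 0" for z using norm_ge_zero[of z] by linarith
  have Q0: "Q z > 0" for z using c1[of z] by (simp add: Q_def)
  have "\<forall>z\<in>Z. \<exists>r. 0 < r \<and> r \<le> Q z \<and> r < 2 * Q z * (C z r - C z (r / 2))"
    using exists_large_increment[OF Q0] by (auto simp: Z_def)
  then obtain \<rho> where \<rho>: "\<And>z. z \<in> Z \<Longrightarrow> 0 < \<rho> z \<and> \<rho> z \<le> Q z \<and> \<rho> z < 2 * Q z * (C z (\<rho> z) - C z (\<rho> z / 2))"
    by metis
  have \<rho>1: "10 * \<rho> z \<le> 1" if "z \<in> Z" for z using \<rho>[OF that] that by (auto simp: Z_def)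
  obtain D where D: "countable D" "D \<subseteq> Z" "pairwise (\<lambda>i j. disjnt (ball i (2 * \<rho> i)) (ball j (2 * \<rho> j))) D"
      "Z \<subseteq> (\<Union>i\<in>D. ball i (5 * (2 * \<rho> i)))"
  proof (rule Vitali_covering_lemma_balls[where S=Z and K=Z and a="\<lambda>z. z" and r="\<lambda>z. 2 * \<rho> z" and B=1])
    show "Z \<subseteq> (\<Union>i\<in>Z. ball i (2 * \<rho> i))" using \<rho> by force
    show "0 < 2 * \<rho> i \<and> 2 * \<rho> i \<le> 1" if "i \<in> Z" for i using \<rho>[OF that] \<rho>1[OF that] by simp
  qed blast
  \<comment> \<open>Dyadic layer of \<open>1 + cmod d\<close>, so that \<open>Q d\<close> and the
    weight are constant up to a bounded factor on each layer.\<close>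
  define lev where "lev d = nat \<lfloor>log 2 (1 + cmod d)\<rfloor>" for d :: complex
  have lev: "2 powr lev d \<le> 1 + cmod d" "1 + cmod d < 2 powr (lev d + 1)" for d
  proof -
    have "log 2 (1 + cmod d) \<ge> 0" by (subst zero_le_log_cancel_iff) (use c1[of d] in auto)
    then have "real (lev d) \<le> log 2 (1 + cmod d)" "log 2 (1 + cmod d) < real (lev d) + 1"
      unfolding lev_def by linarith+
    then show "2 powr lev d \<le> 1 + cmod d" "1 + cmod d < 2 powr (lev d + 1)"
      using c1[of d] by (simp_all add: le_log_iff log_less_iff add.commute)
  qed
  \<comment> \<open>Twice the bound for layer 0, by the geometric series over the layers.\<close>
  define M where "M = 40 * A * 2 powr N"
  have "(\<Sum>d\<in>F. 10 * \<rho> d * (1 + cmod d) powr q) \<le> M" if F: "finite F" "F \<subseteq> D" for F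
  proof -
    have layer: "(\<Sum>d\<in>{d\<in>F. lev d = m}. 10 * \<rho> d * (1 + cmod d) powr q) \<le> 20 * A * 2 powr N * (1/2) ^ m" for m :: nat
    proof -
      let ?F = "{d\<in>F. lev d = m}"
      let ?R = "2 powr (real m + 1)"
      have FZ: "d \<in> Z" if "d \<in> ?F" for d using that F D by auto
      have disj: "(\<Sum>d\<in>?F. C d (\<rho> d) - C d (\<rho> d / 2)) \<le> C 0 (9 * ?R) - C 0 (?R / 2)"
      proof (rule C_disjoint_disks)
        show "pairwise (\<lambda>k l. disjnt (ball k (2 * \<rho> k)) (ball l (2 * \<rho> l))) ?F"
          by (rule pairwise_subset[OF D(3)]) (use F in auto)
        fix d assume d: "d \<in> ?F"
        show "0 < \<rho> d" using \<rho>[OF FZ[OF d]] by simp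
        show "ball d (2 * \<rho> d) \<subseteq> ball 0 ?R"
        proof
          fix w assume "w \<in> ball d (2 * \<rho> d)"
          then have "cmod (w - d) < 1" using \<rho>1[OF FZ[OF d]] by (simp add: dist_norm norm_minus_commute)
          moreover have "1 + cmod d < ?R" using lev(2)[of d] d by (simp add: add.commute)
          ultimately show "w \<in> ball 0 ?R" using norm_triangle_ineq[of "w - d" d] by simp
        qed
      qed (use F in auto)
      have R1: "?R \<ge> 1" by (simp add: ge_one_powr_ge_zero)
      \<comment> \<open>The selection rule for \<open>\<rho> d\<close> trades each radius for
        \<open>2 * Q d\<close> times an increment of circle means; the increments of one layer are
        then summed by disjointness.\<close>
      have "(\<Sum>d\<in>?F. 10 * \<rho> d * (1 + cmod d) powr q) \<le> (\<Sum>d\<in>?F. 20 * (2 powr real m) powr (- (N + 1)) * (C d (\<rho> d) - C d (\<rho> d / 2)))"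
      proof (rule sum_mono)
        fix d assume d: "d \<in> ?F"
        note r = \<rho>[OF FZ[OF d]]
        let ?x = "1 + cmod d" and ?\<Delta> = "C d (\<rho> d) - C d (\<rho> d / 2)"
        have \<Delta>: "?\<Delta> \<ge> 0" using r by (simp add: C_mono)
        have "10 * \<rho> d * ?x powr q \<le> 10 * (2 * Q d * ?\<Delta>) * ?x powr q" using r by (intro mult_right_mono) auto
        also have "\<dots> = 20 * (Q d * ?x powr q) * ?\<Delta>" by (simp add: mult_ac)
        also have "Q d * ?x powr q = ?x powr (- (N + 1))" unfolding Q_def powr_add[symmetric] by simp
        also have "\<dots> \<le> (2 powr real m) powr (- (N + 1))"
          using lev(1)[of d] d N by (intro powr_mono2') auto
        finally show "10 * \<rho> d * ?x powr q \<le> 20 * (2 powr real m) powr (- (N + 1)) * ?\<Delta>"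
          using \<Delta> by (simp add: mult_right_mono)
      qed
      also have "\<dots> = 20 * (2 powr real m) powr (- (N + 1)) * (\<Sum>d\<in>?F. C d (\<rho> d) - C d (\<rho> d / 2))"
        by (rule sum_distrib_left [symmetric])
      also have "\<dots> \<le> 20 * (2 powr real m) powr (- (N + 1)) * (A * ?R powr N)"
        using disj gr[OF R1] by (intro mult_left_mono) auto
      also have "\<dots> = 20 * A * 2 powr N * (1/2) ^ m"
      proof -
        have "(2 powr real m) powr (- (N + 1)) * ?R powr N = 2 powr (real m * (- (N + 1)) + (real m + 1) * N)"
          by (simp only: powr_powr powr_add [symmetric])
        also have "real m * (- (N + 1)) + (real m + 1) * N = N - real m" by (simp add: algebra_simps)
        also have "2 powr (N - real m) = 2 powr N * (1/2) ^ m"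
          by (simp add: powr_diff powr_realpow power_divide)
        finally show ?thesis by (simp add: mult_ac)
      qed
      finally show ?thesis .
    qed
    obtain n where n: "lev ` F \<subseteq> {..<n}" using F(1) by (metis finite_imageI finite_nat_bounded)
    have "(\<Sum>d\<in>F. 10 * \<rho> d * (1 + cmod d) powr q) = (\<Sum>m<n. \<Sum>d\<in>{d\<in>F. lev d = m}. 10 * \<rho> d * (1 + cmod d) powr q)"
      using n F by (intro sum.group[symmetric]) auto
    also have "\<dots> \<le> (\<Sum>m<n. 20 * A * 2 powr N * (1/2) ^ m)" by (intro sum_mono layer)
    also have "\<dots> = 20 * A * 2 powr N * (\<Sum>m<n. (1/2) ^ m)" by (rule sum_distrib_left [symmetric])
    also have "\<dots> \<le> 20 * A * 2 powr N * 2"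
    proof (intro mult_left_mono)
      have "(\<Sum>m<n. (1/2::real) ^ m) = 2 - 2 * (1/2) ^ n" by (induction n) auto
      then show "(\<Sum>m<n. (1/2::real) ^ m) \<le> 2" by simp
    qed (use A in auto)
    finally show ?thesis by (simp add: M_def)
  qed
  moreover have "\<exists>d\<in>D. z \<in> ball d (10 * \<rho> d)" if "10 * Q z \<le> 1" "u z + 1 < ereal (C z (Q z))" for z
  proof -
    have "z \<in> Z" using that by (simp add: Z_def)
    from subsetD[OF D(4) this] show ?thesis by simp
  qed
  moreover have "0 < \<rho> d \<and> 10 * \<rho> d \<le> 1" if "d \<in> D" for d
    using D(2) that \<rho> \<rho>1 by blast
  ultimately show ?thesis using D(1) by (intro that[of D \<rho> M]) auto
qed

text \<open>(A) is applied at \<open>N + q + 1\<close>, the exponent of the covering, so that its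
  radius \<open>Q z\<close> is the very radius at which large increments were detected.\<close>

lemma minorant_off_disks_exists:
  assumes ord: "radial_order (disk_mean u 0) < \<infinity>" and A: "\<forall>q\<ge>0. \<exists>f. minorant_by_means u q f" and q: "q \<ge> 0"
  shows "\<exists>f K c t. minorant_off_disks u q f K c t"
proof -
  obtain A N where AN: "A \<ge> 0" "N \<ge> 0" "\<And>R. R \<ge> 1 \<Longrightarrow> C 0 (9 * R) - C 0 (R / 2) \<le> A * R powr N"
    using C_growth_bound[OF ord] by blast
  define Q where "Q z = (1 + cmod z) powr (- (N + q + 1))" for z
  obtain D \<rho> M where D: "countable D" "\<And>d. d \<in> D \<Longrightarrow> 0 < \<rho> d \<and> 10 * \<rho> d \<le> 1"
    "\<And>z. 10 * Q z \<le> 1 \<Longrightarrow> u z + 1 < ereal (C z (Q z)) \<Longrightarrow> \<exists>d\<in>D. z \<in> ball d (10 * \<rho> d)"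
    "\<And>F. finite F \<Longrightarrow> F \<subseteq> D \<Longrightarrow> (\<Sum>d\<in>F. 10 * \<rho> d * (1 + cmod d) powr q) \<le> M"
    using exceptional_disks[OF q AN(2,1,3), folded Q_def] by blast
  \<comment> \<open>Unit disks cover the bounded region where \<open>10 * Q z \<le> 1\<close> may
    fail; beyond modulus 9, \<open>Q z \<le> 1 / (1 + cmod z) \<le> 1 / 10\<close>.\<close>
  obtain G where G: "finite G" "cball (0::complex) 9 \<subseteq> (\<Union>g\<in>G. ball g 1)"
    using compact_cball[of "0::complex" 9] unfolding compact_eq_totally_bounded by (metis zero_less_one)
  define P where "P = (\<lambda>d. (d, 10 * \<rho> d)) ` D \<union> (\<lambda>g. (g, 1)) ` G"
  define wt where "wt = (\<lambda>p::complex \<times> real. snd p * (1 + cmod (fst p)) powr q)"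
  obtain K c t where K: "disk_union K c t = (\<Union>p\<in>P. ball (fst p) (snd p))"
    "\<And>k. k \<in> K \<Longrightarrow> 0 \<le> t k \<and> t k \<le> 1"
    "bigo_inverse_power q (\<lambda>R. \<Sum>\<^sub>\<infinity>k\<in>{k\<in>K. cmod (c k) \<ge> R}. ennreal (t k))"
  proof (rule disks_of_weighted_sum[of P q "M + (\<Sum>g\<in>G. (1 + cmod g) powr q)"])
    show "countable P" using D(1) G(1) by (auto simp: P_def intro: countable_finite)
    show "0 \<le> snd p \<and> snd p \<le> 1" if "p \<in> P" for p
      using that D(2) by (force simp: P_def)
    fix F assume F: "finite F" "F \<subseteq> P"
    let ?F1 = "{d\<in>D. (d, 10 * \<rho> d) \<in> F}"
    have fin: "finite ?F1"
      by (rule finite_subset[of _ "fst ` F"]) (use F in force)+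
    have sub: "F \<subseteq> (\<lambda>d. (d, 10 * \<rho> d)) ` ?F1 \<union> (\<lambda>g. (g, 1)) ` G"
      using F by (auto simp: P_def)
    have nn: "wt p \<ge> 0" if "p \<in> (\<lambda>d. (d, 10 * \<rho> d)) ` D \<union> (\<lambda>g. (g, 1)) ` G" for p
      using that D(2) by (fastforce simp: wt_def intro: less_imp_le)
    have "sum wt F \<le> sum wt ((\<lambda>d. (d, 10 * \<rho> d)) ` ?F1 \<union> (\<lambda>g. (g, 1)) ` G)"
      using fin G sub nn by (intro sum_mono2) auto
    \<comment> \<open>Disks of the two kinds may coincide as pairs, so the sum over the union is
      only estimated, using nonnegative weights.\<close>
    also have "\<dots> \<le> sum wt ((\<lambda>d. (d, 10 * \<rho> d)) ` ?F1) + sum wt ((\<lambda>g. (g, 1)) ` G)"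
    proof -
      have "sum wt (X \<union> Y) \<le> sum wt X + sum wt Y"
        if "finite X" "finite Y" "\<And>p. p \<in> X \<inter> Y \<Longrightarrow> wt p \<ge> 0" for X Y
        using sum.union_inter[OF that(1,2), of wt] sum_nonneg[of "X \<inter> Y" wt] that(3) by auto
      then show ?thesis using fin G nn by auto
    qed
    also have "sum wt ((\<lambda>d. (d, 10 * \<rho> d)) ` ?F1) = (\<Sum>d\<in>?F1. 10 * \<rho> d * (1 + cmod d) powr q)"
      by (subst sum.reindex) (auto simp: inj_on_def wt_def)
    also have "\<dots> \<le> M" using fin by (intro D(4)) auto
    also have "sum wt ((\<lambda>g. (g, 1)) ` G) = (\<Sum>g\<in>G. (1 + cmod g) powr q)"
      by (subst sum.reindex) (auto simp: inj_on_def wt_def)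
    finally show "(\<Sum>p\<in>F. snd p * (1 + cmod (fst p)) powr q) \<le> M + (\<Sum>g\<in>G. (1 + cmod g) powr q)"
      by (simp add: wt_def)
  qed (use q in auto)
  obtain f where f: "minorant_by_means u (N + q + 1) f" using A AN q by (metis add_nonneg_nonneg zero_le_one)
  define g where "g = (\<lambda>z. of_real (exp (- 1)) * f z)"
  have "nonzero_entire g"
    unfolding g_def using f by (intro nonzero_entire_cmult) (auto simp: minorant_by_means_def)
  moreover have "log_abs g z \<le> u z" if z: "z \<notin> disk_union K c t" for z
  proof -
    have c1: "1 + cmod z > 0" using norm_ge_zero[of z] by linarith
    have Q0: "Q z > 0" using c1 by (simp add: Q_def)
    have "z \<notin> cball 0 9" using z G(2) by (auto simp: K P_def)
    then have z9: "cmod z \<ge> 9" by simp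
    have "Q z \<le> (1 + cmod z) powr (- 1)"
      unfolding Q_def using AN q z9 by (intro powr_mono) auto
    also have "\<dots> \<le> 1 / 10" using z9 c1 by (simp add: powr_minus field_simps)
    finally have "10 * Q z \<le> 1" by simp
    then have "\<not> u z + 1 < ereal (C z (Q z))" using D(3)[of z] z by (auto simp: K P_def)
    then have "ereal (C z (Q z)) \<le> u z + 1" by simp
    moreover have "log_abs f z \<le> ereal (B z (Q z))" using f by (simp add: minorant_by_means_iff Q_def)
    moreover have "B z (Q z) \<le> C z (Q z)" using Q0 by (rule B_le_C)
    ultimately have "log_abs f z \<le> u z + 1" by (meson ereal_less_eq(3) order_trans)
    moreover have "log_abs g z = log_abs f z + ereal (- 1)"
      unfolding g_def by (subst log_abs_cmult) simp_all
    ultimately show ?thesis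
      using u_less_PInf[of z] by (cases "u z"; cases "log_abs f z") (auto simp: one_ereal_def)
  qed
  ultimately have "minorant_off_disks u q g K c t"
    using K by (simp add: minorant_off_disks_def)
  then show ?thesis by blast
qed

end

section \<open>Measure of the exceptional set on rays and circles\<close>

lemma emeasure_UN_le_infsum:
  fixes K :: "nat set" and t :: "nat \<Rightarrow> ennreal"
  assumes S: "\<And>k. k \<in> K \<Longrightarrow> S k \<in> sets M" "\<And>k. k \<in> K \<Longrightarrow> emeasure M (S k) \<le> c * t k"
  shows "emeasure M (\<Union>k\<in>K. S k) \<le> c * (\<Sum>\<^sub>\<infinity>k\<in>K. t k)"
proof -
  define A where "A k = (if k \<in> K then S k else {})" for k
  have "(\<Union>k\<in>K. S k) = (\<Union>k. A k)" by (auto simp: A_def)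
  also have "emeasure M \<dots> \<le> (\<Sum>k. emeasure M (A k))"
    using S(1) by (intro emeasure_subadditive_countably) (auto simp: A_def)
  also have "\<dots> \<le> c * (\<Sum>\<^sub>\<infinity>k\<in>K. t k)"
    unfolding suminf_eq_SUP
  proof (rule SUP_least)
    fix n
    have "(\<Sum>k<n. emeasure M (A k)) \<le> (\<Sum>k<n. if k \<in> K then c * t k else 0)"
      using S(2) by (intro sum_mono) (auto simp: A_def)
    also have "\<dots> = c * (\<Sum>k\<in>{..<n} \<inter> K. t k)"
      by (simp add: sum.inter_restrict sum_distrib_left if_distrib cong: if_cong)
    also have "\<dots> \<le> c * (\<Sum>\<^sub>\<infinity>k\<in>K. t k)"
      by (intro mult_left_mono ennreal_sum_le_infsum) auto
    finally show "(\<Sum>k<n. emeasure M (A k)) \<le> c * (\<Sum>\<^sub>\<infinity>k\<in>K. t k)" .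
  qed
  finally show ?thesis .
qed

text \<open>Jordan's inequality with a cruder constant: the derivative \<open>cos y - 1 / 3\<close>
  is positive up to \<open>pi / 3\<close>, and beyond that
  \<open>sin x \<ge> 2 / 3 \<ge> x / 3\<close> because \<open>pi < 4\<close>.\<close>

lemma third_le_sin:
  assumes "0 \<le> x" "x \<le> pi / 2"
  shows "x / 3 \<le> sin x"
proof (cases "x \<le> pi / 3")
  case True
  have "sin 0 - 0 / 3 \<le> sin x - x / 3"
  proof (rule DERIV_nonneg_imp_nondecreasing[OF assms(1)])
    fix y assume y: "0 \<le> y" "y \<le> x"
    have "cos (pi / 3) \<le> cos y" using y True by (intro cos_monotone_0_pi_le) auto
    then have "0 \<le> cos y - 1 / 3" by (simp add: cos_60)
    moreover have "((\<lambda>x. sin x - x / 3) has_real_derivative (cos y - 1 / 3)) (at y)"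
      by (auto intro!: derivative_eq_intros)
    ultimately show "\<exists>z. ((\<lambda>x. sin x - x / 3) has_real_derivative z) (at y) \<and> 0 \<le> z" by blast
  qed
  then show ?thesis by simp
next
  case False
  have "sin (pi / 3) \<le> sin x" using False assms by (intro sin_monotone_2pi_le) auto
  moreover have "4 / 3 \<le> sqrt 3" by (rule real_le_rsqrt) (simp add: power2_eq_square)
  ultimately show ?thesis using assms pi_less_4 by (simp add: sin_60)
qed

lemma norm_cis_diff: "cmod (cis a - cis b) = 2 * \<bar>sin ((a - b) / 2)\<bar>"
proof -
  have "(cmod (cis a - cis b))\<^sup>2 = (2 * \<bar>sin ((a - b) / 2)\<bar>)\<^sup>2"
  proof -
    have "(cmod (cis a - cis b))\<^sup>2 = (cos a - cos b)\<^sup>2 + (sin a - sin b)\<^sup>2" by (simp add: cmod_power2)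
    also have "\<dots> = ((cos a)\<^sup>2 + (sin a)\<^sup>2) + ((cos b)\<^sup>2 + (sin b)\<^sup>2) - 2 * (cos a * cos b + sin a * sin b)"
      by (simp add: power2_eq_square algebra_simps)
    also have "\<dots> = 2 - 2 * cos (a - b)" by (simp add: cos_diff)
    also have "\<dots> = 4 * (sin ((a - b) / 2))\<^sup>2"     proof -
      have "cos (2 * y) = 1 - 2 * (sin (2 * y / 2))\<^sup>2" for y :: real by (simp add: cos_double_sin)
      moreover have "2 * ((a - b) / 2) = a - b" by (simp add: field_simps)
      ultimately have "cos (a - b) = 1 - 2 * (sin ((a - b) / 2))\<^sup>2" by metis
      then show ?thesis by simp
    qed
    finally show ?thesis by (simp add: power_mult_distrib)
  qed
  then show ?thesis by (subst (asm) power2_eq_iff_nonneg) auto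
qed

text \<open>Two points of the circle in one disk span a chord below \<open>2 * t\<close>, hence
  their angles differ modulo \<open>2 * pi\<close> by at most \<open>6 * t / R\<close>. Three
  intervals of twice that length cover the set, in total \<open>36 * t / R\<close>.\<close>

lemma emeasure_circle_disk:
  assumes R: "R > 0" and t: "t \<ge> 0"
  shows "emeasure lebesgue {\<theta>. 0 \<le> \<theta> \<and> \<theta> < 2 * pi \<and> of_real R * cis \<theta> \<in> ball c t} \<le> ennreal (36 / R) * ennreal t"
    and "{\<theta>. 0 \<le> \<theta> \<and> \<theta> < 2 * pi \<and> of_real R * cis \<theta> \<in> ball c t} \<in> sets lebesgue"
proof -
  let ?T = "{\<theta>. 0 \<le> \<theta> \<and> \<theta> < 2 * pi \<and> of_real R * cis \<theta> \<in> ball c t}"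
  have "open ((\<lambda>\<theta>. of_real R * cis \<theta>) -` ball c t)"
    by (intro open_vimage continuous_intros) auto
  then have "{0..<2*pi} \<inter> (\<lambda>\<theta>. of_real R * cis \<theta>) -` ball c t \<in> sets borel" by (intro sets.Int) auto
  moreover have "{0..<2*pi} \<inter> (\<lambda>\<theta>. of_real R * cis \<theta>) -` ball c t = ?T" by auto
  ultimately show T: "?T \<in> sets lebesgue" by auto
  show "emeasure lebesgue ?T \<le> ennreal (36 / R) * ennreal t"
  proof (cases "?T = {}")
    case False
    then obtain \<phi> where \<phi>: "0 \<le> \<phi>" "\<phi> < 2 * pi" "of_real R * cis \<phi> \<in> ball c t" by auto
    define e where "e = t / R"
    define d where "d = 6 * e"
    have "?T \<subseteq> {\<phi> - d..\<phi> + d} \<union> {\<phi> + 2*pi - d..\<phi> + 2*pi + d} \<union> {\<phi> - 2*pi - d..\<phi> - 2*pi + d}"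
    proof
      fix \<theta> assume "\<theta> \<in> ?T"
      then have \<theta>: "0 \<le> \<theta>" "\<theta> < 2 * pi" "of_real R * cis \<theta> \<in> ball c t" by auto
      have "cmod (of_real R * cis \<theta> - of_real R * cis \<phi>) < t + t"
        using \<theta>(3) \<phi>(3) dist_triangle_less_add[of "of_real R * cis \<theta>" c t "of_real R * cis \<phi>" t]
        by (simp add: dist_commute dist_norm norm_minus_commute)
      moreover have "of_real R * cis \<theta> - of_real R * cis \<phi> = of_real R * (cis \<theta> - cis \<phi>)" by (simp add: algebra_simps)
      ultimately have "R * (2 * \<bar>sin ((\<theta> - \<phi>) / 2)\<bar>) < t + t"
        using R by (simp add: norm_mult norm_cis_diff)
      then have s: "\<bar>sin ((\<theta> - \<phi>) / 2)\<bar> < e" using R by (simp add: e_def field_simps)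
      define x where "x = \<bar>\<theta> - \<phi>\<bar> / 2"
      have x: "0 \<le> x" "x < pi" "sin x < e"
      proof -
        show "0 \<le> x" by (simp add: x_def)
        show "x < pi" using \<theta> \<phi> by (simp add: x_def abs_if)
        have "sin x = sin ((\<theta> - \<phi>) / 2) \<or> sin x = - sin ((\<theta> - \<phi>) / 2)"
        proof (cases "\<theta> \<ge> \<phi>")
          case False
          then have "x = - ((\<theta> - \<phi>) / 2)" by (simp add: x_def field_simps)
          then show ?thesis by (simp only: sin_minus simp_thms)
        qed (simp add: x_def)
        then show "sin x < e" using s by (auto simp: abs_less_iff)
      qed
      show "\<theta> \<in> {\<phi> - d..\<phi> + d} \<union> {\<phi> + 2*pi - d..\<phi> + 2*pi + d} \<union> {\<phi> - 2*pi - d..\<phi> - 2*pi + d}"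
      proof (cases "x \<le> pi / 2")
        case True
        then have "x / 3 < e" using third_le_sin[of x] x by linarith
        then have "\<bar>\<theta> - \<phi>\<bar> \<le> d" unfolding x_def d_def by (simp add: field_simps)
        then show ?thesis by (auto simp: abs_if split: if_splits)
      next
        case False
        moreover have "sin (pi - x) = sin x" by simp
        ultimately have "(pi - x) / 3 < e" using third_le_sin[of "pi - x"] x by linarith
        then have "2 * pi - \<bar>\<theta> - \<phi>\<bar> \<le> d" unfolding x_def d_def by (simp add: field_simps)
        moreover have "\<bar>\<theta> - \<phi>\<bar> < 2 * pi" "d \<ge> 0" using \<theta> \<phi> R t by (auto simp: abs_if d_def e_def)
        ultimately show ?thesis by (cases "\<theta> \<ge> \<phi>") (auto simp: abs_if)
      qed
    qed
    then have "emeasure lebesgue ?T \<le> emeasure lebesgue ({\<phi> - d..\<phi> + d} \<union> {\<phi> + 2*pi - d..\<phi> + 2*pi + d} \<union> {\<phi> - 2*pi - d..\<phi> - 2*pi + d})"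
      by (rule emeasure_mono) simp
    also have "\<dots> \<le> emeasure lebesgue {\<phi> - d..\<phi> + d} + emeasure lebesgue {\<phi> + 2*pi - d..\<phi> + 2*pi + d} + emeasure lebesgue {\<phi> - 2*pi - d..\<phi> - 2*pi + d}"
      by (intro order_trans[OF emeasure_subadditive] add_mono emeasure_subadditive order_refl) auto
    also have "\<dots> = ennreal (36 / R) * ennreal t"
    proof -
      have d: "d \<ge> 0" using R t by (simp add: d_def e_def)
      have "ennreal (36 / R) * ennreal t = ennreal (2 * d) + ennreal (2 * d) + ennreal (2 * d)"
        using d R t by (simp add: d_def e_def flip: ennreal_plus ennreal_mult)
      then show ?thesis using d by simp
    qed
    finally show ?thesis .
  next
    case True
    show ?thesis unfolding True by simp
  qed
qed

text \<open>Multiplying by \<open>cnj w\<close> and taking the real part is the orthogonal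
  projection onto the line of the ray; it does not increase distances, so the parameters lie within
  \<open>t\<close> of that of the projected centre.\<close>

lemma emeasure_ray_disk:
  assumes w: "cmod w = 1" and t: "t \<ge> 0"
  shows "emeasure lebesgue {s::real. a + of_real s * w \<in> ball c t} \<le> 2 * ennreal t"
    and "{s::real. a + of_real s * w \<in> ball c t} \<in> sets lebesgue"
proof -
  let ?T = "{s::real. a + of_real s * w \<in> ball c t}"
  have "open ((\<lambda>s. a + of_real s * w) -` ball c t)"
    by (intro open_vimage continuous_intros) auto
  moreover have "(\<lambda>s. a + of_real s * w) -` ball c t = ?T" by auto
  ultimately show T: "?T \<in> sets lebesgue" by (simp add: borel_open)
  define s0 where "s0 = Re ((c - a) * cnj w)"
  have "?T \<subseteq> {s0 - t..s0 + t}"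
  proof
    fix s assume "s \<in> ?T"
    then have *: "cmod (a + of_real s * w - c) < t" by (simp add: dist_norm norm_minus_commute)
    have "w * cnj w = 1" using w complex_norm_square[of w] by simp
    then have "(a + of_real s * w - c) * cnj w = of_real s - (c - a) * cnj w"
      by (simp add: algebra_simps)
    then have "\<bar>s - s0\<bar> \<le> cmod ((a + of_real s * w - c) * cnj w)"
      using abs_Re_le_cmod[of "(a + of_real s * w - c) * cnj w"] by (simp add: s0_def)
    also have "\<dots> < t" using * w by (simp add: norm_mult)
    finally show "s \<in> {s0 - t..s0 + t}" by (auto simp: abs_less_iff)
  qed
  then have "emeasure lebesgue ?T \<le> emeasure lebesgue {s0 - t..s0 + t}"
    by (rule emeasure_mono) simp
  also have "\<dots> = 2 * ennreal t" using t by (simp add: ennreal_mult)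
  finally show "emeasure lebesgue ?T \<le> 2 * ennreal t" .
qed

text \<open>A disk of radius at most 1 that reaches modulus \<open>R\<close> has its centre at
  modulus at least \<open>R - 1\<close>. Since \<open>R - 1 \<ge> R / 2\<close> eventually, this
  shift costs a factor \<open>2 powr q\<close>.\<close>

lemma bigo_inverse_power_transfer:
  assumes g: "bigo_inverse_power q g" and q: "q \<ge> 0"
    and h: "\<And>R. R \<ge> L \<Longrightarrow> h R \<le> ennreal A * g (R - 1)" and A: "A \<ge> 0"
  shows "bigo_inverse_power q h"
proof -
  obtain C where "eventually (\<lambda>R. g R \<le> ennreal (C * (1 / R powr q))) at_top"
    using g by (auto simp: bigo_inverse_power_def)
  then obtain R1 where R1: "\<And>R. R \<ge> R1 \<Longrightarrow> g R \<le> ennreal (C * (1 / R powr q))"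
    by (auto simp: eventually_at_top_linorder)
  show ?thesis
    unfolding bigo_inverse_power_def
  proof (intro exI eventually_at_top_linorderI)
    fix R assume R: "max (max L (R1 + 1)) 2 \<le> R"
    have "h R \<le> ennreal A * g (R - 1)" using R by (intro h) auto
    also have "\<dots> \<le> ennreal A * ennreal (C * (1 / (R - 1) powr q))" using R by (intro mult_left_mono R1) auto
    also have "\<dots> \<le> ennreal A * ennreal (\<bar>C\<bar> * (2 powr q / R powr q))"
    proof (intro mult_left_mono ennreal_leI)
      have "(R / 2) powr q \<le> (R - 1) powr q" using R q by (intro powr_mono2) auto
      then have "1 / (R - 1) powr q \<le> 1 / (R / 2) powr q" using R by (intro divide_left_mono) auto
      also have "\<dots> = 2 powr q / R powr q" using R by (simp add: powr_divide)
      finally have "1 / (R - 1) powr q \<le> 2 powr q / R powr q" .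
      then show "C * (1 / (R - 1) powr q) \<le> \<bar>C\<bar> * (2 powr q / R powr q)"
        by (intro mult_mono) auto
    qed auto
    also have "\<dots> = ennreal (A * \<bar>C\<bar> * 2 powr q * (1 / R powr q))"
      using A by (simp add: ennreal_mult'[symmetric] mult.assoc)
    finally show "h R \<le> ennreal (A * \<bar>C\<bar> * 2 powr q * (1 / R powr q))" .
  qed
qed

lemma exceptional_ray_measure:
  assumes m: "minorant_off_disks u q f K c t" and q: "q \<ge> 0" and w: "cmod w = 1"
  shows "bigo_inverse_power q (\<lambda>R. ray_measure a w (disk_union K c t - ball 0 R))"
proof (rule bigo_inverse_power_transfer[where A=2 and L=0])
  show "bigo_inverse_power q (\<lambda>R. \<Sum>\<^sub>\<infinity>k\<in>{k\<in>K. cmod (c k) \<ge> R}. ennreal (t k))"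
    using m by (simp add: minorant_off_disks_def)
  fix R :: real
  let ?K = "{k\<in>K. cmod (c k) \<ge> R - 1}"
  have t: "0 \<le> t k \<and> t k \<le> 1" if "k \<in> K" for k using m that by (simp add: minorant_off_disks_def)
  have sub: "{s::real. 0 \<le> s \<and> a + of_real s * w \<in> disk_union K c t - ball 0 R} \<subseteq> (\<Union>k\<in>?K. {s. a + of_real s * w \<in> ball (c k) (t k)})"
  proof
    fix s assume "s \<in> {s::real. 0 \<le> s \<and> a + of_real s * w \<in> disk_union K c t - ball 0 R}"
    then obtain k where k: "k \<in> K" "a + of_real s * w \<in> ball (c k) (t k)" "cmod (a + of_real s * w) \<ge> R"
      by (auto simp: disk_union_def)
    have "cmod (a + of_real s * w - c k) < 1" using k(2) t[OF k(1)] by (simp add: dist_norm norm_minus_commute)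
    then have "cmod (c k) \<ge> R - 1" using k(3) norm_triangle_ineq2[of "a + of_real s * w" "c k"] by simp
    then show "s \<in> (\<Union>k\<in>?K. {s. a + of_real s * w \<in> ball (c k) (t k)})" using k by blast
  qed
  have "ray_measure a w (disk_union K c t - ball 0 R) \<le> emeasure lebesgue (\<Union>k\<in>?K. {s. a + of_real s * w \<in> ball (c k) (t k)})"
    unfolding ray_measure_def using t by (intro emeasure_mono sub sets.countable_UN') (auto intro!: emeasure_ray_disk[OF w])
  also have "\<dots> \<le> 2 * (\<Sum>\<^sub>\<infinity>k\<in>?K. ennreal (t k))"
    using t by (intro emeasure_UN_le_infsum emeasure_ray_disk[OF w]) auto
  finally show "ray_measure a w (disk_union K c t - ball 0 R) \<le> ennreal 2 * (\<Sum>\<^sub>\<infinity>k\<in>{k\<in>K. cmod (c k) \<ge> R - 1}. ennreal (t k))"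
    by simp
qed (use q in auto)

lemma exceptional_circle_measure:
  assumes m: "minorant_off_disks u q f K c t" and q: "q \<ge> 0"
  shows "bigo_inverse_power q (\<lambda>R. circle_measure R (disk_union K c t \<inter> sphere 0 R))"
proof (rule bigo_inverse_power_transfer[where A=36 and L=1])
  show "bigo_inverse_power q (\<lambda>R. \<Sum>\<^sub>\<infinity>k\<in>{k\<in>K. cmod (c k) \<ge> R}. ennreal (t k))"
    using m by (simp add: minorant_off_disks_def)
  fix R :: real assume R: "R \<ge> 1"
  let ?K = "{k\<in>K. cmod (c k) \<ge> R - 1}"
  let ?T = "\<lambda>k. {\<theta>. 0 \<le> \<theta> \<and> \<theta> < 2 * pi \<and> of_real R * cis \<theta> \<in> ball (c k) (t k)}"
  have t: "0 \<le> t k \<and> t k \<le> 1" if "k \<in> K" for k using m that by (simp add: minorant_off_disks_def)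
  have sub: "{\<theta>. 0 \<le> \<theta> \<and> \<theta> < 2 * pi \<and> of_real R * cis \<theta> \<in> disk_union K c t \<inter> sphere 0 R} \<subseteq> (\<Union>k\<in>?K. ?T k)"
  proof
    fix \<theta> assume "\<theta> \<in> {\<theta>. 0 \<le> \<theta> \<and> \<theta> < 2 * pi \<and> of_real R * cis \<theta> \<in> disk_union K c t \<inter> sphere 0 R}"
    then obtain k where k: "k \<in> K" "0 \<le> \<theta>" "\<theta> < 2 * pi" "of_real R * cis \<theta> \<in> ball (c k) (t k)"
      by (auto simp: disk_union_def)
    have "cmod (of_real R * cis \<theta> - c k) < 1" using k(4) t[OF k(1)] by (simp add: dist_norm norm_minus_commute)
    moreover have "cmod (of_real R * cis \<theta>) = R" using R by (simp add: norm_mult)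
    ultimately have "cmod (c k) \<ge> R - 1" using norm_triangle_ineq2[of "of_real R * cis \<theta>" "c k"] by simp
    then show "\<theta> \<in> (\<Union>k\<in>?K. ?T k)" using k by blast
  qed
  have "emeasure lebesgue {\<theta>. 0 \<le> \<theta> \<and> \<theta> < 2 * pi \<and> of_real R * cis \<theta> \<in> disk_union K c t \<inter> sphere 0 R} \<le> emeasure lebesgue (\<Union>k\<in>?K. ?T k)"
    using t R by (intro emeasure_mono sub sets.countable_UN') (auto intro!: emeasure_circle_disk(2))
  also have "\<dots> \<le> ennreal (36 / R) * (\<Sum>\<^sub>\<infinity>k\<in>?K. ennreal (t k))"
    using t R by (intro emeasure_UN_le_infsum emeasure_circle_disk) auto
  finally have "circle_measure R (disk_union K c t \<inter> sphere 0 R) \<le> ennreal R * (ennreal (36 / R) * (\<Sum>\<^sub>\<infinity>k\<in>?K. ennreal (t k)))"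
    unfolding circle_measure_def by (intro mult_left_mono) auto
  also have "\<dots> = ennreal 36 * (\<Sum>\<^sub>\<infinity>k\<in>?K. ennreal (t k))"
  proof -
    have "ennreal R * ennreal (36 / R) = ennreal 36" using R by (subst ennreal_mult[symmetric]) auto
    then show ?thesis by (simp add: mult.assoc[symmetric])
  qed
  finally show "circle_measure R (disk_union K c t \<inter> sphere 0 R) \<le> ennreal 36 * (\<Sum>\<^sub>\<infinity>k\<in>{k\<in>K. cmod (c k) \<ge> R - 1}. ennreal (t k))" .
qed (use q in auto)

section \<open>Entire minorants\<close>

text \<open>The analogue of \<open>trunc\<close> for \<open>log_abs f\<close>. Truncating inside the
  logarithm avoids \<open>ln 0\<close> and gives a continuous function for continuous
  \<open>f\<close>.\<close>

definition tlog :: "(complex \<Rightarrow> complex) \<Rightarrow> nat \<Rightarrow> complex \<Rightarrow> real" where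
  "tlog f n w = ln (max (exp (- real n)) (cmod (f w)))"

lemma tlog_ereal: "ereal (tlog f n w) = max (log_abs f w) (- ereal (real n))"
proof (cases "f w = 0")
  case False
  then have "ln (max (exp (- real n)) (cmod (f w))) = max (- real n) (ln (cmod (f w)))"
    by (simp add: max_def) (smt (verit) exp_le_cancel_iff exp_ln zero_less_norm_iff)
  then show ?thesis using False by (simp add: tlog_def log_abs_def elog_def max.commute)
qed (simp add: tlog_def log_abs_def elog_def)

lemma continuous_tlog:
  assumes "f holomorphic_on UNIV"
  shows "continuous_on UNIV (tlog f n)"
proof -
  have "max (exp (- real n)) x > 0" for x by (simp add: less_max_iff_disj)
  then have "max (exp (- real n)) x \<noteq> 0" for x by (metis less_irrefl)
  then show ?thesis
    unfolding tlog_def using holomorphic_on_imp_continuous_on[OF assms]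
    by (intro continuous_intros) auto
qed

text \<open>The lower bound by half the central value keeps \<open>f\<close> zero-free on the disk,
  where \<open>ln (cmod f)\<close> is then harmonic.\<close>

lemma tlog_submean:
  assumes f: "f holomorphic_on UNIV" and r: "0 < r" "r < R"
    and near: "\<And>w'. dist w w' < R \<Longrightarrow> cmod (f w') \<ge> cmod (f w) / 2"
    and fw: "f w \<noteq> 0"
  shows "ln (cmod (f w)) \<le> cmean (tlog f n) w r"
proof -
  have lt: "locbdd (tlog f m)" for m using f by (intro locbdd_continuous continuous_tlog)
  have nz: "f w' \<noteq> 0" if "w' \<in> ball w R" for w'
    using near[of w'] that fw by auto
  have "ln (cmod (f w)) = cmean (\<lambda>w. ln (cmod (f w))) w r"
    using r by (intro cmean_ln_holomorphic[symmetric, of _ _ R] nz) (auto intro: holomorphic_on_subset[OF f])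
  also have "\<dots> \<le> cmean (tlog f n) w r"
  proof -
    \<comment> \<open>\<open>ln (cmod f)\<close> is not locally bounded near zeros of
      \<open>f\<close>, so monotonicity of means is applied to a truncation so deep that it changes
      nothing on the circle.\<close>
    obtain m :: nat where m: "exp (- real m) \<le> cmod (f w) / 2"
    proof -
      obtain m :: nat where "- ln (cmod (f w) / 2) \<le> real m" using real_arch_simple by blast
      then have "exp (- real m) \<le> exp (ln (cmod (f w) / 2))" by simp
      also have "\<dots> = cmod (f w) / 2" using fw by (intro exp_ln) auto
      finally show ?thesis using that by blast
    qed
    have circle: "exp (- real m) \<le> cmod (f w') \<and> f w' \<noteq> 0" if "cmod (w' - w) = \<bar>r\<bar>" for w'
      using near[of w'] m that r nz[of w'] by (simp add: dist_norm norm_minus_commute)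
    have "cmean (\<lambda>w. ln (cmod (f w))) w r = cmean (tlog f m) w r"
      using circle by (intro cmean_cong) (simp add: tlog_def max_def)
    also have "\<dots> \<le> cmean (tlog f n) w r"
    proof (intro cmean_mono lt)
      fix w' assume "cmod (w' - w) = \<bar>r\<bar>"
      note c = circle[OF this]
      have "ln (cmod (f w')) \<le> tlog f n w'" unfolding tlog_def using c by (subst ln_le_cancel_iff) (auto simp: less_max_iff_disj)
      then show "tlog f m w' \<le> tlog f n w'" using c by (simp add: tlog_def[of f m] max_absorb2)
    qed
    finally show ?thesis .
  qed
  finally show ?thesis .
qed

text \<open>Where \<open>cmod (f w)\<close> is at most \<open>exp (- n)\<close> the function has its
  least value. Elsewhere uniform continuity with tolerance \<open>exp (- n) / 2\<close> keeps
  \<open>cmod f\<close> above half its value at the centre, within a radius uniform for bounded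
  \<open>w\<close>.\<close>

lemma rsh_tlog:
  assumes f: "f holomorphic_on UNIV"
  shows "rsh (tlog f n)"
proof -
  have lt: "locbdd (tlog f n)" using f by (intro locbdd_continuous continuous_tlog)
  have ge: "tlog f n w \<ge> - real n" for w
    using tlog_ereal[of f n w] by (metis ereal_less_eq(3) max.cobounded2 uminus_ereal.simps(1))
  have "\<exists>e>0. \<forall>w r. cmod w \<le> R \<longrightarrow> 0 < r \<longrightarrow> r \<le> e \<longrightarrow> tlog f n w \<le> cmean (tlog f n) w r" for R
  proof -
    have "continuous_on (cball 0 (R + 1)) f"
      using holomorphic_on_imp_continuous_on[OF f] by (rule continuous_on_subset) simp
    then have "uniformly_continuous_on (cball 0 (R + 1)) f"
      by (intro compact_uniformly_continuous) auto
    then obtain d where d: "d > 0" "\<And>x y. x \<in> cball 0 (R + 1) \<Longrightarrow> y \<in> cball 0 (R + 1) \<Longrightarrow> dist y x < d \<Longrightarrow> dist (f y) (f x) < exp (- real n) / 2"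
      unfolding uniformly_continuous_on_def by (metis half_gt_zero_iff exp_gt_zero)
    define e where "e = min d 1 / 2"
    have "tlog f n w \<le> cmean (tlog f n) w r" if w: "cmod w \<le> R" and r: "0 < r" "r \<le> e" for w r
    proof (cases "cmod (f w) > exp (- real n)")
      case True
      have "ln (cmod (f w)) \<le> cmean (tlog f n) w r"
      proof (rule tlog_submean[OF f r(1), where R="2 * e"])
        show "r < 2 * e" using r by simp
        show "f w \<noteq> 0" using True by auto
        fix w' assume w': "dist w w' < 2 * e"
        then have "cmod w' \<le> R + 1"
          using w norm_triangle_ineq[of "w' - w" w] by (simp add: e_def dist_norm norm_minus_commute)
        then have "dist (f w') (f w) < exp (- real n) / 2"
          using w w' by (intro d(2)) (auto simp: e_def dist_commute)
        then show "cmod (f w) / 2 \<le> cmod (f w')"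
          using True norm_triangle_ineq2[of "f w" "f w'"] by (simp add: dist_norm norm_minus_commute)
      qed
      then show ?thesis using True by (simp add: tlog_def max_def)
    next
      case False
      then have "tlog f n w = - real n" by (simp add: tlog_def max_def)
      then show ?thesis using ge by (auto intro!: cmean_ge lt)
    qed
    moreover have "e > 0" using d by (simp add: e_def)
    ultimately show ?thesis by blast
  qed
  then show ?thesis
    unfolding rsh_def using ge usc_continuous[OF continuous_tlog[OF f]] by blast
qed

text \<open>A circle of radius \<open>s\<close> about \<open>z\<close> meets disk \<open>k\<close>
  only if \<open>s\<close> is within \<open>t k\<close> of the distance from \<open>z\<close> to
  \<open>c k\<close>, so the bad radii have measure at most twice the sum of the \<open>t k\<close>.
  As \<open>s\<close> and \<open>t k\<close> are at most 1, only centres of modulus at least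
  \<open>cmod z - 2\<close> count.\<close>

lemma sphere_avoiding_disks:
  assumes t: "\<And>k. k \<in> K \<Longrightarrow> 0 \<le> t k \<and> t k \<le> 1" and d: "0 < d" "d \<le> 1"
    and small: "2 * (\<Sum>\<^sub>\<infinity>k\<in>{k\<in>K. cmod (c k) \<ge> cmod z - 2}. ennreal (t k)) < ennreal d"
  obtains s where "0 < s" "s < d" "sphere z s \<inter> disk_union K c t = {}"
proof -
  let ?K = "{k\<in>K. cmod (c k) \<ge> cmod z - 2}"
  let ?I = "\<lambda>k. {cmod (c k - z) - t k..cmod (c k - z) + t k}"
  have "emeasure lborel (\<Union>k\<in>?K. ?I k) \<le> 2 * (\<Sum>\<^sub>\<infinity>k\<in>?K. ennreal (t k))"
    using t by (intro emeasure_UN_le_infsum) (auto simp: ennreal_mult)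
  also note small
  also have "ennreal d = emeasure lborel {0<..<d}" using d by simp
  finally have lt: "emeasure lborel (\<Union>k\<in>?K. ?I k) < emeasure lborel {0<..<d}" .
  have "\<not> {0<..<d} \<subseteq> (\<Union>k\<in>?K. ?I k)"
  proof
    assume "{0<..<d} \<subseteq> (\<Union>k\<in>?K. ?I k)"
    then have "emeasure lborel {0<..<d} \<le> emeasure lborel (\<Union>k\<in>?K. ?I k)"
      by (intro emeasure_mono) (auto intro!: sets.countable_UN')
    then show False using lt by simp
  qed
  then obtain s where "s \<in> {0<..<d}" "s \<notin> (\<Union>k\<in>?K. ?I k)" by blast
  then have s: "0 < s" "s < d" "\<And>k. k \<in> ?K \<Longrightarrow> s \<notin> ?I k" by auto
  have "w \<notin> ball (c k) (t k)" if w: "w \<in> sphere z s" and k: "k \<in> K" for w k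
  proof
    assume "w \<in> ball (c k) (t k)"
    then have wk: "cmod (c k - w) < t k" by (simp add: dist_norm)
    have ws: "cmod (w - z) = s" using w by (simp add: dist_norm norm_minus_commute)
    have "cmod (c k - z) \<le> cmod (c k - w) + cmod (w - z)" using norm_triangle_ineq[of "c k - w" "w - z"] by simp
    moreover have "cmod (w - z) \<le> cmod (c k - w) + cmod (c k - z)"
      using norm_triangle_ineq[of "w - c k" "c k - z"] by (simp add: norm_minus_commute)
    ultimately have I: "s \<in> ?I k" using wk ws by simp
    have "cmod z \<le> cmod (c k) + cmod (c k - z)"
      using norm_triangle_ineq4[of "c k" "c k - z"] by simp
    moreover have "cmod (c k - z) < 2" using I wk ws t[OF k] s d \<open>cmod (c k - z) \<le> cmod (c k - w) + cmod (w - z)\<close> by simp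
    ultimately have "k \<in> ?K" using k by simp
    then show False using s(3) I by blast
  qed
  then have "sphere z s \<inter> disk_union K c t = {}" unfolding disk_union_def by blast
  then show ?thesis using s by (intro that)
qed

context subharm
begin

text \<open>Both functions are truncated at the same level, so that the inequality on the circle
  survives and the sub-mean value property applies; then the level tends to -\<infinity>.\<close>

lemma log_abs_le_C:
  assumes f: "f holomorphic_on UNIV" and s: "s > 0" and le: "\<And>w. w \<in> sphere z s \<Longrightarrow> log_abs f w \<le> u w"
  shows "log_abs f z \<le> ereal (C z s)"
proof -
  have "log_abs f z \<le> ereal (cmean (trunc u n) z s)" for n
  proof -
    have "log_abs f z \<le> ereal (tlog f n z)" by (simp add: tlog_ereal)
    also have "tlog f n z \<le> cmean (tlog f n) z s" using rsh_tlog[OF f] s by (intro rsh_submean) auto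
    also have "\<dots> \<le> cmean (trunc u n) z s"
    proof (intro cmean_mono rsh_locbdd[OF rsh_tlog[OF f]] locbdd_trunc)
      fix w assume "cmod (w - z) = \<bar>s\<bar>"
      then have "log_abs f w \<le> u w" using s by (intro le) (simp add: dist_norm norm_minus_commute)
      then have "ereal (tlog f n w) \<le> ereal (trunc u n w)"
        unfolding tlog_ereal trunc_ereal by (intro max.mono order_refl)
      then show "tlog f n w \<le> trunc u n w" by simp
    qed
    finally show ?thesis by simp
  qed
  then show ?thesis
    by (intro LIMSEQ_le_const[OF cmean_trunc_tendsto_ereal[of z s, unfolded C_ereal[OF s]]] exI[of _ 0] allI impI)
qed

text \<open>Disks at exponent \<open>q + 1\<close> have tails of order
  \<open>1 / R powr (q + 1)\<close>; the extra power beats any constant and leaves twice the tail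
  below \<open>Q / 2\<close>.\<close>

lemma log_abs_le_B_far:
  assumes m: "minorant_off_disks u (q + 1) f K c t" and q: "q \<ge> 0"
  shows "\<exists>R. \<forall>z. cmod z \<ge> R \<longrightarrow> log_abs f z \<le> ereal (B z ((1 + cmod z) powr (- q)))"
proof -
  have f: "f holomorphic_on UNIV" and t: "\<And>k. k \<in> K \<Longrightarrow> 0 \<le> t k \<and> t k \<le> 1"
    and off: "\<And>z. z \<notin> disk_union K c t \<Longrightarrow> log_abs f z \<le> u z"
    using m by (auto simp: minorant_off_disks_def nonzero_entire_def)
  let ?g = "\<lambda>R. \<Sum>\<^sub>\<infinity>k\<in>{k\<in>K. cmod (c k) \<ge> R}. ennreal (t k)"
  have "bigo_inverse_power (q + 1) ?g" using m by (simp add: minorant_off_disks_def)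
  then obtain A where "eventually (\<lambda>R. ?g R \<le> ennreal (A * (1 / R powr (q + 1)))) at_top"
    by (auto simp: bigo_inverse_power_def)
  then obtain R1 where R1: "\<And>R. R \<ge> R1 \<Longrightarrow> ?g R \<le> ennreal (A * (1 / R powr (q + 1)))"
    by (auto simp: eventually_at_top_linorder)
  \<comment> \<open>The 5 gives \<open>cmod z - 2 \<ge> (1 + cmod z) / 2\<close>, the first entry
    puts \<open>cmod z - 2\<close> into the range of the tail bound, and the last turns the surplus
    power into the required smallness.\<close>
  define R where "R = max (max (R1 + 2) 5) (4 * \<bar>A\<bar> * 2 powr (q + 1))"
  have "log_abs f z \<le> ereal (B z ((1 + cmod z) powr (- q)))" if z: "cmod z \<ge> R" for z
  proof -
    let ?x = "1 + cmod z"
    define Q where "Q = ?x powr (- q)"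
    have z5: "cmod z \<ge> 5" "cmod z \<ge> R1 + 2" "4 * \<bar>A\<bar> * 2 powr (q + 1) < ?x" using z by (auto simp: R_def)
    have Q: "0 < Q" "Q \<le> 1"
    proof -
      show "0 < Q" using z5 by (simp add: Q_def)
      have "?x powr (- q) \<le> ?x powr 0" using z5 q by (intro powr_mono) auto
      then show "Q \<le> 1" using z5 by (simp add: Q_def)
    qed
    have "2 * ?g (cmod z - 2) \<le> 2 * ennreal (A * (1 / (cmod z - 2) powr (q + 1)))"
      using z5 by (intro mult_left_mono R1) auto
    also have "\<dots> \<le> 2 * ennreal (\<bar>A\<bar> * 2 powr (q + 1) / ?x * Q)"
    proof (intro mult_left_mono ennreal_leI)
      have "(?x / 2) powr (q + 1) \<le> (cmod z - 2) powr (q + 1)" using z5 q by (intro powr_mono2) auto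
      then have "1 / (cmod z - 2) powr (q + 1) \<le> 1 / (?x / 2) powr (q + 1)" using z5 by (intro divide_left_mono) auto
      also have "\<dots> = 2 powr (q + 1) / ?x * Q"
      proof -
        have "(?x / 2) powr (q + 1) = (?x powr q * ?x) / 2 powr (q + 1)"
          using z5 by (subst powr_divide) (auto simp: powr_add[of ?x])
        moreover have "Q = 1 / ?x powr q" by (simp add: Q_def powr_minus_divide)
        moreover have "1 / ((a * x) / b) = b / x * (1 / a)" for a b x :: real by simp
        ultimately show ?thesis by (simp only:)
      qed
      finally have "1 / (cmod z - 2) powr (q + 1) \<le> 2 powr (q + 1) / ?x * Q" .
      then have "A * (1 / (cmod z - 2) powr (q + 1)) \<le> \<bar>A\<bar> * (2 powr (q + 1) / ?x * Q)"
        by (intro mult_mono) auto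
      then show "A * (1 / (cmod z - 2) powr (q + 1)) \<le> \<bar>A\<bar> * 2 powr (q + 1) / ?x * Q" by (simp add: mult.assoc)
    qed auto
    also have "\<dots> = ennreal (2 * (\<bar>A\<bar> * 2 powr (q + 1) / ?x * Q))"
      using Q z5 by (subst ennreal_mult) auto
    also have "\<dots> < ennreal (Q / 2)"
    proof (rule ennreal_lessI)
      have "4 * (\<bar>A\<bar> * 2 powr (q + 1) / ?x) < 1" using z5 by (simp add: field_simps)
      then have "4 * (\<bar>A\<bar> * 2 powr (q + 1) / ?x) * Q < 1 * Q" using Q by (intro mult_strict_right_mono) auto
      then show "2 * (\<bar>A\<bar> * 2 powr (q + 1) / ?x * Q) < Q / 2" by simp
    qed (use Q in simp)
    finally have "2 * ?g (cmod z - 2) < ennreal (Q / 2)" .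
    then obtain s where s: "0 < s" "s < Q / 2" "sphere z s \<inter> disk_union K c t = {}"
      using sphere_avoiding_disks[where K=K and t=t and d="Q / 2" and c=c and z=z] t Q by auto
    have "log_abs f z \<le> ereal (C z s)"
    proof (rule log_abs_le_C[OF f s(1)])
      fix w assume "w \<in> sphere z s"
      then have "w \<notin> disk_union K c t" using s(3) by blast
      then show "log_abs f w \<le> u w" by (rule off)
    qed
    also have "C z s \<le> C z (Q / 2)" using s by (intro C_mono) auto
    also have "\<dots> \<le> B z Q" using Q by (intro C_half_le_B)
    finally show ?thesis by (simp add: Q_def)
  qed
  then show ?thesis by blast
qed

text \<open>A constant factor \<open>\<kappa> \<le> 1\<close> preserves the estimates already
  present, so one function keeps its disks and gains the bound by means. For bounded
  \<open>z\<close> the right side is at least \<open>C z d\<close>, with \<open>d\<close> half the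
  smallest \<open>Q\<close>, hence bounded below, while \<open>f\<close> is bounded above.\<close>

lemma minorant_by_means_exists:
  assumes m: "minorant_off_disks u (q + 1) f K c t" and q: "q \<ge> 0"
  shows "\<exists>g. minorant_by_means u q g \<and> minorant_off_disks u (q + 1) g K c t"
proof -
  have f: "nonzero_entire f" "f holomorphic_on UNIV"
    using m by (auto simp: minorant_off_disks_def nonzero_entire_def)
  obtain R' where R': "\<And>z. cmod z \<ge> R' \<Longrightarrow> log_abs f z \<le> ereal (B z ((1 + cmod z) powr (- q)))"
    using log_abs_le_B_far[OF m q] by blast
  define R where "R = max R' 0"
  define d where "d = (1 + R) powr (- q) / 2"
  have d: "d > 0" by (simp add: d_def R_def add_pos_nonneg)
  obtain l where l: "\<And>z. cmod z \<le> R \<Longrightarrow> l \<le> C z d" using C_lower[OF d, of R] by blast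
  have "compact (f ` cball 0 R)"
    using holomorphic_on_imp_continuous_on[OF f(2)]
    by (intro compact_continuous_image compact_cball) (auto intro: continuous_on_subset)
  then obtain F where F: "F > 0" "\<And>z. cmod z \<le> R \<Longrightarrow> cmod (f z) \<le> F"
    using compact_imp_bounded[of "f ` cball 0 R"] by (auto simp: bounded_pos)
  define \<kappa> where "\<kappa> = min 1 (exp l / F)"
  have \<kappa>: "0 < \<kappa>" "\<kappa> \<le> 1" "\<kappa> \<le> exp l / F" using F by (auto simp: \<kappa>_def)
  define g where "g = (\<lambda>z. of_real \<kappa> * f z)"
  have g: "log_abs g z = log_abs f z + ereal (ln \<kappa>)" for z
    unfolding g_def using \<kappa> by (subst log_abs_cmult) auto
  have gf: "log_abs g z \<le> log_abs f z" for z
    unfolding g using \<kappa> by (cases "log_abs f z") auto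
  have ng: "nonzero_entire g" unfolding g_def using \<kappa> f by (intro nonzero_entire_cmult) auto
  have "log_abs g z \<le> ereal (B z ((1 + cmod z) powr (- q)))" for z
  proof (cases "cmod z \<ge> R")
    case True
    then show ?thesis using order_trans[OF gf R'[of z]] by (simp add: R_def)
  next
    case False
    let ?Q = "(1 + cmod z) powr (- q)"
    have c1: "1 + cmod z > 0" using norm_ge_zero[of z] by linarith
    have "d \<le> ?Q / 2" unfolding d_def using False q c1 by (intro divide_right_mono powr_mono2') auto
    then have "C z d \<le> C z (?Q / 2)" using d by (intro C_mono)
    also have "\<dots> \<le> B z ?Q" using c1 by (intro C_half_le_B) auto
    finally have lB: "l \<le> B z ?Q" using l[of z] False by simp
    have "cmod (g z) \<le> exp l / F * F"
      unfolding g_def norm_mult using \<kappa> F False by (intro mult_mono) auto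
    then have ge: "cmod (g z) \<le> exp l" using F by simp
    have "log_abs g z \<le> ereal l"
    proof (cases "g z = 0")
      case False
      then have "ln (cmod (g z)) \<le> ln (exp l)" using ge by (subst ln_le_cancel_iff) auto
      then show ?thesis using False by (simp add: log_abs_def elog_def)
    qed (simp add: log_abs_def elog_def)
    then show ?thesis using lB by (meson ereal_less_eq(3) order_trans)
  qed
  then have "minorant_by_means u q g" using ng by (simp add: minorant_by_means_iff)
  moreover have "minorant_off_disks u (q + 1) g K c t"
    using m ng order_trans[OF gf] by (auto simp: minorant_off_disks_def)
  ultimately show ?thesis by blast
qed

lemma minorant_off_disks_weaken:
  assumes m: "minorant_off_disks u (q + 1) f K c t"
  shows "minorant_off_disks u q f K c t"
proof -
  have "bigo_inverse_power q g" if g: "bigo_inverse_power (q + 1) g" for g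
  proof -
    obtain A where "eventually (\<lambda>R. g R \<le> ennreal (A * (1 / R powr (q + 1)))) at_top"
      using g by (auto simp: bigo_inverse_power_def)
    moreover have "eventually (\<lambda>R. R \<ge> (1::real)) at_top" by (rule eventually_ge_at_top)
    ultimately have "eventually (\<lambda>R. g R \<le> ennreal (\<bar>A\<bar> * (1 / R powr q))) at_top"
    proof eventually_elim
      case (elim R)
      have "A * (1 / R powr (q + 1)) \<le> \<bar>A\<bar> * (1 / R powr q)"
        using elim by (intro mult_mono divide_left_mono powr_mono) auto
      then show ?case using elim(1) by (meson ennreal_leI order_trans)
    qed
    then show ?thesis by (auto simp: bigo_inverse_power_def)
  qed
  then show ?thesis using m by (simp add: minorant_off_disks_def)
qed

text \<open>Because \<open>Q \<le> 1\<close>, the bound by suprema only enlarges the radius by 1, a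
  shift that order and type do not notice.\<close>

lemma disk_sup_minorant_le:
  assumes m: "minorant_by_means u q f" and q: "q \<ge> 0" and r: "r \<ge> 0"
  shows "disk_sup (log_abs f) 0 r \<le> disk_sup u 0 (r + 1)"
  unfolding disk_sup_def[of "log_abs f"]
proof (rule SUP_least)
  fix z assume z: "z \<in> cball (0::complex) r"
  let ?Q = "(1 + cmod z) powr (- q)"
  have "?Q \<le> (1 + cmod z) powr 0" using q by (intro powr_mono) auto
  also have "\<dots> = 1" using norm_ge_zero[of z] by (simp add: add_nonneg_eq_0_iff)
  finally have Q: "?Q \<le> 1" .
  have "log_abs f z \<le> disk_sup u z ?Q" using m unfolding minorant_by_means_def Let_def by (meson order_trans)
  also have "\<dots> \<le> disk_sup u 0 (r + 1)"
    unfolding disk_sup_def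
  proof (intro SUP_subset_mono order_refl)
    show "cball z ?Q \<subseteq> cball 0 (r + 1)"
    proof
      fix w assume "w \<in> cball z ?Q"
      then have "cmod (w - z) \<le> 1" using Q by (simp add: dist_norm norm_minus_commute)
      then show "w \<in> cball 0 (r + 1)" using z norm_triangle_ineq[of "w - z" z] by simp
    qed
  qed
  finally show "log_abs f z \<le> disk_sup u 0 (r + 1)" .
qed

end

section \<open>Growth\<close>

text \<open>Common core for order and type. Nonnegative \<open>e\<close> makes the upper limit
  nonnegative, so the auxiliary \<open>b\<close> above it is positive and the factor
  \<open>c / b > 1\<close> can swallow the ratio of the shifted scales.\<close>

lemma Limsup_shift_le:
  fixes e e' :: "real \<Rightarrow> ereal" and \<phi> :: "real \<Rightarrow> real"
  assumes le: "eventually (\<lambda>r. e' r \<le> e (r + 1)) at_top" and e0: "\<And>r. 0 \<le> e r"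
    and pos: "eventually (\<lambda>r. \<phi> r > 0) at_top"
    and lim: "((\<lambda>r. \<phi> (r + 1) / \<phi> r) \<longlongrightarrow> 1) at_top"
  shows "Limsup at_top (\<lambda>r. e' r / ereal (\<phi> r)) \<le> Limsup at_top (\<lambda>r. e r / ereal (\<phi> r))"
    (is "_ \<le> ?X")
  unfolding Limsup_le_iff[of at_top]
proof (intro allI impI)
  fix y assume y: "?X < y"
  have "eventually (\<lambda>r. 0 \<le> e r / ereal (\<phi> r)) at_top"
    using pos by eventually_elim (simp add: e0 zero_le_divide_ereal)
  then have X0: "0 \<le> ?X" by (intro le_Limsup) auto
  obtain c where c: "?X < ereal c" "ereal c < y" using ereal_dense2[OF y] by blast
  obtain b where b: "?X < ereal b" "b < c" using ereal_dense2[OF c(1)] by auto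
  have b0: "b > 0" using X0 b(1) by (metis le_less_trans less_ereal.simps(1) zero_ereal_def)
  have shift: "filterlim (\<lambda>r::real. r + 1) at_top at_top"
    by (rule filterlim_at_top_mono[OF filterlim_ident]) auto
  have "eventually (\<lambda>r. e r / ereal (\<phi> r) < ereal b \<and> \<phi> r > 0) at_top"
    using Limsup_lessD[OF b(1)] pos by eventually_elim auto
  then have "eventually (\<lambda>r. e (r + 1) / ereal (\<phi> (r + 1)) < ereal b \<and> \<phi> (r + 1) > 0) at_top"
    by (rule eventually_compose_filterlim[OF _ shift])
  moreover have "eventually (\<lambda>r. \<phi> (r + 1) / \<phi> r < c / b) at_top"
    using b b0 by (intro order_tendstoD(2)[OF lim]) simp
  ultimately show "eventually (\<lambda>r. e' r / ereal (\<phi> r) < y) at_top"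
    using pos le
  proof eventually_elim
    case (elim r)
    have "e (r + 1) \<le> ereal (b * \<phi> (r + 1))"
      using elim(1) by (cases "e (r + 1)") (auto simp: field_simps)
    also have "b * \<phi> (r + 1) \<le> c * \<phi> r" using elim b0 by (simp add: field_simps)
    finally have "e' r \<le> ereal (c * \<phi> r)" using elim(4) by (meson ereal_less_eq(3) order_trans)
    then have "e' r / ereal (\<phi> r) \<le> ereal (c * \<phi> r) / ereal (\<phi> r)"
      using elim(3) by (intro ereal_divide_right_mono) auto
    also have "\<dots> = ereal c" using elim(3) by simp
    finally show ?case using c(2) by simp
  qed
qed

lemma powr_shift_tendsto: "((\<lambda>r::real. (r + c) powr p / r powr p) \<longlongrightarrow> 1) at_top"
proof -
  have "((\<lambda>r. 1 + c / r) \<longlongrightarrow> 1 + 0) at_top"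
    by (intro tendsto_intros tendsto_divide_0[OF tendsto_const] filterlim_at_top_imp_at_infinity filterlim_ident)
  then have lim: "((\<lambda>r. (1 + c / r) powr p) \<longlongrightarrow> (1 + 0) powr p) at_top"
    by (intro tendsto_powr tendsto_const) auto
  have "eventually (\<lambda>r. (1 + c / r) powr p = (r + c) powr p / r powr p) at_top"
    using eventually_gt_at_top[of "\<bar>c\<bar>"]
  proof eventually_elim
    case (elim r)
    then have "1 + c / r = (r + c) / r" by (simp add: field_simps)
    then show ?case using elim by (simp add: powr_divide)
  qed
  from Lim_transform_eventually[OF lim this] show ?thesis by simp
qed

lemma ln_shift_tendsto: "((\<lambda>r::real. ln (r + 1) / ln r) \<longlongrightarrow> 1) at_top"
proof -
  have "((\<lambda>r::real. 1 + 1 / r) \<longlongrightarrow> 1 + 0) at_top"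
    by (intro tendsto_intros tendsto_divide_0[OF tendsto_const] filterlim_at_top_imp_at_infinity filterlim_ident)
  then have "((\<lambda>r::real. ln (1 + 1 / r)) \<longlongrightarrow> ln (1 + 0)) at_top" by (intro tendsto_ln) auto
  then have lim: "((\<lambda>r::real. 1 + ln (1 + 1 / r) / ln r) \<longlongrightarrow> 1 + 0) at_top"
    by (intro tendsto_add tendsto_const tendsto_divide_0 filterlim_at_top_imp_at_infinity ln_at_top)
  have "eventually (\<lambda>r::real. 1 + ln (1 + 1 / r) / ln r = ln (r + 1) / ln r) at_top"
    using eventually_gt_at_top[of 1]
  proof eventually_elim
    case (elim r)
    then have "r + 1 = r * (1 + 1 / r)" by (simp add: field_simps)
    moreover have "1 + 1 / r > 0" using elim by (simp add: add_pos_pos)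
    ultimately have "ln (r + 1) = ln r + ln (1 + 1 / r)" using elim ln_mult[of r "1 + 1 / r"] by simp
    moreover have "ln r > 0" using elim by simp
    ultimately show ?case by (simp only: add_divide_distrib) simp
  qed
  from Lim_transform_eventually[OF lim this] show ?thesis by simp
qed

lemma elog_mono: "x \<le> y \<Longrightarrow> elog x \<le> elog y"
  by (cases x; cases y) (auto simp: elog_def)

lemma elog_ge_0: "x \<ge> 0 \<Longrightarrow> elog (1 + x) \<ge> 0"
  by (cases x) (auto simp: elog_def one_ereal_def)

lemma radial_order_shift:
  assumes "\<And>r. r \<ge> 0 \<Longrightarrow> m' r \<le> m (r + 1)"
  shows "radial_order m' \<le> radial_order m"
  unfolding radial_order_def
proof (rule Limsup_shift_le[OF _ _ _ ln_shift_tendsto])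
  show "eventually (\<lambda>r. elog (1 + max 0 (m' r)) \<le> elog (1 + max 0 (m (r + 1)))) at_top"
    using eventually_ge_at_top[of 0]
    by eventually_elim (intro elog_mono add_left_mono max.mono order_refl assms)
  show "eventually (\<lambda>r::real. ln r > 0) at_top"
    using eventually_gt_at_top[of 1] by eventually_elim simp
qed (simp add: elog_ge_0)

lemma radial_type_shift:
  assumes "\<And>r. r \<ge> 0 \<Longrightarrow> m' r \<le> m (r + 1)"
  shows "radial_type p m' \<le> radial_type p m"
  unfolding radial_type_def
proof (rule Limsup_shift_le[OF _ _ _ powr_shift_tendsto])
  show "eventually (\<lambda>r. max 0 (m' r) \<le> max 0 (m (r + 1))) at_top"
    using eventually_ge_at_top[of 0] by eventually_elim (intro max.mono order_refl assms)
  show "eventually (\<lambda>r::real. r powr p > 0) at_top"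
    using eventually_gt_at_top[of 0] by eventually_elim simp
qed simp

section \<open>A barrier for a segment and the two-constants theorem\<close>

definition lg :: "real \<Rightarrow> real \<Rightarrow> real" where
  "lg d x = max 0 (- ln (max d \<bar>x\<bar>))"

lemma continuous_lg: "d > 0 \<Longrightarrow> continuous_on UNIV (lg d)"
  unfolding lg_def by (intro continuous_intros) (auto simp: max_def)

lemma lg_nonneg: "lg d x \<ge> 0" by (simp add: lg_def)

lemma lg_eq_0: "\<bar>x\<bar> \<ge> 1 \<Longrightarrow> lg d x = 0"
  by (simp add: lg_def max_def)

lemma lg_le: "0 < d \<Longrightarrow> d \<le> 1 \<Longrightarrow> lg d x \<le> ln (1 / d)"
  unfolding lg_def by (auto simp: ln_div intro!: ln_mono)

lemma lg_antimono: "0 < d \<Longrightarrow> d \<le> a \<Longrightarrow> lg a x \<le> lg d x"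
  unfolding lg_def by (intro max.mono order_refl) (auto intro!: ln_mono)

text \<open>An antiderivative of \<open>- ln x\<close> is \<open>x - x * ln x\<close>. The total
  tends to 2 as \<open>d\<close> shrinks, which is why the barrier carries the factor 1/2.\<close>

lemma
  assumes d: "0 < d" "d \<le> 1"
  shows integrable_lg: "integrable lborel (lg d)" and integral_lg: "(\<integral>x. lg d x \<partial>lborel) = 2 - 2 * d"
proof -
  have A: "(lg d has_integral (d * (- ln d))) {0..d}"
  proof -
    have "((\<lambda>x::real. - ln d) has_integral (d * (- ln d))) {0..d}"
      using has_integral_const_real[of "- ln d" 0 d] d by simp
    then show ?thesis
      by (rule has_integral_eq[rotated]) (use d in \<open>auto simp: lg_def max_def\<close>)
  qed
  have B: "(lg d has_integral ((1 - 1 * ln 1) - (d - d * ln d))) {d..1}"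
  proof -
    have "((\<lambda>x. - ln x) has_integral ((1 - 1 * ln 1) - (d - d * ln d))) {d..1}"
      using d by (intro fundamental_theorem_of_calculus)
        (auto intro!: derivative_eq_intros simp: has_real_derivative_iff_has_vector_derivative[symmetric])
    then show ?thesis
    proof (rule has_integral_eq[rotated])
      fix x assume "x \<in> {d..1}"
      then show "- ln x = lg d x" using d by (auto simp: lg_def max_def)
    qed
  qed
  have AB: "(lg d has_integral (1 - d)) {0..1}"
    using has_integral_combine[OF _ _ A B] d by simp
  have "((\<lambda>x. lg d (- x)) has_integral (1 - d)) {-1..-0}"
    using AB by (subst has_integral_reflect_real) simp
  then have "(lg d has_integral (1 - d)) {-1..0}" by (simp add: lg_def [abs_def])
  from has_integral_combine[OF _ _ this AB] have I: "(lg d has_integral (2 - 2 * d)) {-1..1}" by simp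
  have eq: "indicator {-1..1} x *\<^sub>R lg d x = lg d x" for x
    using lg_eq_0[of x d] by (cases "\<bar>x\<bar> \<ge> 1") (auto simp: indicator_def)
  have s: "set_integrable lborel {-1..1} (lg d)"
    using continuous_lg[OF d(1)] by (intro borel_integrable_atLeastAtMost') (auto intro: continuous_on_subset)
  then show "integrable lborel (lg d)" by (simp only: set_integrable_def eq)
  have "(LINT x:{-1..1}|lborel. lg d x) = 2 - 2 * d"
    using set_borel_integral_eq_integral(2)[OF s] integral_unique[OF I] by simp
  then show "(\<integral>x. lg d x \<partial>lborel) = 2 - 2 * d" by (simp only: set_lebesgue_integral_def eq)
qed

lemma lpot_lipschitz:
  assumes d: "d > 0"
  shows "\<bar>lpot d y x - lpot d y x'\<bar> \<le> cmod (x - x') / d"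
proof -
  have "lpot d y x - lpot d y x' \<le> cmod (x - x') / d" for x x'
  proof -
    let ?a = "max d (cmod (x - y))" and ?b = "max d (cmod (x' - y))"
    have ab: "?a > 0" "?b > 0" "?b \<ge> d" using d by (auto simp: less_max_iff_disj)
    have "ln ?a - ln ?b = ln (?a / ?b)" using ln_div[of ?a ?b] ab by simp
    also have "\<dots> \<le> ?a / ?b - 1" using ab by (intro ln_le_minus_one) simp
    also have "\<dots> = (?a - ?b) / ?b" using ab by (simp add: diff_divide_distrib)
    also have "\<dots> \<le> cmod (x - x') / ?b"
    proof (intro divide_right_mono)
      have "cmod (x - y) \<le> cmod (x - x') + cmod (x' - y)" using norm_triangle_ineq[of "x - x'" "x' - y"] by simp
      then show "?a - ?b \<le> cmod (x - x')" using norm_ge_zero[of "x - x'"] by linarith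
    qed (use ab in simp)
    also have "\<dots> \<le> cmod (x - x') / d" using ab d by (intro divide_left_mono) auto
    finally show ?thesis by (simp add: lpot_def)
  qed
  from this[of x x'] this[of x' x] show ?thesis by (simp add: norm_minus_commute)
qed

text \<open>Minus half the potential of length measure on the part \<open>T\<close> of the segment,
  with the logarithm cut off at distance \<open>d\<close>. It replaces a harmonic measure: at most
  1, not positive at distance 2 or more from \<open>z\<close>, harmonic at distance more than
  \<open>d\<close> from \<open>T\<close>, and close to 1 at \<open>z\<close> when \<open>d\<close>
  is small and \<open>T\<close> nearly fills the segment.\<close>

definition barrier :: "real \<Rightarrow> real set \<Rightarrow> complex \<Rightarrow> complex \<Rightarrow> complex \<Rightarrow> real" where
  "barrier d T z w x = - (\<integral>s. indicator T s * lpot d (z + of_real s * w) x \<partial>lborel) / 2"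

context
  fixes d :: real and T :: "real set" and z w :: complex
  assumes d: "0 < d" "d \<le> 1" and T: "compact T" "T \<subseteq> {-1..1}" and w: "cmod w = 1"
begin

lemma T_sets [measurable]: "T \<in> sets borel" using T by (auto intro: borel_compact)

lemma barrier_integrable: "integrable lborel (\<lambda>s. indicator T s * lpot d (z + of_real s * w) x)"
proof -
  have "continuous_on T (\<lambda>s. lpot d (z + of_real s * w) x)"
    unfolding lpot_def using d by (intro continuous_intros) (auto simp: max_def)
  from borel_integrable_compact[OF T(1) this] show ?thesis by simp
qed

lemma measure_T: "measure lborel T \<le> 2" "emeasure lborel T < \<infinity>"
proof -
  have "emeasure lborel T \<le> emeasure lborel {-1..1::real}" using T by (intro emeasure_mono) auto
  then have e: "emeasure lborel T \<le> ennreal 2" by simp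
  then show "measure lborel T \<le> 2" by (simp add: measure_def enn2real_leI)
  show "emeasure lborel T < \<infinity>" using e by (rule le_less_trans) simp
qed

lemma continuous_barrier: "continuous_on UNIV (barrier d T z w)"
proof -
  have "\<bar>barrier d T z w x - barrier d T z w x'\<bar> \<le> cmod (x - x') / d" for x x'
  proof -
    have "barrier d T z w x - barrier d T z w x'
        = - (\<integral>s. indicator T s * lpot d (z + of_real s * w) x - indicator T s * lpot d (z + of_real s * w) x' \<partial>lborel) / 2"
      unfolding barrier_def by (subst Bochner_Integration.integral_diff[OF barrier_integrable barrier_integrable]) (simp add: diff_divide_distrib)
    then have "\<bar>barrier d T z w x - barrier d T z w x'\<bar>
        = \<bar>\<integral>s. indicator T s * lpot d (z + of_real s * w) x - indicator T s * lpot d (z + of_real s * w) x' \<partial>lborel\<bar> / 2" by simp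
    also have "\<dots> \<le> (\<integral>s. \<bar>indicator T s * lpot d (z + of_real s * w) x - indicator T s * lpot d (z + of_real s * w) x'\<bar> \<partial>lborel) / 2"
      by (intro divide_right_mono integral_abs_bound) simp
    also have "\<dots> \<le> (\<integral>s. indicator T s * (cmod (x - x') / d) \<partial>lborel) / 2"
    proof (intro divide_right_mono integral_mono integrable_abs Bochner_Integration.integrable_diff barrier_integrable)
      show "integrable lborel (\<lambda>s. indicator T s * (cmod (x - x') / d))" using measure_T by simp
      fix s
      show "\<bar>indicator T s * lpot d (z + of_real s * w) x - indicator T s * lpot d (z + of_real s * w) x'\<bar> \<le> indicator T s * (cmod (x - x') / d)"
        using lpot_lipschitz[OF d(1)] by (simp add: indicator_def)
    qed simp
    also have "\<dots> = measure lborel T * (cmod (x - x') / d) / 2" by simp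
    also have "\<dots> \<le> 2 * (cmod (x - x') / d) / 2" using d measure_T by (intro divide_right_mono mult_right_mono) auto
    finally show ?thesis by simp
  qed
  then have "dist (barrier d T z w x) (barrier d T z w x') \<le> (1 / d) * dist x x'" for x x'
    by (simp add: dist_norm)
  then have "(1 / d)-lipschitz_on UNIV (barrier d T z w)" using d by (intro lipschitz_onI) auto
  then show ?thesis by (rule lipschitz_on_continuous_on)
qed

text \<open>Projection onto the line of the segment does not increase distances, which reduces the
  estimate to the integral of \<open>lg d\<close> over the line.\<close>

lemma barrier_le_1: "barrier d T z w x \<le> 1"
proof -
  define \<sigma> where "\<sigma> = Re ((x - z) * cnj w)"
  have le: "- lpot d (z + of_real s * w) x \<le> lg d (\<sigma> - s)" for s
  proof -
    have "w * cnj w = 1" using w complex_norm_square[of w] by simp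
    then have "(x - (z + of_real s * w)) * cnj w = (x - z) * cnj w - of_real s" by (simp add: algebra_simps)
    then have "\<bar>\<sigma> - s\<bar> \<le> cmod ((x - (z + of_real s * w)) * cnj w)"
      using abs_Re_le_cmod[of "(x - (z + of_real s * w)) * cnj w"] by (simp add: \<sigma>_def)
    then have "\<bar>\<sigma> - s\<bar> \<le> cmod (x - (z + of_real s * w))" using w by (simp add: norm_mult)
    then have "ln (max d \<bar>\<sigma> - s\<bar>) \<le> lpot d (z + of_real s * w) x"
      unfolding lpot_def using d by (intro ln_mono max.mono) (auto simp: less_max_iff_disj)
    then show ?thesis by (simp add: lg_def)
  qed
  have "- (\<integral>s. indicator T s * lpot d (z + of_real s * w) x \<partial>lborel) = (\<integral>s. - (indicator T s * lpot d (z + of_real s * w) x) \<partial>lborel)" by simp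
  also have "\<dots> \<le> (\<integral>s. lg d (\<sigma> + (-1) * s) \<partial>lborel)"
  proof (rule integral_mono)
    show "integrable lborel (\<lambda>s. - (indicator T s * lpot d (z + of_real s * w) x))" by (intro integrable_minus barrier_integrable)
    show "integrable lborel (\<lambda>s. lg d (\<sigma> + (-1) * s))" using integrable_lg[OF d] by (intro lborel_integrable_real_affine) auto
    show "- (indicator T s * lpot d (z + of_real s * w) x) \<le> lg d (\<sigma> + (-1) * s)" for s
      using le[of s] lg_nonneg[of d "\<sigma> - s"] by (simp add: indicator_def)
  qed
  also have "\<dots> = 2 - 2 * d"
    using lborel_integral_real_affine[of "-1" "lg d" \<sigma>] integral_lg[OF d] by simp
  finally show ?thesis using d by (simp add: barrier_def)
qed

lemma barrier_nonpos:
  assumes "cmod (x - z) \<ge> 2"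
  shows "barrier d T z w x \<le> 0"
proof -
  have "0 \<le> (\<integral>s. indicator T s * lpot d (z + of_real s * w) x \<partial>lborel)"
  proof (intro Bochner_Integration.integral_nonneg)
    fix s
    show "0 \<le> indicator T s * lpot d (z + of_real s * w) x"
    proof (cases "s \<in> T")
      case True
      then have "cmod (of_real s * w) \<le> 1" using T w by (auto simp: norm_mult abs_le_iff)
      then have "1 \<le> cmod (x - (z + of_real s * w))"
        using norm_triangle_ineq2[of "x - z" "of_real s * w"] assms by (simp add: algebra_simps)
      then have "ln 1 \<le> lpot d (z + of_real s * w) x" unfolding lpot_def by (intro ln_mono) auto
      then show ?thesis using True by simp
    qed simp
  qed
  then show ?thesis by (simp add: barrier_def)
qed

lemma cmean_barrier:
  assumes r: "0 < r" and far: "\<And>s. s \<in> T \<Longrightarrow> d + r \<le> cmod (x - (z + of_real s * w))"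
  shows "cmean (barrier d T z w) x r = barrier d T z w x"
proof -
  let ?k = "\<lambda>s \<theta>. indicator T s * lpot d (z + of_real s * w) (x + of_real r * cis \<theta>)"
  have "(\<integral>\<theta>. \<integral>s. ?k s \<theta> \<partial>lborel \<partial>circ) = (\<integral>s. \<integral>\<theta>. ?k s \<theta> \<partial>circ \<partial>lborel)"
  proof (rule real_circ.Fubini_integral, rule integrableI_bounded_set[where A="T \<times> UNIV" and B="\<bar>ln d\<bar> + \<bar>ln (d + cmod x + r + cmod z + 1)\<bar>"])
    show "T \<times> UNIV \<in> sets (lborel \<Otimes>\<^sub>M circ)" by (auto intro!: pair_measureI)
    show "(\<lambda>(s, \<theta>). ?k s \<theta>) \<in> borel_measurable (lborel \<Otimes>\<^sub>M circ)" unfolding lpot_def by measurable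
    have "emeasure (lborel \<Otimes>\<^sub>M circ) (T \<times> UNIV) = emeasure lborel T * emeasure circ UNIV"
      by (rule circ.emeasure_pair_measure_Times) auto
    then show "emeasure (lborel \<Otimes>\<^sub>M circ) (T \<times> UNIV) < \<infinity>" using measure_T by simp
    have "\<bar>lpot d (z + of_real s * w) (x + of_real r * cis \<theta>)\<bar> \<le> \<bar>ln d\<bar> + \<bar>ln (d + cmod x + r + cmod z + 1)\<bar>" if s: "s \<in> T" for s \<theta>
    proof -
      have "cmod (of_real s * w) \<le> 1" using T w s by (auto simp: norm_mult abs_le_iff)
      then have "cmod (x + of_real r * cis \<theta> - (z + of_real s * w)) \<le> cmod x + r + (cmod z + 1)"
        using norm_triangle_ineq4[of "x + of_real r * cis \<theta>" "z + of_real s * w"] norm_circle_point_le[of x r \<theta>]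
          norm_triangle_ineq[of z "of_real s * w"] r by linarith
      then have "lpot d (z + of_real s * w) (x + of_real r * cis \<theta>) \<le> ln (d + cmod x + r + cmod z + 1)"
        unfolding lpot_def using d r by (intro ln_mono) (auto simp: less_max_iff_disj)
      moreover have "ln d \<le> lpot d (z + of_real s * w) (x + of_real r * cis \<theta>)" using d by (intro lpot_ge)
      ultimately show ?thesis by linarith
    qed
    then show "AE p in lborel \<Otimes>\<^sub>M circ. p \<in> T \<times> UNIV \<longrightarrow> norm (case p of (s, \<theta>) \<Rightarrow> ?k s \<theta>) \<le> \<bar>ln d\<bar> + \<bar>ln (d + cmod x + r + cmod z + 1)\<bar>"
      by (intro AE_I2) auto
    show "AE p in lborel \<Otimes>\<^sub>M circ. p \<notin> T \<times> UNIV \<longrightarrow> (case p of (s, \<theta>) \<Rightarrow> ?k s \<theta>) = 0"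
      by (intro AE_I2) (auto simp: indicator_def)
  qed
  also have "\<dots> = (\<integral>s. indicator T s * lpot d (z + of_real s * w) x \<partial>lborel)"
  proof (rule Bochner_Integration.integral_cong[OF refl])
    fix s
    have "(\<integral>\<theta>. ?k s \<theta> \<partial>circ) = indicator T s * cmean (lpot d (z + of_real s * w)) x r"
      by (simp add: cmean_def)
    also have "\<dots> = indicator T s * lpot d (z + of_real s * w) x"
      using cmean_lpot_far[of r d x "z + of_real s * w"] far[of s] r d by (cases "s \<in> T") auto
    finally show "(\<integral>\<theta>. ?k s \<theta> \<partial>circ) = indicator T s * lpot d (z + of_real s * w) x" .
  qed
  finally show ?thesis by (simp add: cmean_def barrier_def)
qed

text \<open>The missing part of the segment could cost \<open>ln (1 / d)\<close> times its length,
  which is useless because \<open>d\<close> depends on the function and may be tiny. A second cutoff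
  \<open>a \<ge> d\<close> limits the loss to \<open>ln (1 / a)\<close> and makes the estimate
  independent of \<open>d\<close>.\<close>

lemma barrier_center:
  assumes a: "d \<le> a" "a \<le> 1" and \<eta>: "measure lborel ({-1..1} - T) \<le> \<eta>"
  shows "1 - a - \<eta> / 2 * ln (1 / a) \<le> barrier d T z w z"
proof -
  have a0: "0 < a" using a d by simp
  let ?S = "{-1..1} - T"
  have [measurable]: "?S \<in> sets borel" by measurable
  have fS: "emeasure lborel ?S < \<infinity>"
    by (rule le_less_trans[OF emeasure_mono[of _ "{-1..1::real}"]]) auto
  have iS: "integrable lborel (\<lambda>s. indicator ?S s * ln (1 / a))" using fS by simp
  have eq: "lg d s - indicator ?S s * lg d s = - (indicator T s * lpot d (z + of_real s * w) z)" for s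
  proof (cases "s \<in> {-1..1}")
    case True
    then have "max d \<bar>s\<bar> \<le> 1" "max d \<bar>s\<bar> > 0" using d by auto
    then have "lg d s = - ln (max d \<bar>s\<bar>)" by (simp add: lg_def)
    moreover have "lpot d (z + of_real s * w) z = ln (max d \<bar>s\<bar>)" using w by (simp add: lpot_def norm_mult)
    ultimately show ?thesis using True by (simp add: indicator_def)
  next
    case False
    then have "lg d s = 0" by (intro lg_eq_0) auto
    moreover have "s \<notin> T" using False T by auto
    ultimately show ?thesis by simp
  qed
  have "(\<integral>s. lg a s \<partial>lborel) \<le> (\<integral>s. (lg d s - indicator ?S s * lg d s) + indicator ?S s * ln (1 / a) \<partial>lborel)"
  proof (rule integral_mono)
    show "integrable lborel (lg a)" using a a0 by (intro integrable_lg)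
    show "integrable lborel (\<lambda>s. (lg d s - indicator ?S s * lg d s) + indicator ?S s * ln (1 / a))"
      unfolding eq using iS barrier_integrable by (intro Bochner_Integration.integrable_add integrable_minus)
    fix s
    show "lg a s \<le> (lg d s - indicator ?S s * lg d s) + indicator ?S s * ln (1 / a)"
      using lg_le[OF a0 a(2), of s] lg_antimono[OF d(1) a(1), of s] by (simp add: indicator_def)
  qed
  also have "\<dots> = - (\<integral>s. indicator T s * lpot d (z + of_real s * w) z \<partial>lborel) + measure lborel ?S * ln (1 / a)"
    unfolding eq using iS barrier_integrable fS by (subst Bochner_Integration.integral_add) auto
  also have "measure lborel ?S * ln (1 / a) \<le> \<eta> * ln (1 / a)" using \<eta> a a0 by (intro mult_right_mono) auto
  finally show ?thesis using integral_lg[OF a0 a(2)] by (simp add: barrier_def)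
qed

end

text \<open>A two-constants theorem, with the logarithmic potential of \<open>T\<close> as barrier. The truncation
  \<open>d\<close> of the potential is chosen so small that \<open>ln \<bar>f\<bar>\<close> is still almost bounded by
  \<open>m\<close> within distance \<open>2 d\<close> of the segment points in \<open>T\<close>.\<close>

lemma two_constants_segment:
  assumes f: "f holomorphic_on UNIV" and w: "cmod w = 1"
    and T: "compact T" "T \<subseteq> {-1..1}"
    and hM: "\<And>x. x \<in> cball z 2 \<Longrightarrow> log_abs f x \<le> ereal M"
    and hm: "\<And>s. s \<in> T \<Longrightarrow> log_abs f (z + of_real s * w) \<le> ereal m"
    and mM: "m \<le> M" and a: "0 < a" "a \<le> 1"
    and \<eta>: "measure lborel ({-1..1} - T) \<le> \<eta>"
  shows "log_abs f z \<le> ereal (m + (M - m) * (a + \<eta> / 2 * ln (1 / a)))"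
proof -
  \<comment> \<open>With \<open>- n \<le> m\<close> the bounds \<open>m\<close> and \<open>M\<close>
    pass to the truncated logarithm.\<close>
  obtain n :: nat where n: "- m \<le> real n" using real_arch_simple by blast
  let ?v = "tlog f n"
  have v: "rsh ?v" by (rule rsh_tlog[OF f])
  have cv: "continuous_on UNIV ?v" by (rule continuous_tlog[OF f])
  have vM: "?v x \<le> M" if "x \<in> cball z 2" for x
  proof -
    have "ereal (?v x) \<le> ereal M" unfolding tlog_ereal using hM[OF that] mM n by simp
    then show ?thesis by simp
  qed
  have vm: "?v (z + of_real s * w) \<le> m" if "s \<in> T" for s
  proof -
    have "ereal (?v (z + of_real s * w)) \<le> ereal m" unfolding tlog_ereal using hm[OF that] n by simp
    then show ?thesis by simp
  qed
  have "log_abs f z \<le> ereal (?v z)" by (simp add: tlog_ereal)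
  also have "?v z \<le> m + (M - m) * (a + \<eta> / 2 * ln (1 / a))"
  proof (rule field_le_epsilon)
    fix \<epsilon> :: real assume \<epsilon>: "\<epsilon> > 0"
    have "uniformly_continuous_on (cball z 2) ?v"
      using cv by (intro compact_uniformly_continuous) (auto intro: continuous_on_subset)
    then obtain d0 where d0: "d0 > 0" "\<And>x y. x \<in> cball z 2 \<Longrightarrow> y \<in> cball z 2 \<Longrightarrow> dist y x < d0 \<Longrightarrow> dist (?v y) (?v x) < \<epsilon>"
      unfolding uniformly_continuous_on_def using \<epsilon> by metis
    define d where "d = min a (d0 / 2)"
    have d: "0 < d" "d \<le> 1" "d \<le> a" "2 * d \<le> d0" using a d0 by (auto simp: d_def)
    let ?G = "barrier d T z w"
    \<comment> \<open>On the outer circle the barrier is not positive and \<open>?v \<le> M\<close>;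
      near \<open>T\<close> the barrier is at most 1 and \<open>?v \<le> m + \<epsilon>\<close>.
      Both give \<open>?F \<le> M + \<epsilon>\<close>, and at \<open>z\<close> a barrier close to 1
      subtracts almost \<open>M - m\<close>.\<close>
    let ?F = "\<lambda>x. ?v x + (M - m) * ?G x"
    define \<Gamma> where "\<Gamma> = sphere z 2 \<union> {x. \<exists>s\<in>T. cmod (x - (z + of_real s * w)) < 2 * d}"
    have cG: "continuous_on UNIV ?G" by (rule continuous_barrier[OF d(1,2) T w])
    have cF: "continuous_on UNIV ?F" by (intro continuous_intros cv cG)
    obtain e where e: "e > 0" "\<And>x r. cmod x \<le> cmod z + 2 \<Longrightarrow> 0 < r \<Longrightarrow> r \<le> e \<Longrightarrow> ?v x \<le> cmean ?v x r"
      using v unfolding rsh_def by meson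
    have "?F z \<le> M + \<epsilon>"
    proof (rule max_principle[where F="?F" and x=z and K="cball z 2" and \<Gamma>=\<Gamma>])
      show "z \<in> cball z 2" by (subst mem_cball) simp
      show "compact (cball z 2)" by (rule compact_cball)
      show "usc ?F" using cF by (rule usc_continuous)
      show "locbdd ?F" using cF by (rule locbdd_continuous)
    next
      fix x assume x: "x \<in> cball z 2" "x \<notin> \<Gamma>"
      \<comment> \<open>Outside the \<open>2 * d\<close> neighbourhood of \<open>T\<close>, a circle
        of radius \<open>r \<le> d\<close> stays at distance \<open>d\<close> from \<open>T\<close>,
        where the cut-off has no effect on the logarithms.\<close>
      define r where "r = min (min d e) (2 - dist z x)"
      have r: "r > 0" "r \<le> d" "r \<le> e" using x d e by (auto simp: r_def \<Gamma>_def)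
      have "cball x r \<subseteq> cball z 2"
      proof
        fix y assume "y \<in> cball x r"
        then show "y \<in> cball z 2" using dist_triangle[of z y x] by (auto simp: r_def)
      qed
      moreover have "?F x \<le> cmean ?F x r"
      proof -
        have "cmod x \<le> cmod z + 2" using x norm_triangle_ineq2[of x z] by (simp add: dist_norm norm_minus_commute)
        then have "?v x \<le> cmean ?v x r" using r by (intro e)
        moreover have "cmean ?G x r = ?G x"
        proof (rule cmean_barrier[OF d(1,2) T w r(1)])
          fix s assume "s \<in> T"
          then have "2 * d \<le> cmod (x - (z + of_real s * w))" using x(2) by (auto simp: \<Gamma>_def not_less)
          then show "d + r \<le> cmod (x - (z + of_real s * w))" using r by simp
        qed
        moreover have "cmean ?F x r = cmean ?v x r + (M - m) * cmean ?G x r"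
          using cv cG by (simp add: cmean_add cmean_cmult locbdd_continuous locbdd_cmult)
        ultimately show ?thesis by simp
      qed
      ultimately show "\<exists>r>0. cball x r \<subseteq> cball z 2 \<and> ?F x \<le> cmean ?F x r" using r by blast
    next
      fix x assume x: "x \<in> cball z 2" "x \<in> \<Gamma>"
      show "?F x \<le> M + \<epsilon>"
      proof (cases "x \<in> sphere z 2")
        case True
        then have "?G x \<le> 0" by (intro barrier_nonpos[OF d(1,2) T w]) (simp add: dist_norm norm_minus_commute)
        then have "(M - m) * ?G x \<le> 0" using mM by (intro mult_nonneg_nonpos) auto
        then show ?thesis using vM[OF x(1)] \<epsilon> by simp
      next
        case False
        then obtain s where s: "s \<in> T" "cmod (x - (z + of_real s * w)) < 2 * d" using x(2) by (auto simp: \<Gamma>_def)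
        have "cmod (of_real s * w) \<le> 1" using T s(1) w by (auto simp: norm_mult abs_le_iff)
        then have "z + of_real s * w \<in> cball z 2" by (simp add: dist_norm)
        then have "dist (?v x) (?v (z + of_real s * w)) < \<epsilon>" using x s d by (intro d0(2)) (auto simp: dist_norm)
        then have "?v x \<le> m + \<epsilon>" using vm[OF s(1)] by (simp add: dist_real_def abs_less_iff)
        moreover have "(M - m) * ?G x \<le> (M - m) * 1" using mM by (intro mult_left_mono barrier_le_1[OF d(1,2) T w]) auto
        ultimately show ?thesis by simp
      qed
    qed
    moreover have "(M - m) * (1 - a - \<eta> / 2 * ln (1 / a)) \<le> (M - m) * ?G z"
      using mM by (intro mult_left_mono barrier_center[OF d(1,2) T w d(3) a(2) \<eta>]) auto
    ultimately show "?v z \<le> m + (M - m) * (a + \<eta> / 2 * ln (1 / a)) + \<epsilon>" by (simp add: algebra_simps)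
  qed
  finally show ?thesis by simp
qed

section \<open>The indicator along a ray\<close>

lemma segment_exceptional_measure:
  assumes S: "open E" and r: "r > 1" and w: "cmod w = 1"
  shows "emeasure lborel {s\<in>{-1..1::real}. of_real (r + s) * w \<in> E} \<le> ray_measure 0 w (E - ball 0 (r - 1))"
proof -
  let ?Y = "{s::real. r - 1 \<le> s \<and> of_real s * w \<in> E}"
  have "open ((\<lambda>s::real. of_real s * w) -` E)" by (intro open_vimage S continuous_intros)
  then have "{r - 1..} \<inter> (\<lambda>s::real. of_real s * w) -` E \<in> sets borel" by (intro sets.Int) auto
  moreover have "{r - 1..} \<inter> (\<lambda>s::real. of_real s * w) -` E = ?Y" by auto
  ultimately have Y [measurable]: "?Y \<in> sets borel" by simp
  have V: "(+) r -` ?Y \<in> sets borel" by (rule measurable_sets_borel[OF _ Y]) simp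
  have "{s\<in>{-1..1::real}. of_real (r + s) * w \<in> E} \<subseteq> (+) r -` ?Y" by auto
  then have "emeasure lborel {s\<in>{-1..1::real}. of_real (r + s) * w \<in> E} \<le> emeasure lborel ((+) r -` ?Y)"
    by (rule emeasure_mono) (simp only: V sets_lborel)
  also have "\<dots> = emeasure (distr lborel borel ((+) r)) ?Y"
    by (subst emeasure_distr) auto
  also have "\<dots> = emeasure lebesgue ?Y" by (simp add: lborel_distr_plus)
  also have "?Y = {s::real. 0 \<le> s \<and> 0 + of_real s * w \<in> E - ball 0 (r - 1)}"
    using r w by (auto simp: norm_mult abs_if)
  finally show ?thesis by (simp only: ray_measure_def)
qed

context subharm
begin

lemma disk_sup_less_PInf: "disk_sup u z r < \<infinity>"
proof -
  obtain b where b: "\<And>w. cmod w \<le> cmod z + r \<Longrightarrow> \<bar>trunc u 0 w\<bar> \<le> b"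
    using locbdd_trunc[of 0] by (metis locbdd_bound)
  have "disk_sup u z r \<le> ereal b"
    unfolding disk_sup_def
  proof (rule SUP_least)
    fix w assume "w \<in> cball z r"
    then have "cmod w \<le> cmod z + r" using norm_triangle_ineq2[of w z] by (simp add: dist_norm norm_minus_commute)
    then have "trunc u 0 w \<le> b" using b[of w] by simp
    then show "u w \<le> ereal b" using u_le_trunc[of w 0] by (meson ereal_less_eq(3) order_trans)
  qed
  then show ?thesis by (rule le_less_trans) simp
qed

text \<open>The two-constants theorem is applied on the segment of the ray within distance 1 of
  \<open>r * cis s\<close>. Both constants are of order at most \<open>r powr p\<close>, so a
  fraction \<open>2 * a\<close> of their difference adds at most \<open>2 * a * D\<close> in the
  limit, and \<open>a\<close> may be taken small.\<close>

lemma indicator_of_growth_minorant_le: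
  assumes ms: "minorant_by_means u q f" and md: "minorant_off_disks u (q + 1) f K c t"
    and q: "q \<ge> 0" and p: "p \<ge> 0" and ty: "growth_type p u < \<infinity>"
  shows "indicator_of_growth p (log_abs f) s \<le> indicator_of_growth p u s"
  unfolding indicator_of_growth_def[of p "log_abs f"] Limsup_le_iff[of at_top]
proof (intro allI impI)
  fix y assume y: "indicator_of_growth p u s < y"
  have f: "f holomorphic_on UNIV" using md by (auto simp: minorant_off_disks_def nonzero_entire_def)
  let ?w = "cis s"
  define E where "E = disk_union K c t"
  have E: "open E" by (auto simp: E_def disk_union_def)
  have off: "log_abs f x \<le> u x" if "x \<notin> E" for x using md that by (auto simp: minorant_off_disks_def E_def)
  obtain b' where b': "indicator_of_growth p u s < ereal b'" "ereal b' < y" using ereal_dense2[OF y] by blast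
  obtain b where b: "indicator_of_growth p u s < ereal b" "b < b'" using ereal_dense2[OF b'(1)] by auto
  obtain A0 where A0: "growth_type p u < ereal A0" using ereal_dense2[OF ty] by blast
  define A where "A = max A0 0"
  \<comment> \<open>A bound for \<open>b * x powr p\<close> on the segment for either sign of
    \<open>b\<close>: the value at the centre plus the oscillation of the power, which is negligible
    against \<open>r powr p\<close>.\<close>
  define m where "m r = b * r powr p + \<bar>b\<bar> * ((r + 1) powr p - (r + (-1)) powr p)" for r
  \<comment> \<open>Points within distance 2 have modulus at most \<open>r + 2\<close>, and
    \<open>disk_sup_minorant_le\<close> adds 1. The terms with \<open>\<bar>b\<bar>\<close> ensure
    \<open>m r \<le> M r\<close>.\<close>
  define M where "M r = (A + \<bar>b\<bar>) * (r + 3) powr p + \<bar>b\<bar> * ((r + 1) powr p - (r + (-1)) powr p)" for r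
  \<comment> \<open>The limit of \<open>(M r - m r) / r powr p\<close>.\<close>
  define D where "D = A + \<bar>b\<bar> - b"
  have D: "D \<ge> 0" by (auto simp: D_def A_def)
  define a where "a = min (1/2) ((b' - b) / (4 * (D + 1)))"
  have a: "0 < a" "a \<le> 1" "2 * a * D < b' - b"
  proof -
    show "0 < a" using b(2) D by (simp add: a_def)
    show "a \<le> 1" by (simp add: a_def)
    have "2 * a * D \<le> 2 * ((b' - b) / (4 * (D + 1))) * D" using D by (intro mult_right_mono mult_left_mono) (auto simp: a_def)
    also have "\<dots> < b' - b"
    proof -
      have "(b' - b) * (2 * D) < (b' - b) * (4 * (D + 1))" using b(2) D by (intro mult_strict_left_mono) auto
      moreover have "4 * (D + 1) > 0" using D by simp
      ultimately have "(b' - b) * (2 * D) / (4 * (D + 1)) < b' - b" by (subst pos_divide_less_eq) auto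
      then show ?thesis by (simp add: mult_ac)
    qed
    finally show "2 * a * D < b' - b" .
  qed
  \<comment> \<open>Chosen so that the loss from the exceptional part of the segment is at most
    another \<open>a\<close>, whence the factor \<open>2 * a\<close>.\<close>
  define \<eta> where "\<eta> = a / (ln (1 / a) + 1)"
  have ln0: "ln (1 / a) \<ge> 0" using a by simp
  have \<eta>: "\<eta> > 0" "\<eta> / 2 * ln (1 / a) \<le> a"
  proof -
    show "\<eta> > 0" unfolding \<eta>_def by (intro divide_pos_pos a(1)) (use ln0 in linarith)
    have "\<eta> * ln (1 / a) \<le> \<eta> * (ln (1 / a) + 1)" using \<open>\<eta> > 0\<close> by (intro mult_left_mono) auto
    also have "\<dots> = a" using ln0 by (simp add: \<eta>_def)
    finally have "\<eta> * ln (1 / a) \<le> a" .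
    moreover have "0 \<le> \<eta> * ln (1 / a)" using \<open>\<eta> > 0\<close> ln0 by simp
    ultimately show "\<eta> / 2 * ln (1 / a) \<le> a" by simp
  qed
  have "eventually (\<lambda>r. u (of_real r * ?w) / ereal (r powr p) < ereal b \<and> r > 0) at_top"
    using Limsup_lessD[OF b(1)[unfolded indicator_of_growth_def]] eventually_gt_at_top[of 0] by eventually_elim auto
  then obtain r1 where r1: "\<And>r. r \<ge> r1 \<Longrightarrow> u (of_real r * ?w) / ereal (r powr p) < ereal b \<and> r > 0"
    by (auto simp: eventually_at_top_linorder)
  have ub: "u (of_real r * ?w) \<le> ereal (b * r powr p)" if "r \<ge> r1" for r
    using r1[OF that] u_less_PInf[of "of_real r * ?w"]
    by (cases "u (of_real r * ?w)") (auto simp: field_simps)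
  have "eventually (\<lambda>r. max 0 (disk_sup u 0 r) / ereal (r powr p) < ereal A0 \<and> r > 0) at_top"
    using Limsup_lessD[OF A0[unfolded growth_type_def radial_type_def]] eventually_gt_at_top[of 0] by eventually_elim auto
  then obtain r2 where r2: "\<And>r. r \<ge> r2 \<Longrightarrow> max 0 (disk_sup u 0 r) / ereal (r powr p) < ereal A0 \<and> r > 0"
    by (auto simp: eventually_at_top_linorder)
  have uA: "disk_sup u 0 r \<le> ereal (A * r powr p)" if r: "r \<ge> r2" for r
  proof (cases "disk_sup u 0 r")
    case (real x)
    have "max 0 x / r powr p < A0" "r > 0" using r2[OF r] real by (auto simp: max_def zero_ereal_def split: if_splits)
    then have "max 0 x < A0 * r powr p" by (simp add: field_simps)
    also have "\<dots> \<le> A * r powr p" by (intro mult_right_mono) (auto simp: A_def)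
    finally show ?thesis using real by simp
  qed (use disk_sup_less_PInf[of 0 r] in auto)
  have "bigo_inverse_power (q + 1) (\<lambda>R. ray_measure 0 ?w (E - ball 0 R))"
    unfolding E_def using md q by (intro exceptional_ray_measure) auto
  then obtain A1 where "eventually (\<lambda>R. ray_measure 0 ?w (E - ball 0 R) \<le> ennreal (A1 * (1 / R powr (q + 1)))) at_top"
    by (auto simp: bigo_inverse_power_def)
  moreover have "((\<lambda>R::real. A1 * (1 / R powr (q + 1))) \<longlongrightarrow> A1 * 0) at_top"
  proof (intro tendsto_intros)
    have "((\<lambda>R::real. R powr (- (q + 1))) \<longlongrightarrow> 0) at_top" using q by (intro tendsto_neg_powr filterlim_ident) auto
    then show "((\<lambda>R::real. 1 / R powr (q + 1)) \<longlongrightarrow> 0) at_top" by (simp only: powr_minus_divide)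
  qed
  then have "eventually (\<lambda>R. A1 * (1 / R powr (q + 1)) < \<eta>) at_top" using \<eta>(1) by (intro order_tendstoD) auto
  ultimately have "eventually (\<lambda>R. ray_measure 0 ?w (E - ball 0 R) \<le> ennreal \<eta>) at_top"
    by eventually_elim (meson ennreal_leI less_imp_le order_trans)
  then obtain r3 where r3: "\<And>R. R \<ge> r3 \<Longrightarrow> ray_measure 0 ?w (E - ball 0 R) \<le> ennreal \<eta>"
    by (auto simp: eventually_at_top_linorder)
  have bound: "log_abs f (of_real r * ?w) \<le> ereal (m r + (M r - m r) * (2 * a))"
    if r: "r \<ge> max (max (r1 + 1) r2) (max (r3 + 1) 3)" for r
  proof -
    have rr: "r \<ge> r1 + 1" "r \<ge> r2" "r \<ge> r3 + 1" "r \<ge> 3" using r by auto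
    define T where "T = {s\<in>{-1..1::real}. of_real (r + s) * ?w \<notin> E}"
    have ST: "{-1..1} - T = {s\<in>{-1..1::real}. of_real (r + s) * ?w \<in> E}" by (auto simp: T_def)
    have "closed ((\<lambda>s::real. of_real (r + s) * ?w) -` (- E))"
      using E by (intro closed_vimage continuous_intros) auto
    moreover have "T = {-1..1} \<inter> (\<lambda>s::real. of_real (r + s) * ?w) -` (- E)" by (auto simp: T_def)
    ultimately have T: "compact T" by (simp add: compact_Int_closed)
    have zs: "of_real r * ?w + of_real s * ?w = of_real (r + s) * ?w" for s by (simp add: distrib_right)
    have mono: "(r + (-1)) powr p \<le> (r + s) powr p" "(r + s) powr p \<le> (r + 1) powr p" "(r + s) powr p \<le> (r + 3) powr p"
      if "s \<in> {-1..1}" for s using that rr p by (auto intro!: powr_mono2)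
    have d1: "0 \<le> (r + 1) powr p - (r + (-1)) powr p" using mono[of 1] by simp
    have mM: "m r \<le> M r"
    proof -
      have "b * r powr p \<le> (A + \<bar>b\<bar>) * (r + 3) powr p"
        using mono(3)[of 0] by (intro mult_mono) (auto simp: A_def)
      then show ?thesis by (simp add: m_def M_def)
    qed
    have "log_abs f (of_real r * ?w) \<le> ereal (m r + (M r - m r) * (a + \<eta> / 2 * ln (1 / a)))"
    proof (rule two_constants_segment[OF f _ T _ _ _ mM a(1,2)])
      show "cmod ?w = 1" by simp
      show "T \<subseteq> {-1..1}" by (auto simp: T_def)
      show "log_abs f x \<le> ereal (M r)" if x: "x \<in> cball (of_real r * ?w) 2" for x
      proof -
        have "cmod x \<le> r + 2" using x norm_triangle_ineq2[of x "of_real r * ?w"] rr by (simp add: dist_norm norm_minus_commute norm_mult)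
        then have "log_abs f x \<le> disk_sup (log_abs f) 0 (r + 2)"
          unfolding disk_sup_def by (intro SUP_upper) simp
        also have "\<dots> \<le> disk_sup u 0 (r + 2 + 1)" using rr by (intro disk_sup_minorant_le[OF ms q]) auto
        also have "\<dots> \<le> ereal (A * (r + 3) powr p)" using rr uA[of "r + 2 + 1"] by (simp add: add.assoc)
        also have "A * (r + 3) powr p \<le> M r"
        proof -
          have "A * (r + 3) powr p \<le> (A + \<bar>b\<bar>) * (r + 3) powr p" by (intro mult_right_mono) auto
          moreover have "0 \<le> \<bar>b\<bar> * ((r + 1) powr p - (r + (-1)) powr p)" using d1 by simp
          ultimately show ?thesis unfolding M_def by linarith
        qed
        finally show ?thesis by simp
      qed
      show "log_abs f (of_real r * ?w + of_real s * ?w) \<le> ereal (m r)" if s: "s \<in> T" for s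
      proof -
        have s1: "s \<in> {-1..1}" "of_real (r + s) * ?w \<notin> E" using s by (auto simp: T_def)
        have "log_abs f (of_real (r + s) * ?w) \<le> u (of_real (r + s) * ?w)" using s1 by (intro off)
        also have "\<dots> \<le> ereal (b * (r + s) powr p)" using rr s1 by (intro ub) auto
        also have "b * (r + s) powr p \<le> m r"
        proof -
          have "b * ((r + s) powr p - r powr p) \<le> \<bar>b\<bar> * ((r + 1) powr p - (r + (-1)) powr p)"
          proof (rule order_trans[OF abs_ge_self])
            have "\<bar>(r + s) powr p - r powr p\<bar> \<le> (r + 1) powr p - (r + (-1)) powr p"
              using mono[OF s1(1)] mono[of 0] by (simp add: abs_le_iff)
            then show "\<bar>b * ((r + s) powr p - r powr p)\<bar> \<le> \<bar>b\<bar> * ((r + 1) powr p - (r + (-1)) powr p)"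
              unfolding abs_mult by (intro mult_left_mono) auto
          qed
          then show ?thesis by (simp add: m_def right_diff_distrib)
        qed
        finally show ?thesis by (simp add: zs)
      qed
      have "emeasure lborel ({-1..1} - T) \<le> ray_measure 0 ?w (E - ball 0 (r - 1))"
        unfolding ST using rr by (intro segment_exceptional_measure[OF E]) auto
      also have "\<dots> \<le> ennreal \<eta>" using rr by (intro r3) auto
      finally show "measure lborel ({-1..1} - T) \<le> \<eta>"
        using \<eta>(1) by (simp add: measure_def enn2real_leI)
    qed
    also have "m r + (M r - m r) * (a + \<eta> / 2 * ln (1 / a)) \<le> m r + (M r - m r) * (2 * a)"
      using mM \<eta>(2) by (intro add_left_mono mult_left_mono) auto
    finally show ?thesis by simp
  qed
  have lim1: "((\<lambda>r. m r / r powr p) \<longlongrightarrow> b * 1 + \<bar>b\<bar> * (1 - 1)) at_top"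
  proof (rule Lim_transform_eventually)
    show "((\<lambda>r. b * 1 + \<bar>b\<bar> * ((r + 1) powr p / r powr p - (r + (-1)) powr p / r powr p)) \<longlongrightarrow> b * 1 + \<bar>b\<bar> * (1 - 1)) at_top"
      by (intro tendsto_intros powr_shift_tendsto)
    show "eventually (\<lambda>r. b * 1 + \<bar>b\<bar> * ((r + 1) powr p / r powr p - (r + (-1)) powr p / r powr p) = m r / r powr p) at_top"
      using eventually_gt_at_top[of 0] by eventually_elim (simp add: m_def add_divide_distrib diff_divide_distrib right_diff_distrib)
  qed
  have lim2: "((\<lambda>r. M r / r powr p) \<longlongrightarrow> (A + \<bar>b\<bar>) * 1 + \<bar>b\<bar> * (1 - 1)) at_top"
  proof (rule Lim_transform_eventually)
    show "((\<lambda>r. (A + \<bar>b\<bar>) * ((r + 3) powr p / r powr p) + \<bar>b\<bar> * ((r + 1) powr p / r powr p - (r + (-1)) powr p / r powr p)) \<longlongrightarrow> (A + \<bar>b\<bar>) * 1 + \<bar>b\<bar> * (1 - 1)) at_top"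
      by (intro tendsto_intros powr_shift_tendsto)
    show "eventually (\<lambda>r. (A + \<bar>b\<bar>) * ((r + 3) powr p / r powr p) + \<bar>b\<bar> * ((r + 1) powr p / r powr p - (r + (-1)) powr p / r powr p) = M r / r powr p) at_top"
      using eventually_gt_at_top[of 0] by eventually_elim (simp add: M_def add_divide_distrib diff_divide_distrib right_diff_distrib)
  qed
  have "((\<lambda>r. m r / r powr p + (M r / r powr p - m r / r powr p) * (2 * a)) \<longlongrightarrow> b + D * (2 * a)) at_top"
    using tendsto_add[OF lim1 tendsto_mult[OF tendsto_diff[OF lim2 lim1] tendsto_const[of "2 * a"]]] by (simp add: D_def)
  moreover have "b + D * (2 * a) < b'" using a(3) by (simp add: mult_ac)
  ultimately have "eventually (\<lambda>r. m r / r powr p + (M r / r powr p - m r / r powr p) * (2 * a) < b') at_top"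
    by (rule order_tendstoD)
  then show "eventually (\<lambda>r. log_abs f (of_real r * ?w) / ereal (r powr p) < y) at_top"
    using eventually_gt_at_top[of 0] eventually_ge_at_top[of "max (max (r1 + 1) r2) (max (r3 + 1) 3)"]
  proof eventually_elim
    case (elim r)
    let ?v = "m r + (M r - m r) * (2 * a)"
    have pos: "r powr p > 0" using elim by simp
    have "log_abs f (of_real r * ?w) / ereal (r powr p) \<le> ereal ?v / ereal (r powr p)"
      using pos by (intro ereal_divide_right_mono bound[OF elim(3)]) auto
    also have "\<dots> = ereal (m r / r powr p + (M r / r powr p - m r / r powr p) * (2 * a))"
    proof -
      have "?v / x = m r / x + (M r / x - m r / x) * (2 * a)" for x
        by (simp only: add_divide_distrib diff_divide_distrib times_divide_eq_left [symmetric])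
      then show ?thesis using pos by simp
    qed
    also have "\<dots> < ereal b'" using elim(1) by simp
    finally show ?case using b'(2) by (rule less_trans)
  qed
qed

lemma growth_restrictions_minorant:
  assumes ms: "minorant_by_means u q f" and md: "minorant_off_disks u (q + 1) f K c t" and q: "q \<ge> 0"
  shows "growth_restrictions u f"
  unfolding growth_restrictions_def growth_order_def growth_type_def
  using radial_order_shift[of "disk_sup (log_abs f) 0" "disk_sup u 0"] radial_type_shift[of "disk_sup (log_abs f) 0" "disk_sup u 0"]
    disk_sup_minorant_le[OF ms q] indicator_of_growth_minorant_le[OF ms md q, unfolded growth_type_def] by blast

end

theorem theorem2:
  fixes u :: "complex \<Rightarrow> ereal"
  assumes "subharmonic u"
    and "\<exists>z. u z \<noteq> -\<infinity>"
    and "radial_order (disk_mean u 0) < \<infinity>"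
  shows
    "((\<forall>q\<ge>0. \<exists>f. minorant_by_means u q f) \<longleftrightarrow>
      (\<forall>q\<ge>0. \<exists>f K c t. minorant_off_disks u q f K c t))
     \<and>
     (growth_order u < \<infinity> \<longrightarrow>
       ((\<forall>q\<ge>0. \<exists>f. minorant_by_means u q f) \<longrightarrow>
        (\<forall>q\<ge>0. \<exists>f. minorant_by_means u q f \<and> growth_restrictions u f)) \<and>
       ((\<forall>q\<ge>0. \<exists>f K c t. minorant_off_disks u q f K c t) \<longrightarrow>
        (\<forall>q\<ge>0. \<exists>f K c t. minorant_off_disks u q f K c t \<and> growth_restrictions u f)))
     \<and>
     (\<forall>q\<ge>0. \<forall>f K c t. minorant_off_disks u q f K c t \<longrightarrow>
       (\<forall>a w. cmod w = 1 \<longrightarrow>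
          bigo_inverse_power q (\<lambda>R. ray_measure a w (disk_union K c t - ball 0 R))) \<and>
       bigo_inverse_power q (\<lambda>R. circle_measure R (disk_union K c t \<inter> sphere 0 R)))"
proof -
  obtain z0 where "u z0 \<noteq> -\<infinity>" using assms(2) by blast
  with assms(1) interpret subharm u z0 by unfold_locales
  let ?A = "\<forall>q\<ge>0. \<exists>f. minorant_by_means u q f"
  let ?B = "\<forall>q\<ge>0. \<exists>f K c t. minorant_off_disks u q f K c t"
  have AB: ?B if ?A using minorant_off_disks_exists[OF assms(3) that] by blast
  \<comment> \<open>One function at \<open>q\<close>, built from (B) at \<open>q + 1\<close>, serves
    both statements together with the growth restrictions; (A) reaches it through (B).\<close>
  have both: "\<exists>f K c t. minorant_by_means u q f \<and> minorant_off_disks u q f K c t \<and> growth_restrictions u f"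
    if B: ?B and q: "q \<ge> 0" for q
  proof -
    have "q + 1 \<ge> 0" using q by simp
    then obtain f K c t where "minorant_off_disks u (q + 1) f K c t" using B by blast
    then obtain g where g: "minorant_by_means u q g" "minorant_off_disks u (q + 1) g K c t"
      using minorant_by_means_exists q by blast
    then show ?thesis using growth_restrictions_minorant[OF g q] minorant_off_disks_weaken[OF g(2)] by blast
  qed
  have measures: "(\<forall>a w. cmod w = 1 \<longrightarrow> bigo_inverse_power q (\<lambda>R. ray_measure a w (disk_union K c t - ball 0 R))) \<and>
       bigo_inverse_power q (\<lambda>R. circle_measure R (disk_union K c t \<inter> sphere 0 R))"
    if "q \<ge> 0" "minorant_off_disks u q f K c t" for q f K c t
    using exceptional_ray_measure[OF that(2,1)] exceptional_circle_measure[OF that(2,1)] by blast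
  have "?A \<longleftrightarrow> ?B" using AB both by blast
  moreover have "?B \<longrightarrow> (\<forall>q\<ge>0. \<exists>f. minorant_by_means u q f \<and> growth_restrictions u f)" using both by blast
  moreover have "?B \<longrightarrow> (\<forall>q\<ge>0. \<exists>f K c t. minorant_off_disks u q f K c t \<and> growth_restrictions u f)" using both by blast
  ultimately show ?thesis using measures by blast
qed

end
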